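(* Let $q\ge3$, let $\lambda_1,\dots,\lambda_q$ be distinct non-zero real numbers, and let $e_1,\dots,e_q$ be $q$ distinct orthonormal functions of $L^2(0,1)$ such that $e_m\in\mathcal{C}^\alpha([0,1])$ for some $\alpha\in(0,1]$. Let $$K_q(x,y)=\sum_{m=1}^q\lambda_me_m(x)e_m(y),\qquad a_{i,j}(n)=\frac1nK_q\Big(\frac in,\frac jn\Big),\quad 1\le i,j\le n.$$ Let $(X_i)_{i\ge1}$ be i.i.d. centered random variables with $\mathbb{E}[X_i^2]=1$ and $\mathbb{E}[X_i^4]<+\infty$, and $(Z_i)_{i\ge1}$ i.i.d. standard normal random variables. Set $$\tilde a_{i,j}(n)=\frac{a_{i,j}(n)}{\big(\sum_{i,j=1}^na_{i,j}(n)^2\big)^{1/2}},\quad \tilde\lambda_m=\frac{\lambda_m}{\big(\sum_{l=1}^q\lambda_l^2\big)^{1/2}},\quad \tilde Q_n(X)=\sum_{i,j=1}^n\tilde a_{i,j}(n)X_iX_j,\quad \tilde Q_\infty=\sum_{m=1}^q\tilde\lambda_m(Z_m^2-1).$$ Then there are constants $C_1,C_2>0$, independent of $n$, such that $$d_{\mathrm{Kol}}\big(\tilde Q_n(X)-\mathbb{E}[\tilde Q_n(X)],\tilde Q_\infty\big)\le\frac{C_1}{n^{1/16}}+\frac{C_2}{n^{\alpha/4}}.$$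
   Context: $d_{\mathrm{Kol}}(F,G)=\sup_{x\in\mathbb{R}}|\mathbb{P}(F\le x)-\mathbb{P}(G\le x)|$. $\mathcal{C}^\alpha([0,1])$ is the space of real-valued functions on $[0,1]$ that are Hölder continuous of order $\alpha$. The normalized coefficients $\tilde a_{i,j}(n)$ are defined for those $n$ with $\sum_{i,j}a_{i,j}(n)^2\ne0$ (all sufficiently large $n$), and the bound is for those $n$. *)

theory Defs
  imports "HOL-Probability.Probability"
begin

text \<open>
  A function with domain $[0,1]$ or $(0,1)$ is a total function on the reals whose values
  outside that interval are ignored. Families such as the eigenvalues, the functions and the
  random variables are indexed from 1; their values at index 0 are ignored.
\<close>

definition holder_continuous_on :: "real \<Rightarrow> real set \<Rightarrow> (real \<Rightarrow> real) \<Rightarrow> bool" where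
  "holder_continuous_on \<alpha> S f \<longleftrightarrow>
     (\<exists>C. \<forall>x\<in>S. \<forall>y\<in>S. \<bar>f x - f y\<bar> \<le> C * \<bar>x - y\<bar> powr \<alpha>)"

definition in_L2 :: "real set \<Rightarrow> (real \<Rightarrow> real) \<Rightarrow> bool" where
  "in_L2 S f \<longleftrightarrow> f \<in> borel_measurable (lebesgue_on S) \<and>
     integrable (lebesgue_on S) (\<lambda>x. (f x)\<^sup>2)"

definition orthonormal_L2 :: "real set \<Rightarrow> 'i set \<Rightarrow> ('i \<Rightarrow> real \<Rightarrow> real) \<Rightarrow> bool" where
  "orthonormal_L2 S I e \<longleftrightarrow> (\<forall>m\<in>I. in_L2 S (e m)) \<and>
     (\<forall>m\<in>I. \<forall>l\<in>I. (LINT x|lebesgue_on S. e m x * e l x) = (if m = l then 1 else 0))"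

definition iid_seq :: "'a measure \<Rightarrow> (nat \<Rightarrow> 'a \<Rightarrow> real) \<Rightarrow> bool" where
  "iid_seq M X \<longleftrightarrow> prob_space.indep_vars M (\<lambda>_. borel) X {1..} \<and>
     (\<forall>i\<ge>1. \<forall>j\<ge>1. distr M borel (X i) = distr M borel (X j))"

text \<open>
  The Kolmogorov distance depends only on the two laws, so the two variables may live on
  different probability spaces.
\<close>
definition d_Kol :: "'a measure \<Rightarrow> ('a \<Rightarrow> real) \<Rightarrow> 'b measure \<Rightarrow> ('b \<Rightarrow> real) \<Rightarrow> real" where
  "d_Kol M F N G = (SUP x. \<bar>\<P>(\<omega> in M. F \<omega> \<le> x) - \<P>(\<omega> in N. G \<omega> \<le> x)\<bar>)"

definition kern :: "nat \<Rightarrow> (nat \<Rightarrow> real) \<Rightarrow> (nat \<Rightarrow> real \<Rightarrow> real) \<Rightarrow> real \<Rightarrow> real \<Rightarrow> real" where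
  "kern q lam e x y = (\<Sum>m=1..q. lam m * e m x * e m y)"

definition coeff_mat :: "(real \<Rightarrow> real \<Rightarrow> real) \<Rightarrow> nat \<Rightarrow> nat \<Rightarrow> nat \<Rightarrow> real" where
  "coeff_mat K n i j = 1 / real n * K (real i / real n) (real j / real n)"

definition sum_squares :: "nat \<Rightarrow> (nat \<Rightarrow> nat \<Rightarrow> real) \<Rightarrow> real" where
  "sum_squares n a = (\<Sum>i=1..n. \<Sum>j=1..n. (a i j)\<^sup>2)"

text \<open>Meaningful only when \<^term>\<open>sum_squares n a \<noteq> 0\<close>.\<close>
definition normalized_coeff :: "nat \<Rightarrow> (nat \<Rightarrow> nat \<Rightarrow> real) \<Rightarrow> nat \<Rightarrow> nat \<Rightarrow> real" where
  "normalized_coeff n a i j = a i j / sqrt (sum_squares n a)"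

definition normalized_eigenvalue :: "nat \<Rightarrow> (nat \<Rightarrow> real) \<Rightarrow> nat \<Rightarrow> real" where
  "normalized_eigenvalue q lam m = lam m / sqrt (\<Sum>l=1..q. (lam l)\<^sup>2)"

definition quad_form :: "nat \<Rightarrow> (nat \<Rightarrow> nat \<Rightarrow> real) \<Rightarrow> (nat \<Rightarrow> 'a \<Rightarrow> real) \<Rightarrow> 'a \<Rightarrow> real" where
  "quad_form n a X \<omega> = (\<Sum>i=1..n. \<Sum>j=1..n. a i j * X i \<omega> * X j \<omega>)"

definition Q_limit :: "nat \<Rightarrow> (nat \<Rightarrow> real) \<Rightarrow> (nat \<Rightarrow> 'b \<Rightarrow> real) \<Rightarrow> 'b \<Rightarrow> real" where
  "Q_limit q lam Z \<omega> = (\<Sum>m=1..q. normalized_eigenvalue q lam m * ((Z m \<omega>)\<^sup>2 - 1))"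

end

theory Submission
  imports Defs
begin

text \<open>
  Put $c_{im} = e_m(i/n)/\sqrt n$ and $S_m = \sum_i c_{im} X_i$. Then $\tilde Q_n = \rho_n \sum_m
  \tilde\lambda_m S_m^2$ with a scalar $\rho_n$, and Riemann sums of the Hoelder functions $e_m e_l$ show
  that the Gram matrix $\sum_i c_{im} c_{il}$ is the identity up to $O(n^{-\alpha})$, whence also
  $\rho_n = 1 + O(n^{-\alpha})$. The limit is the same form in independent standard normal variables
  $Z_m$. Writing $Z_m$ in law as $n^{-1/2} \sum_i g_{mi}$ with independent standard normal $g_{mi}$, both
  sides become quadratic forms in one large independent family of centered variables $Y_k$ of variance one,
  and they differ only in their coefficients, all of which are $O(n^{-1/2})$.

  The two sets of coefficients are joined by the path $\sin t$ times those of $X$ and $\cos t$ times those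
  of $g$ (lemma \<open>smart_path_comparison\<close>). Let $Q_t$ be the form on the path with the squares
  $Y_k^2$ removed. In a single variable $Y_k$ it is affine, with a slope of order $n^{-1/2}$ independent of
  $Y_k$. A Taylor expansion in $Y_k$ of the derivative of $E\,h(Q_t)$ therefore sees only the mean and the
  variance of $Y_k$, up to an error of order $n^{-3/2}$ (lemma \<open>coordinate_taylor_estimate\<close>). Summed
  over $k$ the errors are $O(n^{-1/2})$, and the second order terms combine to half the derivative of the
  covariance of the linear forms, which is $\sin t \cos t$ times the defect of the Gram matrix and hence
  $O(n^{-\alpha})$. Removing the squares costs $O(n^{-1/2})$ in $L^1$; it is what makes fourth moments
  suffice, since the Taylor remainder of the full form would contain sixth powers of $X_i$.

  Smooth estimates turn into a Kolmogorov bound once the limit law has no concentrated mass. Among three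
  nonzero eigenvalues two have the same sign; conditionally on the other variables, $\tilde Q_\infty$ falls
  into an interval of length $\epsilon$ when a Gaussian vector in the plane falls into an annulus of area
  $O(\epsilon)$, so this has probability $O(\epsilon)$
  (lemma \<open>weighted_chi_square_anticoncentration\<close>).

  An indicator smoothed at scale $\epsilon$ has derivatives up to order three of size $\epsilon^{-3}$. The
  exponent may be taken at most $1/4$, so that $n^{-1/2} \le \delta$ for $\delta = n^{-\alpha}$, and the
  Kolmogorov distance is $O(\epsilon + \epsilon^{-3} \delta)$. The choice $\epsilon = \delta^{1/4}$ gives
  $n^{-\alpha/4}$. For a larger Hoelder exponent the value $1/4$ gives $n^{-1/16}$, the first term of the
  bound.
\<close>

section \<open>Linear forms in independent variables of mean zero and variance one\<close>

lemma abs_power_le_one_plus_power4: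
  fixes x :: real
  assumes "j \<le> 4"
  shows "\<bar>x\<bar> ^ j \<le> 1 + x ^ 4"
proof (cases "\<bar>x\<bar> \<le> 1")
  case True
  then have "\<bar>x\<bar> ^ j \<le> 1"
    by (simp add: power_le_one)
  moreover have "0 \<le> x ^ 4"
    by simp
  ultimately show ?thesis
    by linarith
next
  case False
  then have "\<bar>x\<bar> ^ j \<le> \<bar>x\<bar> ^ 4"
    using assms by (intro power_increasing) auto
  then show ?thesis
    by (simp add: power_even_abs)
qed

lemma integrable_of_abs_le:
  fixes f g :: "'a \<Rightarrow> real"
  assumes "integrable M g" "f \<in> borel_measurable M" "\<And>x. \<bar>f x\<bar> \<le> g x"
  shows "integrable M f"
  by (rule Bochner_Integration.integrable_bound[OF assms(1,2)])
     (use assms(3) in \<open>auto intro!: AE_I2 order_trans[OF _ abs_ge_self]\<close>)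

context prob_space
begin

text \<open>
  The condition \<open>f (restrict y J1) = f y\<close> says that \<open>f\<close> reads only the coordinates in
  \<open>J1\<close>. It lets functions of a subfamily be written as functions of the whole family, without
  restricting the argument at each use.
\<close>
lemma indep_var_of_disjoint_functions:
  fixes Y :: "'i \<Rightarrow> 'a \<Rightarrow> real" and f g :: "('i \<Rightarrow> real) \<Rightarrow> real"
  assumes ind: "indep_vars (\<lambda>_. borel) Y I"
    and sub: "J1 \<inter> J2 = {}" "J1 \<subseteq> I" "J2 \<subseteq> I"
    and f: "f \<in> borel_measurable (PiM J1 (\<lambda>_. borel))" "\<And>y. f (restrict y J1) = f y"
    and g: "g \<in> borel_measurable (PiM J2 (\<lambda>_. borel))" "\<And>y. g (restrict y J2) = g y"
  shows "indep_var borel (\<lambda>\<omega>. f (\<lambda>i. Y i \<omega>)) borel (\<lambda>\<omega>. g (\<lambda>i. Y i \<omega>))"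
  using indep_var_compose[OF indep_var_restrict[OF ind sub] f(1) g(1)] f(2) g(2)
  by (simp add: comp_def)

text \<open>
  The form in which independence enters all later moment computations: one variable is averaged against
  an arbitrary function of the remaining ones.
\<close>
lemma expectation_mult_function_of_others:
  fixes Y :: "'i \<Rightarrow> 'a \<Rightarrow> real" and f :: "('i \<Rightarrow> real) \<Rightarrow> real" and g :: "real \<Rightarrow> real"
  assumes ind: "indep_vars (\<lambda>_. borel) Y I" and k: "k \<in> I"
    and f: "f \<in> borel_measurable (PiM (I - {k}) (\<lambda>_. borel))" "\<And>y. f (restrict y (I - {k})) = f y"
    and g: "g \<in> borel_measurable borel"
    and int: "integrable M (\<lambda>\<omega>. g (Y k \<omega>))" "integrable M (\<lambda>\<omega>. f (\<lambda>i. Y i \<omega>))"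
  shows "integrable M (\<lambda>\<omega>. g (Y k \<omega>) * f (\<lambda>i. Y i \<omega>))"
    and "expectation (\<lambda>\<omega>. g (Y k \<omega>) * f (\<lambda>i. Y i \<omega>))
         = expectation (\<lambda>\<omega>. g (Y k \<omega>)) * expectation (\<lambda>\<omega>. f (\<lambda>i. Y i \<omega>))"
proof -
  have "indep_var borel (\<lambda>\<omega>. (\<lambda>y. g (y k)) (\<lambda>i. Y i \<omega>)) borel (\<lambda>\<omega>. f (\<lambda>i. Y i \<omega>))"
  proof (rule indep_var_of_disjoint_functions[OF ind, where ?J1.0 = "{k}" and ?J2.0 = "I - {k}"])
    show "(\<lambda>y. g (y k)) \<in> borel_measurable (PiM {k} (\<lambda>_. borel))"
      using g by measurable
    show "f \<in> borel_measurable (PiM (I - {k}) (\<lambda>_. borel))" "\<And>y. f (restrict y (I - {k})) = f y"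
      by (fact f)+
  qed (use k in auto)
  then have "indep_var borel (\<lambda>\<omega>. g (Y k \<omega>)) borel (\<lambda>\<omega>. f (\<lambda>i. Y i \<omega>))"
    by simp
  then show "integrable M (\<lambda>\<omega>. g (Y k \<omega>) * f (\<lambda>i. Y i \<omega>))"
    and "expectation (\<lambda>\<omega>. g (Y k \<omega>) * f (\<lambda>i. Y i \<omega>))
         = expectation (\<lambda>\<omega>. g (Y k \<omega>)) * expectation (\<lambda>\<omega>. f (\<lambda>i. Y i \<omega>))"
    using indep_var_integrable[OF _ int] indep_var_lebesgue_integral[OF _ int] by auto
qed

lemma expectation_sum_squared_indep:
  fixes V :: "'i \<Rightarrow> 'a \<Rightarrow> real"
  assumes "finite J" and "indep_vars (\<lambda>_. borel) V J"
    and "\<And>k. k \<in> J \<Longrightarrow> integrable M (V k)" and "\<And>k. k \<in> J \<Longrightarrow> expectation (V k) = 0"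
    and "\<And>k. k \<in> J \<Longrightarrow> integrable M (\<lambda>\<omega>. (V k \<omega>)\<^sup>2)"
  shows "integrable M (\<lambda>\<omega>. (\<Sum>k\<in>J. V k \<omega>)\<^sup>2) \<and>
         expectation (\<lambda>\<omega>. (\<Sum>k\<in>J. V k \<omega>)\<^sup>2) = (\<Sum>k\<in>J. expectation (\<lambda>\<omega>. (V k \<omega>)\<^sup>2))"
  using assms
proof (induction J rule: finite_induct)
  case empty
  then show ?case by simp
next
  case (insert k J)
  let ?L = "\<lambda>\<omega>. \<Sum>j\<in>J. V j \<omega>"
  have IH: "integrable M (\<lambda>\<omega>. (?L \<omega>)\<^sup>2)"
    "expectation (\<lambda>\<omega>. (?L \<omega>)\<^sup>2) = (\<Sum>k\<in>J. expectation (\<lambda>\<omega>. (V k \<omega>)\<^sup>2))"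
    using insert.IH insert.prems indep_vars_subset[OF insert.prems(1), of J] by auto
  have intL: "integrable M ?L"
    using insert.prems by auto
  have meas: "(\<lambda>y. \<Sum>j\<in>J. y j :: real) \<in> borel_measurable (PiM (insert k J - {k}) (\<lambda>_. borel))"
    by (rule borel_measurable_sum) (use insert.hyps in \<open>auto intro!: measurable_component_singleton\<close>)
  have restr: "(\<Sum>j\<in>J. restrict y (insert k J - {k}) j) = (\<Sum>j\<in>J. y j)" for y :: "'i \<Rightarrow> real"
    using insert.hyps by (intro sum.cong) auto
  note * = expectation_mult_function_of_others[OF insert.prems(1) _ meas restr, where g = "\<lambda>x. x"]
  have cross: "integrable M (\<lambda>\<omega>. V k \<omega> * ?L \<omega>)" "expectation (\<lambda>\<omega>. V k \<omega> * ?L \<omega>) = 0"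
    using * insert.prems(2,3) intL by auto
  have eq: "(\<Sum>j\<in>insert k J. V j \<omega>)\<^sup>2 = (V k \<omega>)\<^sup>2 + 2 * (V k \<omega> * ?L \<omega>) + (?L \<omega>)\<^sup>2" for \<omega>
    using insert.hyps by (simp add: power2_eq_square algebra_simps)
  have intk: "integrable M (\<lambda>\<omega>. (V k \<omega>)\<^sup>2)"
    using insert.prems by auto
  show ?case
    unfolding eq using cross IH intk insert.hyps by (simp)
qed

end

text \<open>
  The marginal laws may differ; in the application some members have the law of the given variables and
  the others are standard normal. The lower bound on \<open>K\<close> is the fourth moment of the standard
  normal law.
\<close>
locale unit_indep_family = prob_space M for M :: "'a measure" +
  fixes Y :: "'i \<Rightarrow> 'a \<Rightarrow> real" and I :: "'i set" and K :: real
  assumes finite_I: "finite I"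
    and indep: "indep_vars (\<lambda>_. borel) Y I"
    and mean_zero: "k \<in> I \<Longrightarrow> expectation (Y k) = 0"
    and unit_variance: "k \<in> I \<Longrightarrow> expectation (\<lambda>\<omega>. (Y k \<omega>)\<^sup>2) = 1"
    and integrable_fourth: "k \<in> I \<Longrightarrow> integrable M (\<lambda>\<omega>. (Y k \<omega>) ^ 4)"
    and fourth_le: "k \<in> I \<Longrightarrow> expectation (\<lambda>\<omega>. (Y k \<omega>) ^ 4) \<le> K"
    and K_ge: "3 \<le> K"
begin

lemma Y_measurable [measurable]: "k \<in> I \<Longrightarrow> Y k \<in> borel_measurable M"
  using indep by (auto simp: indep_vars_def)

lemma integrable_power_of_fourth:
  assumes "f \<in> borel_measurable M" "integrable M (\<lambda>\<omega>. (f \<omega>) ^ 4)" "j \<le> 4"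
  shows "integrable M (\<lambda>\<omega>. \<bar>f \<omega>\<bar> ^ j)" and "integrable M (\<lambda>\<omega>. (f \<omega> :: real) ^ j)"
    and "expectation (\<lambda>\<omega>. \<bar>f \<omega>\<bar> ^ j) \<le> 1 + expectation (\<lambda>\<omega>. (f \<omega>) ^ 4)"
proof -
  have dom: "integrable M (\<lambda>\<omega>. 1 + (f \<omega>) ^ 4)"
    using assms by simp
  show 1: "integrable M (\<lambda>\<omega>. \<bar>f \<omega>\<bar> ^ j)"
    by (rule integrable_of_abs_le[OF dom]) (use assms abs_power_le_one_plus_power4[of j] in auto)
  show "integrable M (\<lambda>\<omega>. (f \<omega>) ^ j)"
    by (rule integrable_of_abs_le[OF 1]) (use assms in \<open>auto simp: power_abs\<close>)
  have "expectation (\<lambda>\<omega>. \<bar>f \<omega>\<bar> ^ j) \<le> expectation (\<lambda>\<omega>. 1 + (f \<omega>) ^ 4)"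
    by (rule integral_mono[OF 1 dom]) (use abs_power_le_one_plus_power4[of j] assms in auto)
  then show "expectation (\<lambda>\<omega>. \<bar>f \<omega>\<bar> ^ j) \<le> 1 + expectation (\<lambda>\<omega>. (f \<omega>) ^ 4)"
    using assms by (simp add: prob_space)
qed

lemma integrable_power:
  assumes "k \<in> I" "j \<le> 4"
  shows "integrable M (\<lambda>\<omega>. \<bar>Y k \<omega>\<bar> ^ j)" and "integrable M (\<lambda>\<omega>. (Y k \<omega>) ^ j)"
    and "expectation (\<lambda>\<omega>. \<bar>Y k \<omega>\<bar> ^ j) \<le> 1 + K"
  using integrable_power_of_fourth[OF Y_measurable integrable_fourth] assms fourth_le[of k]
  by fastforce+

lemma integrable_Y: "k \<in> I \<Longrightarrow> integrable M (Y k)"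
  using integrable_power(2)[of k 1] by simp

text \<open>
  Fourth and second moments are computed by one induction. Adding a variable of coefficient \<open>a\<close> to a
  form of variance \<open>s\<close> adds \<open>6 * a\<^sup>2 * s\<close> and at most \<open>K * a ^ 4\<close> to the fourth moment,
  the odd terms vanishing; \<open>K \<ge> 3\<close> absorbs the former into \<open>K * (s + a\<^sup>2)\<^sup>2\<close>.
\<close>
lemma linear_form_moments:
  assumes "J \<subseteq> I"
  shows "integrable M (\<lambda>\<omega>. (\<Sum>k\<in>J. a k * Y k \<omega>) ^ 4) \<and>
         expectation (\<lambda>\<omega>. (\<Sum>k\<in>J. a k * Y k \<omega>) ^ 4) \<le> K * (\<Sum>k\<in>J. (a k)\<^sup>2)\<^sup>2 \<and>
         integrable M (\<lambda>\<omega>. (\<Sum>k\<in>J. a k * Y k \<omega>)\<^sup>2) \<and>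
         expectation (\<lambda>\<omega>. (\<Sum>k\<in>J. a k * Y k \<omega>)\<^sup>2) = (\<Sum>k\<in>J. (a k)\<^sup>2)"
proof -
  have "finite J"
    using assms finite_I finite_subset by blast
  then show ?thesis
    using assms
  proof (induction J rule: finite_induct)
    case empty
    then show ?case by simp
  next
    case (insert k J)
    let ?L = "\<lambda>\<omega>. \<Sum>j\<in>J. a j * Y j \<omega>"
    let ?T = "\<lambda>\<omega>. \<Sum>j\<in>insert k J. a j * Y j \<omega>"
    let ?s = "\<Sum>j\<in>J. (a j)\<^sup>2"
    have IH: "integrable M (\<lambda>\<omega>. (?L \<omega>) ^ 4)" "expectation (\<lambda>\<omega>. (?L \<omega>) ^ 4) \<le> K * ?s\<^sup>2"
      "integrable M (\<lambda>\<omega>. (?L \<omega>)\<^sup>2)" "expectation (\<lambda>\<omega>. (?L \<omega>)\<^sup>2) = ?s"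
      using insert by auto
    have k: "k \<in> I" and JI: "J \<subseteq> I - {k}"
      using insert by auto
    have measL: "?L \<in> borel_measurable M"
      using JI by (intro borel_measurable_sum borel_measurable_times Y_measurable) auto
    note powL = integrable_power_of_fourth(2)[OF measL IH(1)]
    have EL: "expectation ?L = 0"
    proof -
      have "expectation ?L = (\<Sum>j\<in>J. expectation (\<lambda>\<omega>. a j * Y j \<omega>))"
        by (rule Bochner_Integration.integral_sum) (use JI integrable_Y in auto)
      also have "\<dots> = 0"
        using JI mean_zero by (intro sum.neutral) auto
      finally show ?thesis .
    qed
    have meas: "(\<lambda>y. (\<Sum>j\<in>J. a j * y j) ^ r) \<in> borel_measurable (PiM (I - {k}) (\<lambda>_. borel))" for r
      using JI by (intro borel_measurable_power borel_measurable_sum borel_measurable_times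
          measurable_component_singleton) auto
    have restr: "(\<Sum>j\<in>J. a j * restrict y (I - {k}) j) ^ r = (\<Sum>j\<in>J. a j * y j) ^ r"
      for y :: "'i \<Rightarrow> real" and r
      using JI by (intro arg_cong[where f = "\<lambda>x. x ^ r"] sum.cong) auto
    have mix: "integrable M (\<lambda>\<omega>. (Y k \<omega>) ^ p * (?L \<omega>) ^ r)"
      "expectation (\<lambda>\<omega>. (Y k \<omega>) ^ p * (?L \<omega>) ^ r)
         = expectation (\<lambda>\<omega>. (Y k \<omega>) ^ p) * expectation (\<lambda>\<omega>. (?L \<omega>) ^ r)"
      if "p \<le> 4" "r \<le> 4" for p r
      using expectation_mult_function_of_others[OF indep k meas[of r] restr, where g = "\<lambda>x. x ^ p"]
        integrable_power(2)[OF k that(1)] powL[OF that(2)] by auto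
    have m1: "expectation (\<lambda>\<omega>. Y k \<omega> * (?L \<omega>) ^ 3) = 0"
      and m2: "expectation (\<lambda>\<omega>. (Y k \<omega>) ^ 3 * ?L \<omega>) = 0"
      and m3: "expectation (\<lambda>\<omega>. (Y k \<omega>)\<^sup>2 * (?L \<omega>)\<^sup>2) = ?s"
      and m4: "expectation (\<lambda>\<omega>. Y k \<omega> * ?L \<omega>) = 0"
      using mix(2)[of 1 3] mix(2)[of 3 1] mix(2)[of 2 2] mix(2)[of 1 1]
        mean_zero[OF k] EL unit_variance[OF k] IH(4) by auto
    have i1: "integrable M (\<lambda>\<omega>. Y k \<omega> * (?L \<omega>) ^ 3)"
      and i2: "integrable M (\<lambda>\<omega>. (Y k \<omega>) ^ 3 * ?L \<omega>)"
      and i3: "integrable M (\<lambda>\<omega>. (Y k \<omega>)\<^sup>2 * (?L \<omega>)\<^sup>2)"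
      and i4: "integrable M (\<lambda>\<omega>. Y k \<omega> * ?L \<omega>)"
      using mix(1)[of 1 3] mix(1)[of 3 1] mix(1)[of 2 2] mix(1)[of 1 1] by auto
    have i5: "integrable M (\<lambda>\<omega>. (Y k \<omega>)\<^sup>2)"
      using integrable_power(2)[OF k] by simp
    have eq4: "(?T \<omega>) ^ 4 =
        (?L \<omega>) ^ 4 + (4 * a k) * (Y k \<omega> * (?L \<omega>) ^ 3) + (6 * (a k)\<^sup>2) * ((Y k \<omega>)\<^sup>2 * (?L \<omega>)\<^sup>2)
        + (4 * (a k) ^ 3) * ((Y k \<omega>) ^ 3 * ?L \<omega>) + (a k) ^ 4 * (Y k \<omega>) ^ 4" for \<omega>
    proof -
      have "?T \<omega> = a k * Y k \<omega> + ?L \<omega>"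
        using insert.hyps by simp
      then show ?thesis
        by (simp add: power4_eq_xxxx power3_eq_cube power2_eq_square algebra_simps)
    qed
    have eq2: "(?T \<omega>)\<^sup>2 =
        (?L \<omega>)\<^sup>2 + (2 * a k) * (Y k \<omega> * ?L \<omega>) + (a k)\<^sup>2 * (Y k \<omega>)\<^sup>2" for \<omega>
      using insert.hyps by (simp add: power2_eq_square algebra_simps)
    have int4: "integrable M (\<lambda>\<omega>. (?T \<omega>) ^ 4)"
      unfolding eq4 using i1 i2 i3 IH(1) integrable_fourth[OF k] by simp
    have int2: "integrable M (\<lambda>\<omega>. (?T \<omega>)\<^sup>2)"
      unfolding eq2 using i4 i5 IH(3) by simp
    have "expectation (\<lambda>\<omega>. (?T \<omega>) ^ 4) =
        expectation (\<lambda>\<omega>. (?L \<omega>) ^ 4) + 6 * (a k)\<^sup>2 * ?s + (a k) ^ 4 * expectation (\<lambda>\<omega>. (Y k \<omega>) ^ 4)"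
      unfolding eq4 using i1 i2 i3 IH(1) integrable_fourth[OF k] m1 m2 m3 by simp
    also have "\<dots> \<le> K * ?s\<^sup>2 + 2 * K * (a k)\<^sup>2 * ?s + (a k) ^ 4 * K"
    proof (intro add_mono mult_right_mono mult_left_mono)
      show "0 \<le> ?s" by (intro sum_nonneg) auto
    qed (use IH fourth_le[OF k] K_ge in auto)
    also have "\<dots> = K * (\<Sum>j\<in>insert k J. (a j)\<^sup>2)\<^sup>2"
      using insert.hyps by simp algebra
    finally have le: "expectation (\<lambda>\<omega>. (?T \<omega>) ^ 4)
        \<le> K * (\<Sum>j\<in>insert k J. (a j)\<^sup>2)\<^sup>2" .
    have "expectation (\<lambda>\<omega>. (?T \<omega>)\<^sup>2) = ?s + (a k)\<^sup>2"
      unfolding eq2 using i4 i5 IH(3,4) m4 unit_variance[OF k] by simp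
    then show ?case
      using int4 int2 le insert.hyps by simp
  qed
qed

text \<open>
  The summands are independent and centered, so the variance is the sum of the variances; this is the
  price of discarding the squares of the variables from a quadratic form.
\<close>
lemma expectation_abs_weighted_square_fluctuation:
  shows "integrable M (\<lambda>\<omega>. \<Sum>k\<in>I. w k * ((Y k \<omega>)\<^sup>2 - 1))"
    and "expectation (\<lambda>\<omega>. \<bar>\<Sum>k\<in>I. w k * ((Y k \<omega>)\<^sup>2 - 1)\<bar>) \<le> sqrt (K * (\<Sum>k\<in>I. (w k)\<^sup>2))"
proof -
  let ?V = "\<lambda>k \<omega>. w k * ((Y k \<omega>)\<^sup>2 - 1)"
  let ?D = "\<lambda>\<omega>. \<Sum>k\<in>I. ?V k \<omega>"
  have i2: "integrable M (\<lambda>\<omega>. (Y k \<omega>)\<^sup>2)" if "k \<in> I" for k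
    using integrable_power(2)[OF that] by simp
  have eq: "(?V k \<omega>)\<^sup>2 = (w k)\<^sup>2 * ((Y k \<omega>) ^ 4 - 2 * (Y k \<omega>)\<^sup>2 + 1)" for k \<omega>
    by algebra
  have ind: "indep_vars (\<lambda>_. borel) ?V I"
    by (rule indep_vars_compose2[OF indep, where Y = "\<lambda>k x. w k * (x\<^sup>2 - 1)"]) simp
  have sq: "integrable M (\<lambda>\<omega>. (?D \<omega>)\<^sup>2) \<and>
      expectation (\<lambda>\<omega>. (?D \<omega>)\<^sup>2) = (\<Sum>k\<in>I. expectation (\<lambda>\<omega>. (?V k \<omega>)\<^sup>2))"
  proof (rule expectation_sum_squared_indep[OF finite_I ind])
    fix k assume k: "k \<in> I"
    show "integrable M (?V k)" "expectation (?V k) = 0"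
      using i2[OF k] unit_variance[OF k] by (simp_all add: prob_space)
    show "integrable M (\<lambda>\<omega>. (?V k \<omega>)\<^sup>2)"
      unfolding eq using i2[OF k] integrable_fourth[OF k] by simp
  qed
  have "expectation (\<lambda>\<omega>. (?D \<omega>)\<^sup>2) \<le> (\<Sum>k\<in>I. (w k)\<^sup>2 * K)"
    unfolding conjunct2[OF sq]
  proof (rule sum_mono)
    fix k assume k: "k \<in> I"
    have "expectation (\<lambda>\<omega>. (?V k \<omega>)\<^sup>2) = (w k)\<^sup>2 * (expectation (\<lambda>\<omega>. (Y k \<omega>) ^ 4) - 1)"
      unfolding eq using i2[OF k] integrable_fourth[OF k] unit_variance[OF k] by (simp add: prob_space)
    also have "\<dots> \<le> (w k)\<^sup>2 * K"
      using fourth_le[OF k] by (intro mult_left_mono) auto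
    finally show "expectation (\<lambda>\<omega>. (?V k \<omega>)\<^sup>2) \<le> (w k)\<^sup>2 * K" .
  qed
  then have bound: "expectation (\<lambda>\<omega>. (?D \<omega>)\<^sup>2) \<le> K * (\<Sum>k\<in>I. (w k)\<^sup>2)"
    by (simp add: sum_distrib_left mult.commute)
  show intD: "integrable M ?D"
    using i2 by (intro Bochner_Integration.integrable_sum) simp
  have "(expectation (\<lambda>\<omega>. \<bar>?D \<omega>\<bar>))\<^sup>2 \<le> expectation (\<lambda>\<omega>. \<bar>?D \<omega>\<bar>\<^sup>2)"
  proof -
    have "0 \<le> variance (\<lambda>\<omega>. \<bar>?D \<omega>\<bar>)" by simp
    also have "\<dots> = expectation (\<lambda>\<omega>. \<bar>?D \<omega>\<bar>\<^sup>2) - (expectation (\<lambda>\<omega>. \<bar>?D \<omega>\<bar>))\<^sup>2"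
      using intD sq by (intro variance_eq) auto
    finally show ?thesis by simp
  qed
  then show "expectation (\<lambda>\<omega>. \<bar>?D \<omega>\<bar>) \<le> sqrt (K * (\<Sum>k\<in>I. (w k)\<^sup>2))"
    using bound by (intro real_le_rsqrt) simp
qed

end

section \<open>Test functions with a Lipschitz second derivative\<close>

text \<open>
  The constant \<open>A\<close> controls the error of expanding \<open>h1\<close> to first order. A Lipschitz bound on \<open>h2\<close> in place of a third derivative admits cubic splines.
\<close>
locale smooth_test =
  fixes A :: real and h h1 h2 :: "real \<Rightarrow> real"
  assumes DERIV_h: "(h has_real_derivative h1 x) (at x)"
    and DERIV_h1: "(h1 has_real_derivative h2 x) (at x)"
    and h1_le: "\<bar>h1 x\<bar> \<le> A"
    and h2_le: "\<bar>h2 x\<bar> \<le> A"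
    and h2_lipschitz: "\<bar>h2 x - h2 y\<bar> \<le> A * \<bar>x - y\<bar>"
begin

lemma A_nonneg: "0 \<le> A"
  using h1_le[of 0] by linarith

lemma measurable_h [measurable]:
  "h \<in> borel_measurable borel" "h1 \<in> borel_measurable borel" "h2 \<in> borel_measurable borel"
proof -
  have "continuous_on UNIV h" "continuous_on UNIV h1"
    using DERIV_h DERIV_h1 by (auto intro!: continuous_at_imp_continuous_on dest: DERIV_isCont)
  moreover have "continuous_on UNIV h2"
  proof (rule lipschitz_on_continuous_on)
    show "A-lipschitz_on UNIV h2"
      using A_nonneg h2_lipschitz by (auto intro!: lipschitz_onI simp: dist_real_def)
  qed
  ultimately show "h \<in> borel_measurable borel" "h1 \<in> borel_measurable borel"
    "h2 \<in> borel_measurable borel"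
    by (auto intro: borel_measurable_continuous_onI)
qed

lemma h_lipschitz: "\<bar>h x - h y\<bar> \<le> A * \<bar>x - y\<bar>"
  using field_differentiable_bound[of UNIV h h1 A x y] DERIV_h h1_le by auto

lemma h1_taylor: "\<bar>h1 (u + v) - h1 u - v * h2 u\<bar> \<le> A * v\<^sup>2"
proof -
  obtain \<xi> where \<xi>: "h1 (u + v) - h1 u = v * h2 \<xi>" "\<bar>\<xi> - u\<bar> \<le> \<bar>v\<bar>"
  proof (cases v "0 :: real" rule: linorder_cases)
    case less
    then obtain z where "u + v < z" "z < u" "h1 u - h1 (u + v) = (u - (u + v)) * h2 z"
      using MVT2[of "u + v" u h1 h2] DERIV_h1 by auto
    then show ?thesis
      using less by (intro that[of z]) auto
  next
    case equal
    then show ?thesis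
      using that[of u] by simp
  next
    case greater
    then obtain z where "u < z" "z < u + v" "h1 (u + v) - h1 u = (u + v - u) * h2 z"
      using MVT2[of u "u + v" h1 h2] DERIV_h1 by auto
    then show ?thesis
      using greater by (intro that[of z]) auto
  qed
  have "h1 (u + v) - h1 u - v * h2 u = v * (h2 \<xi> - h2 u)"
    using \<xi>(1) by (simp add: algebra_simps)
  also have "\<bar>\<dots>\<bar> \<le> \<bar>v\<bar> * (A * \<bar>v\<bar>)"
    unfolding abs_mult using h2_lipschitz[of \<xi> u] \<xi>(2) A_nonneg
    by (intro mult_left_mono order_trans[OF h2_lipschitz] mult_left_mono) auto
  also have "\<dots> = A * v\<^sup>2"
    by (simp add: power2_eq_square)
  finally show ?thesis .
qed

end

section \<open>Off-diagonal quadratic forms: Taylor expansion in one variable\<close>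

definition lin_form :: "'i set \<Rightarrow> ('i \<Rightarrow> nat \<Rightarrow> real) \<Rightarrow> nat \<Rightarrow> ('i \<Rightarrow> real) \<Rightarrow> real" where
  "lin_form J b m y = (\<Sum>k\<in>J. b k m * y k)"

text \<open>
  The quadratic form \<open>\<Sum>m. lam m * (lin_form m)\<^sup>2\<close> with the squares \<open>(y k)\<^sup>2\<close> removed, so
  that it is affine in each single variable.
\<close>
definition offdiag_form ::
    "'i set \<Rightarrow> nat \<Rightarrow> (nat \<Rightarrow> real) \<Rightarrow> ('i \<Rightarrow> nat \<Rightarrow> real) \<Rightarrow> ('i \<Rightarrow> real) \<Rightarrow> real" where
  "offdiag_form J q lam b y =
     (\<Sum>m=1..q. lam m * ((lin_form J b m y)\<^sup>2 - (\<Sum>k\<in>J. (b k m)\<^sup>2 * (y k)\<^sup>2)))"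

text \<open>
  The derivative of \<open>v \<mapsto> \<Sum>m. lam m * (v m)\<^sup>2\<close> in direction \<open>c\<close> at the point whose coordinates
  are the linear forms.
\<close>
definition form_derivative ::
    "'i set \<Rightarrow> nat \<Rightarrow> (nat \<Rightarrow> real) \<Rightarrow> ('i \<Rightarrow> nat \<Rightarrow> real) \<Rightarrow> (nat \<Rightarrow> real) \<Rightarrow> ('i \<Rightarrow> real) \<Rightarrow> real" where
  "form_derivative J q lam b c y = 2 * (\<Sum>m=1..q. lam m * c m * lin_form J b m y)"

lemmas arith_measurable = borel_measurable_sum borel_measurable_times borel_measurable_diff
  borel_measurable_power borel_measurable_const

lemma lin_form_restrict: "J \<subseteq> J' \<Longrightarrow> lin_form J b m (restrict y J') = lin_form J b m y"
  unfolding lin_form_def by (intro sum.cong) auto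

lemma lin_form_measurable_PiM:
  "J \<subseteq> J' \<Longrightarrow> lin_form J b m \<in> borel_measurable (PiM J' (\<lambda>_. borel))"
  unfolding lin_form_def
  by (intro arith_measurable measurable_component_singleton) auto

lemma offdiag_form_restrict:
  "J \<subseteq> J' \<Longrightarrow> offdiag_form J q lam b (restrict y J') = offdiag_form J q lam b y"
  unfolding offdiag_form_def by (intro sum.cong) (auto simp: lin_form_restrict intro!: sum.cong)

lemma offdiag_form_measurable_PiM:
  "J \<subseteq> J' \<Longrightarrow> offdiag_form J q lam b \<in> borel_measurable (PiM J' (\<lambda>_. borel))"
  unfolding offdiag_form_def
  by (intro arith_measurable measurable_component_singleton lin_form_measurable_PiM) auto

lemma form_derivative_restrict:
  "J \<subseteq> J' \<Longrightarrow> form_derivative J q lam b c (restrict y J') = form_derivative J q lam b c y"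
  unfolding form_derivative_def by (simp add: lin_form_restrict)

lemma form_derivative_measurable_PiM:
  "J \<subseteq> J' \<Longrightarrow> form_derivative J q lam b c \<in> borel_measurable (PiM J' (\<lambda>_. borel))"
  unfolding form_derivative_def
  by (intro arith_measurable lin_form_measurable_PiM)

lemma lin_form_split:
  assumes "finite I" "k \<in> I"
  shows "lin_form I b m y = lin_form (I - {k}) b m y + b k m * y k"
  using assms by (simp add: lin_form_def sum.remove[of I k])

text \<open>
  The slope in \<open>y k\<close> does not involve \<open>y k\<close>; this is the reason for removing the squares.
\<close>
lemma offdiag_form_split:
  assumes "finite I" "k \<in> I"
  shows "offdiag_form I q lam b y =
    offdiag_form (I - {k}) q lam b y + y k * form_derivative (I - {k}) q lam b (b k) y"
proof -
  have "lam m * ((lin_form I b m y)\<^sup>2 - (\<Sum>j\<in>I. (b j m)\<^sup>2 * (y j)\<^sup>2)) =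
      lam m * ((lin_form (I - {k}) b m y)\<^sup>2 - (\<Sum>j\<in>I - {k}. (b j m)\<^sup>2 * (y j)\<^sup>2))
      + y k * 2 * (lam m * b k m * lin_form (I - {k}) b m y)" for m
  proof -
    have "(\<Sum>j\<in>I. (b j m)\<^sup>2 * (y j)\<^sup>2) = (b k m)\<^sup>2 * (y k)\<^sup>2 + (\<Sum>j\<in>I - {k}. (b j m)\<^sup>2 * (y j)\<^sup>2)"
      using assms by (simp add: sum.remove[of I k])
    then show ?thesis
      unfolding lin_form_split[OF assms, of b m y] by (simp add: power2_eq_square algebra_simps)
  qed
  then show ?thesis
    unfolding offdiag_form_def form_derivative_def
    by (simp only: sum.distrib sum_distrib_left mult.assoc)
qed

lemma form_derivative_split:
  assumes "finite I" "k \<in> I"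
  shows "form_derivative I q lam b c y =
    form_derivative (I - {k}) q lam b c y + y k * (2 * (\<Sum>m=1..q. lam m * c m * b k m))"
  unfolding form_derivative_def lin_form_split[OF assms]
  by (simp add: sum.distrib sum_distrib_left algebra_simps)

lemma form_derivative_le:
  assumes "\<And>m. m \<in> {1..q} \<Longrightarrow> \<bar>lam m\<bar> \<le> \<Lambda>" "\<And>m. m \<in> {1..q} \<Longrightarrow> \<bar>c m\<bar> \<le> \<beta>"
  shows "\<bar>form_derivative J q lam b c y\<bar> \<le> 2 * \<Lambda> * \<beta> * (\<Sum>m=1..q. \<bar>lin_form J b m y\<bar>)"
proof -
  have "\<bar>\<Sum>m=1..q. lam m * c m * lin_form J b m y\<bar> \<le> (\<Sum>m=1..q. \<Lambda> * \<beta> * \<bar>lin_form J b m y\<bar>)"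
  proof (rule order_trans[OF sum_abs sum_mono])
    fix m assume m: "m \<in> {1..q}"
    show "\<bar>lam m * c m * lin_form J b m y\<bar> \<le> \<Lambda> * \<beta> * \<bar>lin_form J b m y\<bar>"
      unfolding abs_mult using assms[OF m] by (intro mult_right_mono mult_mono) auto
  qed
  then show ?thesis
    unfolding form_derivative_def by (simp add: abs_mult mult.assoc flip: sum_distrib_left)
qed

lemma sum_abs_power4_le:
  "(\<Sum>m=1..q. \<bar>x m\<bar>) ^ 4 \<le> real q ^ 3 * (\<Sum>m=1..q. (x m :: real) ^ 4)"
proof -
  have 1: "(\<Sum>m=1..q. \<bar>x m\<bar>)\<^sup>2 \<le> real q * (\<Sum>m=1..q. (x m)\<^sup>2)"
    using sum_squared_le_sum_of_squares[of "\<lambda>m. \<bar>x m\<bar>" "{1..q}"] by (simp add: mult.commute)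
  have 2: "(\<Sum>m=1..q. (x m)\<^sup>2)\<^sup>2 \<le> real q * (\<Sum>m=1..q. (x m) ^ 4)"
    using sum_squared_le_sum_of_squares[of "\<lambda>m. (x m)\<^sup>2" "{1..q}"]
    by (simp add: mult.commute flip: power_mult)
  have "(\<Sum>m=1..q. \<bar>x m\<bar>) ^ 4 = ((\<Sum>m=1..q. \<bar>x m\<bar>)\<^sup>2)\<^sup>2"
    by (simp flip: power_mult)
  also have "\<dots> \<le> (real q * (\<Sum>m=1..q. (x m)\<^sup>2))\<^sup>2"
    using 1 by (intro power_mono) auto
  also have "\<dots> = (real q)\<^sup>2 * (\<Sum>m=1..q. (x m)\<^sup>2)\<^sup>2"
    by (simp add: power_mult_distrib)
  also have "\<dots> \<le> (real q)\<^sup>2 * (real q * (\<Sum>m=1..q. (x m) ^ 4))"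
    using 2 by (intro mult_left_mono) auto
  finally show ?thesis
    by (simp add: power2_eq_square power3_eq_cube)
qed

lemma (in prob_space) abs_expectation_diff_le:
  fixes f g R :: "'a \<Rightarrow> real"
  assumes "integrable M f" "integrable M g" "integrable M R" "\<And>\<omega>. \<bar>f \<omega> - g \<omega>\<bar> \<le> R \<omega>"
  shows "\<bar>expectation f - expectation g\<bar> \<le> expectation R"
proof -
  have "\<bar>expectation f - expectation g\<bar> = \<bar>expectation (\<lambda>\<omega>. f \<omega> - g \<omega>)\<bar>"
    using assms by simp
  also have "\<dots> \<le> expectation (\<lambda>\<omega>. \<bar>f \<omega> - g \<omega>\<bar>)"
    using integral_norm_bound[of M "\<lambda>\<omega>. f \<omega> - g \<omega>"] unfolding real_norm_def .
  also have "\<dots> \<le> expectation R"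
    using assms by (intro integral_mono) auto
  finally show ?thesis .
qed

text \<open>
  Bounds all moments up to order four of the sum of the absolute values of \<open>q\<close> linear forms of
  variance at most \<open>B\<close>.
\<close>
definition form_bound :: "real \<Rightarrow> nat \<Rightarrow> real \<Rightarrow> real" where
  "form_bound K q B = 1 + real q ^ 4 * K * B\<^sup>2"

text \<open>
  The error of expanding in a single variable with coefficients at most \<open>\<beta>\<close>, up to moment
  constants; weights of the form are at most \<open>\<Lambda>\<close>.
\<close>
definition taylor_bound :: "nat \<Rightarrow> real \<Rightarrow> real \<Rightarrow> real" where
  "taylor_bound q \<Lambda> \<beta> =
    16 * \<Lambda> ^ 3 * \<beta> ^ 3 + 8 * real q * \<Lambda>\<^sup>2 * \<beta> ^ 3 + 4 * (real q * \<Lambda>)\<^sup>2 * \<beta> ^ 4"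

context unit_indep_family
begin

lemma lin_form_measurable: "J \<subseteq> I \<Longrightarrow> (\<lambda>\<omega>. lin_form J b m (\<lambda>i. Y i \<omega>)) \<in> borel_measurable M"
  unfolding lin_form_def
  by (intro arith_measurable Y_measurable) auto

lemma offdiag_form_measurable:
  "J \<subseteq> I \<Longrightarrow> (\<lambda>\<omega>. offdiag_form J q lam b (\<lambda>i. Y i \<omega>)) \<in> borel_measurable M"
  unfolding offdiag_form_def
  by (intro arith_measurable Y_measurable lin_form_measurable) auto

lemma form_derivative_measurable:
  "J \<subseteq> I \<Longrightarrow> (\<lambda>\<omega>. form_derivative J q lam b c (\<lambda>i. Y i \<omega>)) \<in> borel_measurable M"
  unfolding form_derivative_def
  by (intro arith_measurable lin_form_measurable)

lemma form_bound_ge: "1 \<le> form_bound K q B"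
  using K_ge by (simp add: form_bound_def)

lemma sum_abs_lin_form_moments:
  assumes J: "J \<subseteq> I" and b: "\<And>m. m \<in> {1..q} \<Longrightarrow> (\<Sum>k\<in>I. (b k m)\<^sup>2) \<le> B" and r: "r \<le> 4"
  shows "integrable M (\<lambda>\<omega>. (\<Sum>m=1..q. \<bar>lin_form J b m (\<lambda>i. Y i \<omega>)\<bar>) ^ r)"
    and "expectation (\<lambda>\<omega>. (\<Sum>m=1..q. \<bar>lin_form J b m (\<lambda>i. Y i \<omega>)\<bar>) ^ r) \<le> form_bound K q B"
proof -
  let ?L = "\<lambda>m \<omega>. lin_form J b m (\<lambda>i. Y i \<omega>)"
  let ?W = "\<lambda>\<omega>. \<Sum>m=1..q. \<bar>?L m \<omega>\<bar>"
  let ?R = "\<lambda>\<omega>. real q ^ 3 * (\<Sum>m=1..q. (?L m \<omega>) ^ 4)"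
  have i4: "integrable M (\<lambda>\<omega>. (?L m \<omega>) ^ 4)" for m
    using linear_form_moments[OF J, of "\<lambda>k. b k m"] by (simp add: lin_form_def)
  have e4: "expectation (\<lambda>\<omega>. (?L m \<omega>) ^ 4) \<le> K * B\<^sup>2" if "m \<in> {1..q}" for m
  proof -
    have "(\<Sum>k\<in>J. (b k m)\<^sup>2) \<le> (\<Sum>k\<in>I. (b k m)\<^sup>2)"
      using J finite_I by (intro sum_mono2) auto
    also have "\<dots> \<le> B"
      by (rule b[OF that])
    finally have "K * (\<Sum>k\<in>J. (b k m)\<^sup>2)\<^sup>2 \<le> K * B\<^sup>2"
      using K_ge by (intro mult_left_mono power_mono sum_nonneg) auto
    then show ?thesis
      using linear_form_moments[OF J, of "\<lambda>k. b k m"] by (simp add: lin_form_def)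
  qed
  have measW: "?W \<in> borel_measurable M"
    by (intro borel_measurable_sum borel_measurable_abs lin_form_measurable J)
  have R: "integrable M ?R"
    using i4 by (intro integrable_mult_right Bochner_Integration.integrable_sum)
  have W4: "integrable M (\<lambda>\<omega>. (?W \<omega>) ^ 4)"
    by (rule integrable_of_abs_le[OF R]) (use measW sum_abs_power4_le in auto)
  have "expectation (\<lambda>\<omega>. (?W \<omega>) ^ 4) \<le> expectation ?R"
    by (rule integral_mono[OF W4 R]) (rule sum_abs_power4_le)
  also have "\<dots> = real q ^ 3 * (\<Sum>m=1..q. expectation (\<lambda>\<omega>. (?L m \<omega>) ^ 4))"
    using i4 by simp
  also have "\<dots> \<le> real q ^ 3 * (\<Sum>m=1..q. K * B\<^sup>2)"
    using e4 by (intro mult_left_mono sum_mono) auto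
  also have "\<dots> = real q ^ 4 * K * B\<^sup>2"
    by (simp add: power4_eq_xxxx power3_eq_cube)
  finally have e: "expectation (\<lambda>\<omega>. (?W \<omega>) ^ 4) \<le> real q ^ 4 * K * B\<^sup>2" .
  show "integrable M (\<lambda>\<omega>. (?W \<omega>) ^ r)"
    by (rule integrable_power_of_fourth(2)[OF measW W4 r])
  have abs_W: "\<bar>?W \<omega>\<bar> = ?W \<omega>" for \<omega>
    by (intro abs_of_nonneg sum_nonneg) auto
  show "expectation (\<lambda>\<omega>. (?W \<omega>) ^ r) \<le> form_bound K q B"
    using integrable_power_of_fourth(3)[OF measW W4 r] e unfolding abs_W form_bound_def by simp
qed

text \<open>
  Write \<open>Q = U + Y k * P\<close> with \<open>U\<close>, \<open>P\<close> and the direction term \<open>P'\<close> functions of the other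
  variables. Expanding \<open>h1 (U + Y k * P) * Y k * P'\<close> in \<open>Y k\<close>, the term linear in \<open>Y k\<close> has
  expectation zero, and in the quadratic one \<open>(Y k)\<^sup>2\<close> may be replaced by 1, leaving
  \<open>h2 U * P * P'\<close>. Going back from \<open>U\<close>, \<open>P\<close>, \<open>P'\<close> to the full form and the full
  derivatives costs errors of the same order. The statement uses the full quantities
  because their products can then be summed over \<open>k\<close> for one and the same value of \<open>h2\<close>.
\<close>
lemma coordinate_taylor_estimate:
  fixes h h1 h2 :: "real \<Rightarrow> real" and lam :: "nat \<Rightarrow> real" and b :: "'i \<Rightarrow> nat \<Rightarrow> real"
  assumes test: "smooth_test A h h1 h2" and k: "k \<in> I"
    and lam: "\<And>m. m \<in> {1..q} \<Longrightarrow> \<bar>lam m\<bar> \<le> \<Lambda>"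
    and bk: "\<And>m. m \<in> {1..q} \<Longrightarrow> \<bar>b k m\<bar> \<le> \<beta>" and c: "\<And>m. m \<in> {1..q} \<Longrightarrow> \<bar>c m\<bar> \<le> \<beta>"
    and b: "\<And>m. m \<in> {1..q} \<Longrightarrow> (\<Sum>k\<in>I. (b k m)\<^sup>2) \<le> B"
    and nonneg: "0 \<le> \<Lambda>" "0 \<le> \<beta>"
  defines "Q \<equiv> \<lambda>\<omega>. offdiag_form I q lam b (\<lambda>i. Y i \<omega>)"
  defines "F1 \<equiv> \<lambda>\<omega>. h1 (Q \<omega>) * (Y k \<omega> * form_derivative (I - {k}) q lam b c (\<lambda>i. Y i \<omega>))"
  defines "F2 \<equiv> \<lambda>\<omega>. h2 (Q \<omega>) * (form_derivative I q lam b (b k) (\<lambda>i. Y i \<omega>) *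
                      form_derivative I q lam b c (\<lambda>i. Y i \<omega>))"
  shows "integrable M F1" and "integrable M F2"
    and "\<bar>expectation F1 - expectation F2\<bar> \<le>
      A * (1 + K) * form_bound K q B * taylor_bound q \<Lambda> \<beta>"
proof -
  interpret smooth_test A h h1 h2 by (fact test)
  let ?J = "I - {k}"
  let ?y = "\<lambda>\<omega> i. Y i \<omega>"
  define U where "U = offdiag_form ?J q lam b"
  define P where "P = form_derivative ?J q lam b (b k)"
  define P' where "P' = form_derivative ?J q lam b c"
  define W where "W y = (\<Sum>m=1..q. \<bar>lin_form ?J b m y\<bar>)" for y
  define x where "x = 2 * (\<Sum>m=1..q. lam m * b k m * b k m)"
  define x' where "x' = 2 * (\<Sum>m=1..q. lam m * c m * b k m)"
  define s where "s = 2 * \<Lambda> * \<beta>"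
  define d where "d = 2 * real q * \<Lambda> * \<beta>\<^sup>2"
  have s: "0 \<le> s" and d: "0 \<le> d"
    using nonneg by (auto simp: s_def d_def)
  have PW: "\<bar>P y\<bar> \<le> s * W y" "\<bar>P' y\<bar> \<le> s * W y" for y
    using form_derivative_le[where J = ?J, OF lam bk] form_derivative_le[where J = ?J, OF lam c]
    by (auto simp: P_def P'_def W_def s_def)
  have x_bound: "\<bar>2 * (\<Sum>m=1..q. lam m * u m * b k m)\<bar> \<le> d"
    if "\<And>m. m \<in> {1..q} \<Longrightarrow> \<bar>u m\<bar> \<le> \<beta>" for u
  proof -
    have "\<bar>\<Sum>m=1..q. lam m * u m * b k m\<bar> \<le> (\<Sum>m=1..q. \<Lambda> * \<beta> * \<beta>)"
    proof (rule order_trans[OF sum_abs sum_mono])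
      fix m assume "m \<in> {1..q}"
      then show "\<bar>lam m * u m * b k m\<bar> \<le> \<Lambda> * \<beta> * \<beta>"
        unfolding abs_mult using lam bk that nonneg by (intro mult_mono) auto
    qed
    then show ?thesis
      by (simp add: d_def power2_eq_square abs_mult)
  qed
  have xd: "\<bar>x\<bar> \<le> d" "\<bar>x'\<bar> \<le> d"
    unfolding x_def x'_def using x_bound bk c by blast+
  have W0: "0 \<le> W y" for y
    unfolding W_def by (intro sum_nonneg) auto
  have Q: "Q \<omega> = U (?y \<omega>) + Y k \<omega> * P (?y \<omega>)" for \<omega>
    unfolding Q_def U_def P_def by (rule offdiag_form_split[OF finite_I k])
  have F1: "F1 \<omega> = h1 (U (?y \<omega>) + Y k \<omega> * P (?y \<omega>)) * (Y k \<omega> * P' (?y \<omega>))" for \<omega>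
    unfolding F1_def Q P'_def ..
  have F2: "F2 \<omega> = h2 (U (?y \<omega>) + Y k \<omega> * P (?y \<omega>)) *
      ((P (?y \<omega>) + Y k \<omega> * x) * (P' (?y \<omega>) + Y k \<omega> * x'))" for \<omega>
    unfolding F2_def Q form_derivative_split[OF finite_I k] P_def P'_def x_def x'_def by simp

  have meas_M: "(\<lambda>\<omega>. U (?y \<omega>)) \<in> borel_measurable M" "(\<lambda>\<omega>. P (?y \<omega>)) \<in> borel_measurable M"
    "(\<lambda>\<omega>. P' (?y \<omega>)) \<in> borel_measurable M" "Y k \<in> borel_measurable M"
    unfolding U_def P_def P'_def
    by (auto intro: offdiag_form_measurable form_derivative_measurable Y_measurable[OF k])
  have meas_P: "U \<in> borel_measurable (PiM ?J (\<lambda>_. borel))" "P \<in> borel_measurable (PiM ?J (\<lambda>_. borel))"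
    "P' \<in> borel_measurable (PiM ?J (\<lambda>_. borel))" "W \<in> borel_measurable (PiM ?J (\<lambda>_. borel))"
    unfolding U_def P_def P'_def W_def
    by (auto intro!: offdiag_form_measurable_PiM form_derivative_measurable_PiM borel_measurable_sum
        borel_measurable_abs lin_form_measurable_PiM)
  have restr: "U (restrict y ?J) = U y" "P (restrict y ?J) = P y" "P' (restrict y ?J) = P' y"
    "W (restrict y ?J) = W y" for y
    by (simp_all add: U_def P_def P'_def W_def offdiag_form_restrict form_derivative_restrict
        lin_form_restrict)

  have Wint: "integrable M (\<lambda>\<omega>. W (?y \<omega>) ^ r)"
    and Wexp: "expectation (\<lambda>\<omega>. W (?y \<omega>) ^ r) \<le> form_bound K q B" if "r \<le> 4" for r
    using sum_abs_lin_form_moments[OF _ b that, where J = ?J] by (auto simp: W_def)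
  have YW: "integrable M (\<lambda>\<omega>. \<bar>Y k \<omega>\<bar> ^ p * W (?y \<omega>) ^ r)"
    "expectation (\<lambda>\<omega>. \<bar>Y k \<omega>\<bar> ^ p * W (?y \<omega>) ^ r) \<le> (1 + K) * form_bound K q B"
    if "p \<le> 4" "r \<le> 4" for p r
  proof -
    note * = expectation_mult_function_of_others[OF indep k, where f = "\<lambda>y. W y ^ r"
        and g = "\<lambda>x. \<bar>x\<bar> ^ p"]
    show "integrable M (\<lambda>\<omega>. \<bar>Y k \<omega>\<bar> ^ p * W (?y \<omega>) ^ r)"
      by (rule *) (use meas_P restr integrable_power(1)[OF k] Wint that in auto)
    have "expectation (\<lambda>\<omega>. \<bar>Y k \<omega>\<bar> ^ p * W (?y \<omega>) ^ r)
        = expectation (\<lambda>\<omega>. \<bar>Y k \<omega>\<bar> ^ p) * expectation (\<lambda>\<omega>. W (?y \<omega>) ^ r)"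
      by (rule *) (use meas_P restr integrable_power(1)[OF k] Wint that in auto)
    also have "\<dots> \<le> (1 + K) * form_bound K q B"
      using integrable_power(3)[OF k that(1)] Wexp[OF that(2)] K_ge W0
      by (intro mult_mono) (auto intro!: integral_nonneg_AE)
    finally show "expectation (\<lambda>\<omega>. \<bar>Y k \<omega>\<bar> ^ p * W (?y \<omega>) ^ r) \<le> (1 + K) * form_bound K q B" .
  qed

  \<comment> \<open>The two terms of the expansion that vanish in expectation: \<open>G1\<close> because \<open>Y k\<close> has mean
    zero, \<open>G2\<close> because it has variance one.\<close>
  define G1 where "G1 \<omega> = Y k \<omega> * (h1 (U (?y \<omega>)) * P' (?y \<omega>))" for \<omega>
  define G2 where "G2 \<omega> = ((Y k \<omega>)\<^sup>2 - 1) * (h2 (U (?y \<omega>)) * (P (?y \<omega>) * P' (?y \<omega>)))" for \<omega>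
  have int_hP: "integrable M (\<lambda>\<omega>. h1 (U (?y \<omega>)) * P' (?y \<omega>))"
  proof (rule integrable_of_abs_le)
    show "integrable M (\<lambda>\<omega>. A * (s * W (?y \<omega>)))"
      using Wint[of 1] by simp
    show "\<bar>h1 (U (?y \<omega>)) * P' (?y \<omega>)\<bar> \<le> A * (s * W (?y \<omega>))" for \<omega>
      unfolding abs_mult using PW h1_le A_nonneg by (intro mult_mono) auto
  qed (use meas_M in measurable)
  have int_hPP: "integrable M (\<lambda>\<omega>. h2 (U (?y \<omega>)) * (P (?y \<omega>) * P' (?y \<omega>)))"
  proof (rule integrable_of_abs_le)
    show "integrable M (\<lambda>\<omega>. A * ((s * W (?y \<omega>)) * (s * W (?y \<omega>))))"
      using Wint[of 2] by (simp add: power2_eq_square ac_simps)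
    show "\<bar>h2 (U (?y \<omega>)) * (P (?y \<omega>) * P' (?y \<omega>))\<bar> \<le> A * ((s * W (?y \<omega>)) * (s * W (?y \<omega>)))" for \<omega>
      unfolding abs_mult using PW h2_le A_nonneg s W0 by (intro mult_mono) auto
  qed (use meas_M in measurable)
  have G1: "integrable M G1" "expectation G1 = 0"
  proof -
    note * = expectation_mult_function_of_others[OF indep k,
        where f = "\<lambda>y. h1 (U y) * P' y" and g = "\<lambda>x. x"]
    show "integrable M G1" unfolding G1_def
      by (rule *) (use meas_P restr int_hP integrable_Y[OF k] in \<open>auto\<close>)
    have "expectation G1 = expectation (Y k) * expectation (\<lambda>\<omega>. h1 (U (?y \<omega>)) * P' (?y \<omega>))"
      unfolding G1_def
      by (rule *) (use meas_P restr int_hP integrable_Y[OF k] in \<open>auto\<close>)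
    then show "expectation G1 = 0"
      using mean_zero[OF k] by simp
  qed
  have G2: "integrable M G2" "expectation G2 = 0"
  proof -
    have Y2: "integrable M (\<lambda>\<omega>. (Y k \<omega>)\<^sup>2 - 1)" "expectation (\<lambda>\<omega>. (Y k \<omega>)\<^sup>2 - 1) = 0"
      using integrable_power(2)[OF k, of 2] unit_variance[OF k] by (auto simp: prob_space)
    note * = expectation_mult_function_of_others[OF indep k,
        where f = "\<lambda>y. h2 (U y) * (P y * P' y)" and g = "\<lambda>x. x\<^sup>2 - 1"]
    show "integrable M G2" unfolding G2_def
      by (rule *) (use meas_P restr int_hPP Y2 in \<open>auto\<close>)
    have "expectation G2 = expectation (\<lambda>\<omega>. (Y k \<omega>)\<^sup>2 - 1) *
        expectation (\<lambda>\<omega>. h2 (U (?y \<omega>)) * (P (?y \<omega>) * P' (?y \<omega>)))"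
      unfolding G2_def
      by (rule *) (use meas_P restr int_hPP Y2 in \<open>auto\<close>)
    then show "expectation G2 = 0"
      using Y2 by simp
  qed

  show intF1: "integrable M F1"
  proof (rule integrable_of_abs_le)
    show "integrable M (\<lambda>\<omega>. A * (\<bar>Y k \<omega>\<bar> * (s * W (?y \<omega>))))"
      using YW(1)[of 1 1] by (simp add: mult.left_commute[of _ s])
    show "\<bar>F1 \<omega>\<bar> \<le> A * (\<bar>Y k \<omega>\<bar> * (s * W (?y \<omega>)))" for \<omega>
      unfolding F1 abs_mult using PW h1_le A_nonneg by (intro mult_mono) auto
    show "F1 \<in> borel_measurable M"
      unfolding F1[abs_def] using meas_M by measurable
  qed
  show intF2: "integrable M F2"
  proof (rule integrable_of_abs_le)
    show "integrable M (\<lambda>\<omega>. A * (2 * s\<^sup>2 * (W (?y \<omega>))\<^sup>2 + 2 * d\<^sup>2 * (Y k \<omega>)\<^sup>2))"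
      using Wint[of 2] integrable_power(2)[OF k, of 2] by simp
    have "\<bar>h2 u * ((P y + t * x) * (P' y + t * x'))\<bar> \<le> A * (2 * s\<^sup>2 * (W y)\<^sup>2 + 2 * d\<^sup>2 * t\<^sup>2)" for u t y
    proof -
      have "\<bar>P y + t * x\<bar> \<le> s * W y + \<bar>t\<bar> * d" "\<bar>P' y + t * x'\<bar> \<le> s * W y + \<bar>t\<bar> * d"
        using PW[of y] xd mult_left_mono[OF xd(1), of "\<bar>t\<bar>"] mult_left_mono[OF xd(2), of "\<bar>t\<bar>"]
        by (auto simp: abs_mult intro!: order_trans[OF abs_triangle_ineq] add_mono)
      then have "\<bar>h2 u * ((P y + t * x) * (P' y + t * x'))\<bar> \<le> A * ((s * W y + \<bar>t\<bar> * d) * (s * W y + \<bar>t\<bar> * d))"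
        unfolding abs_mult[of "h2 u"] abs_mult[of "P y + t * x"]
        using h2_le A_nonneg s d W0 by (intro mult_mono) auto
      also have "\<dots> \<le> A * (2 * s\<^sup>2 * (W y)\<^sup>2 + 2 * d\<^sup>2 * t\<^sup>2)"
      proof (intro mult_left_mono A_nonneg)
        have "0 \<le> (s * W y - \<bar>t\<bar> * d)\<^sup>2" by simp
        then show "(s * W y + \<bar>t\<bar> * d) * (s * W y + \<bar>t\<bar> * d) \<le> 2 * s\<^sup>2 * (W y)\<^sup>2 + 2 * d\<^sup>2 * t\<^sup>2"
          by (simp add: power2_eq_square algebra_simps abs_mult_self_eq)
      qed
      finally show ?thesis .
    qed
    then show "\<bar>F2 \<omega>\<bar> \<le> A * (2 * s\<^sup>2 * (W (?y \<omega>))\<^sup>2 + 2 * d\<^sup>2 * (Y k \<omega>)\<^sup>2)" for \<omega>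
      unfolding F2 .
    show "F2 \<in> borel_measurable M"
      unfolding F2[abs_def] using meas_M by measurable
  qed

  \<comment> \<open>The four summands bound, in this order, the Taylor remainder of \<open>h1\<close>, the change of \<open>h2\<close>, and
    the linear and quadratic corrections from replacing \<open>P\<close> and \<open>P'\<close> by the full derivatives. The
    trivial exponents allow a uniform use of \<open>YW\<close>.\<close>
  define R where "R \<omega> = A * (s ^ 3 * (\<bar>Y k \<omega>\<bar> ^ 3 * W (?y \<omega>) ^ 3) + s ^ 3 * (\<bar>Y k \<omega>\<bar> ^ 1 * W (?y \<omega>) ^ 3)
      + 2 * s * d * (\<bar>Y k \<omega>\<bar> ^ 1 * W (?y \<omega>) ^ 1) + d\<^sup>2 * (\<bar>Y k \<omega>\<bar> ^ 2 * W (?y \<omega>) ^ 0))" for \<omega>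
  have R_bound: "\<bar>F1 \<omega> - (F2 \<omega> + G1 \<omega> + G2 \<omega>)\<bar> \<le> R \<omega>" for \<omega>
  proof -
    define t where "t = Y k \<omega>"
    define y where "y = ?y \<omega>"
    define u where "u = U y"
    define p where "p = P y"
    define p' where "p' = P' y"
    define w where "w = s * W y"
    have pw: "\<bar>p\<bar> \<le> w" "\<bar>p'\<bar> \<le> w" and w0: "0 \<le> w"
      using PW[of y] s W0[of y] by (auto simp: p_def p'_def w_def)
    have "F1 \<omega> - (F2 \<omega> + G1 \<omega> + G2 \<omega>) =
        (h1 (u + t * p) - h1 u - (t * p) * h2 u) * (t * p') - (h2 (u + t * p) - h2 u) * (p * p')
        - h2 (u + t * p) * (p * t * x' + t * x * p' + t * t * x * x')"
      unfolding F1 F2 G1_def G2_def t_def y_def u_def p_def p'_def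
      by (simp add: power2_eq_square algebra_simps)
    also have "\<bar>\<dots>\<bar> \<le> \<bar>(h1 (u + t * p) - h1 u - (t * p) * h2 u) * (t * p')\<bar>
        + \<bar>(h2 (u + t * p) - h2 u) * (p * p')\<bar> + \<bar>h2 (u + t * p) * (p * t * x' + t * x * p' + t * t * x * x')\<bar>"
      by linarith
    also have "\<dots> \<le> (A * (\<bar>t\<bar> * w)\<^sup>2) * (\<bar>t\<bar> * w) + (A * (\<bar>t\<bar> * w)) * (w * w)
        + A * (w * \<bar>t\<bar> * d + \<bar>t\<bar> * d * w + \<bar>t\<bar> * \<bar>t\<bar> * d * d)"
    proof (intro add_mono)
      have tp: "\<bar>t * p\<bar> \<le> \<bar>t\<bar> * w"
        unfolding abs_mult using pw by (intro mult_left_mono) auto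
      have tp': "\<bar>t * p'\<bar> \<le> \<bar>t\<bar> * w"
        unfolding abs_mult using pw by (intro mult_left_mono) auto
      have "(t * p)\<^sup>2 \<le> (\<bar>t\<bar> * w)\<^sup>2"
        using power_mono[OF tp, of 2] by simp
      then have "\<bar>h1 (u + t * p) - h1 u - (t * p) * h2 u\<bar> \<le> A * (\<bar>t\<bar> * w)\<^sup>2"
        using h1_taylor[of u "t * p"] A_nonneg by (meson mult_left_mono order_trans)
      then show "\<bar>(h1 (u + t * p) - h1 u - (t * p) * h2 u) * (t * p')\<bar> \<le> (A * (\<bar>t\<bar> * w)\<^sup>2) * (\<bar>t\<bar> * w)"
        unfolding abs_mult[of "h1 (u + t * p) - h1 u - (t * p) * h2 u"] using tp' A_nonneg
        by (intro mult_mono) auto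
      have "\<bar>h2 (u + t * p) - h2 u\<bar> \<le> A * (\<bar>t\<bar> * w)"
        using h2_lipschitz[of "u + t * p" u] mult_left_mono[OF tp A_nonneg] by simp
      then show "\<bar>(h2 (u + t * p) - h2 u) * (p * p')\<bar> \<le> (A * (\<bar>t\<bar> * w)) * (w * w)"
        unfolding abs_mult[of "h2 (u + t * p) - h2 u"] abs_mult[of p p'] using pw A_nonneg w0
        by (intro mult_mono) auto
      have "\<bar>p * t * x' + t * x * p' + t * t * x * x'\<bar> \<le> \<bar>p * t * x'\<bar> + \<bar>t * x * p'\<bar> + \<bar>t * t * x * x'\<bar>"
        by linarith
      also have "\<dots> \<le> w * \<bar>t\<bar> * d + \<bar>t\<bar> * d * w + \<bar>t\<bar> * \<bar>t\<bar> * d * d"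
        unfolding abs_mult using pw xd w0 d by (intro add_mono mult_mono) auto
      finally show "\<bar>h2 (u + t * p) * (p * t * x' + t * x * p' + t * t * x * x')\<bar>
          \<le> A * (w * \<bar>t\<bar> * d + \<bar>t\<bar> * d * w + \<bar>t\<bar> * \<bar>t\<bar> * d * d)"
        unfolding abs_mult[of "h2 (u + t * p)"] using h2_le A_nonneg by (intro mult_mono) auto
    qed
    also have "\<dots> = R \<omega>"
      unfolding R_def w_def t_def y_def
      by (simp add: power3_eq_cube power2_eq_square algebra_simps)
    finally show ?thesis .
  qed
  have intR: "integrable M R"
    unfolding R_def by (intro integrable_mult_right Bochner_Integration.integrable_add YW(1)) auto
  have "\<bar>expectation F1 - expectation (\<lambda>\<omega>. F2 \<omega> + G1 \<omega> + G2 \<omega>)\<bar> \<le> expectation R"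
    using intF1 intF2 G1(1) G2(1) intR R_bound by (intro abs_expectation_diff_le) auto
  then have "\<bar>expectation F1 - expectation F2\<bar> \<le> expectation R"
    using intF2 G1 G2 by simp
  also have "expectation R = A * (s ^ 3 * expectation (\<lambda>\<omega>. \<bar>Y k \<omega>\<bar> ^ 3 * W (?y \<omega>) ^ 3)
      + s ^ 3 * expectation (\<lambda>\<omega>. \<bar>Y k \<omega>\<bar> ^ 1 * W (?y \<omega>) ^ 3)
      + 2 * s * d * expectation (\<lambda>\<omega>. \<bar>Y k \<omega>\<bar> ^ 1 * W (?y \<omega>) ^ 1)
      + d\<^sup>2 * expectation (\<lambda>\<omega>. \<bar>Y k \<omega>\<bar> ^ 2 * W (?y \<omega>) ^ 0))"
    unfolding R_def using YW(1)[of 3 3] YW(1)[of 1 3] YW(1)[of 1 1] YW(1)[of 2 0] by simp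
  also have "\<dots> \<le> A * (s ^ 3 * ((1 + K) * form_bound K q B) + s ^ 3 * ((1 + K) * form_bound K q B)
      + 2 * s * d * ((1 + K) * form_bound K q B) + d\<^sup>2 * ((1 + K) * form_bound K q B))"
    using s d A_nonneg by (intro mult_left_mono add_mono YW(2)) auto
  also have "\<dots> = A * (1 + K) * form_bound K q B *
      taylor_bound q \<Lambda> \<beta>"
    unfolding s_def d_def taylor_bound_def by (simp add: power4_eq_xxxx power3_eq_cube power2_eq_square algebra_simps)
  finally show "\<bar>expectation F1 - expectation F2\<bar> \<le> A * (1 + K) * form_bound K q B *
      taylor_bound q \<Lambda> \<beta>" .
qed

end

section \<open>Interpolation along a path of coefficients\<close>

text \<open>
  Differentiation under the integral sign: the difference quotients are dominated by \<open>D\<close> by the mean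
  value theorem.
\<close>
lemma has_real_derivative_integral_dominated:
  fixes f f' :: "real \<Rightarrow> 'a \<Rightarrow> real"
  assumes deriv: "\<And>t \<omega>. ((\<lambda>t. f t \<omega>) has_real_derivative f' t \<omega>) (at t)"
    and bound: "\<And>t \<omega>. \<bar>f' t \<omega>\<bar> \<le> D \<omega>" and D: "integrable M D"
    and f: "\<And>t. integrable M (f t)" and f': "f' t \<in> borel_measurable M"
  shows "((\<lambda>t. \<integral>\<omega>. f t \<omega> \<partial>M) has_real_derivative (\<integral>\<omega>. f' t \<omega> \<partial>M)) (at t)"
  unfolding has_field_derivative_iff tendsto_at_iff_sequentially comp_def
proof (intro allI impI)
  fix s :: "nat \<Rightarrow> real"
  assume s: "\<forall>i. s i \<in> UNIV - {t}" and lim: "s \<longlonglongrightarrow> t"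
  have "(\<lambda>i. \<integral>\<omega>. (f (s i) \<omega> - f t \<omega>) / (s i - t) \<partial>M) \<longlonglongrightarrow> (\<integral>\<omega>. f' t \<omega> \<partial>M)"
  proof (rule integral_dominated_convergence[OF f' _ D])
    show "(\<lambda>\<omega>. (f (s i) \<omega> - f t \<omega>) / (s i - t)) \<in> borel_measurable M" for i
      using f by (intro borel_measurable_divide borel_measurable_diff borel_measurable_integrable) auto
    show "AE \<omega> in M. (\<lambda>i. (f (s i) \<omega> - f t \<omega>) / (s i - t)) \<longlonglongrightarrow> f' t \<omega>"
      using deriv[of _ t] s lim
      unfolding has_field_derivative_iff tendsto_at_iff_sequentially comp_def by (intro AE_I2) blast
    show "AE \<omega> in M. norm ((f (s i) \<omega> - f t \<omega>) / (s i - t)) \<le> D \<omega>" for i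
    proof (intro AE_I2)
      fix \<omega>
      have "\<bar>f (s i) \<omega> - f t \<omega>\<bar> \<le> D \<omega> * \<bar>s i - t\<bar>"
        using field_differentiable_bound[of UNIV "\<lambda>t. f t \<omega>" "\<lambda>t. f' t \<omega>" "D \<omega>" "s i" t]
          deriv bound by auto
      then show "norm ((f (s i) \<omega> - f t \<omega>) / (s i - t)) \<le> D \<omega>"
        using s by (simp add: abs_divide pos_divide_le_eq)
    qed
  qed
  then show "(\<lambda>i. ((\<integral>\<omega>. f (s i) \<omega> \<partial>M) - (\<integral>\<omega>. f t \<omega> \<partial>M)) / (s i - t)) \<longlonglongrightarrow> (\<integral>\<omega>. f' t \<omega> \<partial>M)"
    using f by simp
qed

text \<open>
  The derivative of \<open>offdiag_form\<close> when the coefficients \<open>b\<close> move with velocity \<open>c\<close>.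
\<close>
definition path_speed ::
    "'i set \<Rightarrow> nat \<Rightarrow> (nat \<Rightarrow> real) \<Rightarrow> ('i \<Rightarrow> nat \<Rightarrow> real) \<Rightarrow> ('i \<Rightarrow> nat \<Rightarrow> real) \<Rightarrow> ('i \<Rightarrow> real) \<Rightarrow> real" where
  "path_speed I q lam b c y = (\<Sum>k\<in>I. y k * form_derivative (I - {k}) q lam b (c k) y)"

lemma offdiag_form_path_derivative:
  fixes b b' :: "real \<Rightarrow> 'i \<Rightarrow> nat \<Rightarrow> real"
  assumes fin: "finite I" and b: "\<And>k m. ((\<lambda>t. b t k m) has_real_derivative b' t k m) (at t)"
  shows "((\<lambda>t. offdiag_form I q lam (b t) y) has_real_derivative path_speed I q lam (b t) (b' t) y) (at t)"
proof -
  let ?L' = "\<lambda>m. \<Sum>k\<in>I. b' t k m * y k"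
  have L: "((\<lambda>t. lin_form I (b t) m y) has_real_derivative ?L' m) (at t)" for m
    unfolding lin_form_def by (auto intro!: derivative_eq_intros b)
  have Lsq: "((\<lambda>t. (lin_form I (b t) m y)\<^sup>2) has_real_derivative 2 * lin_form I (b t) m y * ?L' m) (at t)" for m
    using DERIV_power[OF L[of m], of 2] by (simp add: ac_simps)
  have S: "((\<lambda>t. \<Sum>k\<in>I. (b t k m)\<^sup>2 * (y k)\<^sup>2) has_real_derivative
      (\<Sum>k\<in>I. 2 * b t k m * b' t k m * (y k)\<^sup>2)) (at t)" for m
    by (auto intro!: derivative_eq_intros b sum.cong)
  have "((\<lambda>t. offdiag_form I q lam (b t) y) has_real_derivative
      (\<Sum>m=1..q. lam m * (2 * lin_form I (b t) m y * ?L' m - (\<Sum>k\<in>I. 2 * b t k m * b' t k m * (y k)\<^sup>2)))) (at t)"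
    unfolding offdiag_form_def
    by (rule DERIV_sum, rule DERIV_cmult, rule DERIV_diff, rule Lsq, rule S)
  also have "(\<Sum>m=1..q. lam m * (2 * lin_form I (b t) m y * ?L' m - (\<Sum>k\<in>I. 2 * b t k m * b' t k m * (y k)\<^sup>2)))
      = (\<Sum>m=1..q. \<Sum>k\<in>I. y k * (2 * (lam m * b' t k m * lin_form (I - {k}) (b t) m y)))"
  proof (intro sum.cong refl)
    fix m
    have "2 * lin_form I (b t) m y * ?L' m - (\<Sum>k\<in>I. 2 * b t k m * b' t k m * (y k)\<^sup>2) =
        (\<Sum>k\<in>I. 2 * b' t k m * y k * (lin_form I (b t) m y - b t k m * y k))"
      by (simp add: sum_distrib_left sum_subtractf power2_eq_square algebra_simps)
    also have "\<dots> = (\<Sum>k\<in>I. 2 * b' t k m * y k * lin_form (I - {k}) (b t) m y)"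
      by (intro sum.cong refl) (simp add: lin_form_split[OF fin])
    finally show "lam m * (2 * lin_form I (b t) m y * ?L' m - (\<Sum>k\<in>I. 2 * b t k m * b' t k m * (y k)\<^sup>2))
        = (\<Sum>k\<in>I. y k * (2 * (lam m * b' t k m * lin_form (I - {k}) (b t) m y)))"
      by (simp add: sum_distrib_left ac_simps)
  qed
  also have "\<dots> = path_speed I q lam (b t) (b' t) y"
    unfolding path_speed_def form_derivative_def
    by (subst sum.swap) (simp add: sum_distrib_left)
  finally show ?thesis .
qed

lemma path_speed_le:
  assumes fin: "finite I" and nonneg: "0 \<le> \<Lambda>" "0 \<le> \<beta>"
    and lam: "\<And>m. m \<in> {1..q} \<Longrightarrow> \<bar>lam m\<bar> \<le> \<Lambda>"
    and b: "\<And>k m. k \<in> I \<Longrightarrow> m \<in> {1..q} \<Longrightarrow> \<bar>b k m\<bar> \<le> \<beta>"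
    and c: "\<And>k m. k \<in> I \<Longrightarrow> m \<in> {1..q} \<Longrightarrow> \<bar>c k m\<bar> \<le> \<beta>"
  shows "\<bar>path_speed I q lam b c y\<bar> \<le> 2 * \<Lambda> * \<beta>\<^sup>2 * real q * real (card I) * (\<Sum>k\<in>I. (y k)\<^sup>2)"
proof -
  let ?s = "\<Sum>k\<in>I. \<bar>y k\<bar>"
  have L: "\<bar>lin_form (I - {k}) b m y\<bar> \<le> \<beta> * ?s" if "m \<in> {1..q}" for k m
  proof -
    have "\<bar>lin_form (I - {k}) b m y\<bar> \<le> (\<Sum>j\<in>I - {k}. \<beta> * \<bar>y j\<bar>)"
      unfolding lin_form_def using b that
      by (intro order_trans[OF sum_abs sum_mono]) (auto simp: abs_mult intro!: mult_right_mono)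
    also have "\<dots> \<le> (\<Sum>j\<in>I. \<beta> * \<bar>y j\<bar>)"
      using fin nonneg by (intro sum_mono2) auto
    finally show ?thesis
      by (simp add: sum_distrib_left)
  qed
  have hg: "\<bar>form_derivative (I - {k}) q lam b (c k) y\<bar> \<le> 2 * \<Lambda> * \<beta>\<^sup>2 * real q * ?s" if "k \<in> I" for k
  proof -
    have "\<bar>form_derivative (I - {k}) q lam b (c k) y\<bar> \<le> 2 * \<Lambda> * \<beta> * (\<Sum>m=1..q. \<bar>lin_form (I - {k}) b m y\<bar>)"
      using lam c[OF that] by (rule form_derivative_le)
    also have "\<dots> \<le> 2 * \<Lambda> * \<beta> * (\<Sum>m=1..q. \<beta> * ?s)"
      using L nonneg by (intro mult_left_mono sum_mono) auto
    finally show ?thesis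
      by (simp add: power2_eq_square ac_simps)
  qed
  have "\<bar>path_speed I q lam b c y\<bar> \<le> (\<Sum>k\<in>I. \<bar>y k\<bar> * (2 * \<Lambda> * \<beta>\<^sup>2 * real q * ?s))"
    unfolding path_speed_def using hg
    by (intro order_trans[OF sum_abs sum_mono]) (auto simp: abs_mult intro!: mult_left_mono)
  also have "\<dots> = 2 * \<Lambda> * \<beta>\<^sup>2 * real q * ?s\<^sup>2"
    by (simp add: power2_eq_square flip: sum_distrib_right)
  also have "\<dots> \<le> 2 * \<Lambda> * \<beta>\<^sup>2 * real q * ((\<Sum>k\<in>I. (y k)\<^sup>2) * real (card I))"
    using sum_squared_le_sum_of_squares[of "\<lambda>k. \<bar>y k\<bar>" I] nonneg by (intro mult_left_mono) auto
  finally show ?thesis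
    by (simp add: ac_simps)
qed

text \<open>
  The first summand collects the Taylor errors of \<open>N\<close> variables with coefficients of size
  \<open>\<beta>\<close>, the second the variation \<open>\<delta>\<close> of the covariances along the path.
\<close>
definition path_bound :: "real \<Rightarrow> nat \<Rightarrow> nat \<Rightarrow> real \<Rightarrow> real \<Rightarrow> real \<Rightarrow> real \<Rightarrow> real" where
  "path_bound K N q \<Lambda> \<beta> B \<delta> = form_bound K q B *
    (real N * (1 + K) * taylor_bound q \<Lambda> \<beta>
     + 4 * \<Lambda>\<^sup>2 * \<delta>)"

context unit_indep_family
begin

lemma path_speed_measurable:
  "(\<lambda>\<omega>. path_speed I q lam b c (\<lambda>i. Y i \<omega>)) \<in> borel_measurable M"
  unfolding path_speed_def
  by (intro arith_measurable form_derivative_measurable Y_measurable) auto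

text \<open>
  After the expansion in each variable the remaining terms add up to \<open>h2 Q\<close> times a quadratic
  polynomial in the linear forms. Its coefficients are the sums \<open>\<Sum>k. b k m * c k l\<close>; symmetrized in
  \<open>m\<close> and \<open>l\<close>, these are half the velocities of the covariances of the linear forms. Only the
  sums, not their single terms, have to be small.
\<close>
lemma expectation_path_speed_le:
  assumes test: "smooth_test A h h1 h2" and nonneg: "0 \<le> \<Lambda>" "0 \<le> \<beta>"
    and lam: "\<And>m. m \<in> {1..q} \<Longrightarrow> \<bar>lam m\<bar> \<le> \<Lambda>"
    and b: "\<And>k m. k \<in> I \<Longrightarrow> m \<in> {1..q} \<Longrightarrow> \<bar>b k m\<bar> \<le> \<beta>"
    and c: "\<And>k m. k \<in> I \<Longrightarrow> m \<in> {1..q} \<Longrightarrow> \<bar>c k m\<bar> \<le> \<beta>"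
    and B: "real (card I) * \<beta>\<^sup>2 \<le> B" and \<delta>0: "0 \<le> \<delta>"
    and \<delta>: "\<And>m l. m \<in> {1..q} \<Longrightarrow> l \<in> {1..q} \<Longrightarrow> \<bar>\<Sum>k\<in>I. b k m * c k l\<bar> \<le> \<delta>"
  shows "\<bar>expectation (\<lambda>\<omega>. h1 (offdiag_form I q lam b (\<lambda>i. Y i \<omega>)) * path_speed I q lam b c (\<lambda>i. Y i \<omega>))\<bar>
    \<le> A * path_bound K (card I) q \<Lambda> \<beta> B \<delta>"
proof -
  interpret smooth_test A h h1 h2 by (fact test)
  let ?y = "\<lambda>\<omega> i. Y i \<omega>"
  let ?Q = "\<lambda>\<omega>. offdiag_form I q lam b (?y \<omega>)"
  let ?W = "\<lambda>\<omega>. \<Sum>m=1..q. \<bar>lin_form I b m (?y \<omega>)\<bar>"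
  define F1 where "F1 k \<omega> = h1 (?Q \<omega>) * (Y k \<omega> * form_derivative (I - {k}) q lam b (c k) (?y \<omega>))" for k \<omega>
  define F2 where "F2 k \<omega> = h2 (?Q \<omega>) * (form_derivative I q lam b (b k) (?y \<omega>) *
      form_derivative I q lam b (c k) (?y \<omega>))" for k \<omega>
  let ?r = "A * (1 + K) * form_bound K q B *
      taylor_bound q \<Lambda> \<beta>"
  have bB: "(\<Sum>k\<in>I. (b k m)\<^sup>2) \<le> B" if "m \<in> {1..q}" for m
  proof -
    have "(\<Sum>k\<in>I. (b k m)\<^sup>2) \<le> (\<Sum>k\<in>I. \<beta>\<^sup>2)"
      using b that nonneg by (intro sum_mono) (metis abs_of_nonneg abs_le_square_iff)
    then show ?thesis
      using B by simp
  qed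
  have int: "integrable M (F1 k)" "integrable M (F2 k)"
    and est: "\<bar>expectation (F1 k) - expectation (F2 k)\<bar> \<le> ?r" if "k \<in> I" for k
    unfolding F1_def F2_def
    using coordinate_taylor_estimate[where lam = lam and b = b and q = q and c = "c k",
        OF test that lam b[OF that] c[OF that] bB nonneg]
    by simp_all
  have "expectation (\<lambda>\<omega>. h1 (?Q \<omega>) * path_speed I q lam b c (?y \<omega>)) = (\<Sum>k\<in>I. expectation (F1 k))"
    unfolding path_speed_def sum_distrib_left F1_def[symmetric] using int by (intro Bochner_Integration.integral_sum)
  then have split: "\<bar>expectation (\<lambda>\<omega>. h1 (?Q \<omega>) * path_speed I q lam b c (?y \<omega>))\<bar>
      \<le> \<bar>\<Sum>k\<in>I. expectation (F1 k) - expectation (F2 k)\<bar> + \<bar>\<Sum>k\<in>I. expectation (F2 k)\<bar>"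
    by (simp add: sum_subtractf)
  have first: "\<bar>\<Sum>k\<in>I. expectation (F1 k) - expectation (F2 k)\<bar> \<le> real (card I) * ?r"
    using order_trans[OF sum_abs sum_bounded_above[of I "\<lambda>k. \<bar>expectation (F1 k) - expectation (F2 k)\<bar>" ?r]] est
    by simp

  have gram: "\<bar>\<Sum>k\<in>I. form_derivative I q lam b (b k) y * form_derivative I q lam b (c k) y\<bar>
      \<le> 4 * \<Lambda>\<^sup>2 * \<delta> * (\<Sum>m=1..q. \<bar>lin_form I b m y\<bar>)\<^sup>2" for y
  proof -
    let ?L = "\<lambda>m. lin_form I b m y"
    have prod: "(2 * sum f {1..q}) * (2 * sum g {1..q}) = (\<Sum>m=1..q. \<Sum>l=1..q. 4 * (f m * g l))"
      for f g :: "nat \<Rightarrow> real"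
    proof -
      have "(2 * sum f {1..q}) * (2 * sum g {1..q}) = 4 * (sum f {1..q} * sum g {1..q})"
        by simp
      also have "\<dots> = (\<Sum>m=1..q. \<Sum>l=1..q. 4 * (f m * g l))"
        unfolding sum_product by (simp only: sum_distrib_left)
      finally show ?thesis .
    qed
    have "(\<Sum>k\<in>I. form_derivative I q lam b (b k) y * form_derivative I q lam b (c k) y) =
        (\<Sum>k\<in>I. \<Sum>m=1..q. \<Sum>l=1..q. 4 * (lam m * ?L m) * (lam l * ?L l) * (b k m * c k l))"
      unfolding form_derivative_def prod by (intro sum.cong refl) simp
    also have "\<dots> = (\<Sum>m=1..q. \<Sum>l=1..q. 4 * (lam m * ?L m) * (lam l * ?L l) * (\<Sum>k\<in>I. b k m * c k l))"
      by (subst sum.swap, intro sum.cong refl, subst sum.swap) (simp add: sum_distrib_left)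
    finally have "\<bar>\<Sum>k\<in>I. form_derivative I q lam b (b k) y * form_derivative I q lam b (c k) y\<bar> =
        \<bar>\<Sum>m=1..q. \<Sum>l=1..q. 4 * (lam m * ?L m) * (lam l * ?L l) * (\<Sum>k\<in>I. b k m * c k l)\<bar>"
      by (rule arg_cong)
    also have "\<dots> \<le> (\<Sum>m=1..q. \<Sum>l=1..q. 4 * (\<Lambda> * \<bar>?L m\<bar>) * (\<Lambda> * \<bar>?L l\<bar>) * \<delta>)"
    proof (intro order_trans[OF sum_abs sum_mono])
      fix m l assume ml: "m \<in> {1..q}" "l \<in> {1..q}"
      show "\<bar>4 * (lam m * ?L m) * (lam l * ?L l) * (\<Sum>k\<in>I. b k m * c k l)\<bar>
          \<le> 4 * (\<Lambda> * \<bar>?L m\<bar>) * (\<Lambda> * \<bar>?L l\<bar>) * \<delta>"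
        unfolding abs_mult abs_numeral using lam[OF ml(1)] lam[OF ml(2)] \<delta>[OF ml] nonneg
        by (intro mult_mono mult_nonneg_nonneg) auto
    qed
    also have "\<dots> = 4 * \<Lambda>\<^sup>2 * \<delta> * (\<Sum>m=1..q. \<bar>?L m\<bar>)\<^sup>2"
      by (simp add: power2_eq_square sum_product sum_distrib_left ac_simps)
    finally show ?thesis .
  qed
  have W2: "integrable M (\<lambda>\<omega>. (?W \<omega>)\<^sup>2)" "expectation (\<lambda>\<omega>. (?W \<omega>)\<^sup>2) \<le> form_bound K q B"
    using sum_abs_lin_form_moments[OF subset_refl, where b = b and q = q and r = 2 and B = B] bB by auto
  have second: "\<bar>\<Sum>k\<in>I. expectation (F2 k)\<bar> \<le> A * (4 * \<Lambda>\<^sup>2 * \<delta>) * form_bound K q B"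
  proof -
    have le: "\<bar>\<Sum>k\<in>I. F2 k \<omega>\<bar> \<le> A * (4 * \<Lambda>\<^sup>2 * \<delta>) * (?W \<omega>)\<^sup>2" for \<omega>
    proof -
      have "\<bar>\<Sum>k\<in>I. F2 k \<omega>\<bar> = \<bar>h2 (?Q \<omega>)\<bar> *
          \<bar>\<Sum>k\<in>I. form_derivative I q lam b (b k) (?y \<omega>) * form_derivative I q lam b (c k) (?y \<omega>)\<bar>"
        by (simp add: F2_def abs_mult flip: sum_distrib_left)
      also have "\<dots> \<le> A * (4 * \<Lambda>\<^sup>2 * \<delta> * (?W \<omega>)\<^sup>2)"
        using h2_le gram A_nonneg by (intro mult_mono) auto
      finally show ?thesis
        by simp
    qed
    have "\<bar>\<Sum>k\<in>I. expectation (F2 k)\<bar> = \<bar>expectation (\<lambda>\<omega>. \<Sum>k\<in>I. F2 k \<omega>) - expectation (\<lambda>\<omega>. 0)\<bar>"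
      using int by simp
    also have "\<dots> \<le> expectation (\<lambda>\<omega>. A * (4 * \<Lambda>\<^sup>2 * \<delta>) * (?W \<omega>)\<^sup>2)"
      using int W2 le by (intro abs_expectation_diff_le Bochner_Integration.integrable_sum) auto
    also have "\<dots> \<le> A * (4 * \<Lambda>\<^sup>2 * \<delta>) * form_bound K q B"
      using W2 A_nonneg \<delta>0 by (simp add: mult_left_mono)
    finally show ?thesis .
  qed
  have "real (card I) * ?r + A * (4 * \<Lambda>\<^sup>2 * \<delta>) * form_bound K q B = A * path_bound K (card I) q \<Lambda> \<beta> B \<delta>"
    unfolding path_bound_def by (simp add: algebra_simps)
  then show ?thesis
    using split first second by linarith
qed

theorem smart_path_comparison:
  fixes b b' :: "real \<Rightarrow> 'i \<Rightarrow> nat \<Rightarrow> real"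
  assumes test: "smooth_test A h h1 h2" and nonneg: "0 \<le> \<Lambda>" "0 \<le> \<beta>"
    and bounded: "\<And>x. \<bar>h x\<bar> \<le> H"
    and lam: "\<And>m. m \<in> {1..q} \<Longrightarrow> \<bar>lam m\<bar> \<le> \<Lambda>"
    and deriv: "\<And>t k m. ((\<lambda>t. b t k m) has_real_derivative b' t k m) (at t)"
    and b: "\<And>t k m. k \<in> I \<Longrightarrow> m \<in> {1..q} \<Longrightarrow> \<bar>b t k m\<bar> \<le> \<beta>"
    and b': "\<And>t k m. k \<in> I \<Longrightarrow> m \<in> {1..q} \<Longrightarrow> \<bar>b' t k m\<bar> \<le> \<beta>"
    and B: "real (card I) * \<beta>\<^sup>2 \<le> B" and \<delta>0: "0 \<le> \<delta>"
    and \<delta>: "\<And>t m l. m \<in> {1..q} \<Longrightarrow> l \<in> {1..q} \<Longrightarrow> \<bar>\<Sum>k\<in>I. b t k m * b' t k l\<bar> \<le> \<delta>"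
  shows "\<bar>expectation (\<lambda>\<omega>. h (offdiag_form I q lam (b u) (\<lambda>i. Y i \<omega>)))
          - expectation (\<lambda>\<omega>. h (offdiag_form I q lam (b v) (\<lambda>i. Y i \<omega>)))\<bar>
         \<le> A * path_bound K (card I) q \<Lambda> \<beta> B \<delta> * \<bar>u - v\<bar>"
proof -
  interpret smooth_test A h h1 h2 by (fact test)
  let ?Q = "\<lambda>t \<omega>. offdiag_form I q lam (b t) (\<lambda>i. Y i \<omega>)"
  let ?S = "\<lambda>t \<omega>. path_speed I q lam (b t) (b' t) (\<lambda>i. Y i \<omega>)"
  have meas: "?Q t \<in> borel_measurable M" "?S t \<in> borel_measurable M" for t
    by (auto intro: offdiag_form_measurable path_speed_measurable)
  have D: "((\<lambda>t. expectation (\<lambda>\<omega>. h (?Q t \<omega>))) has_real_derivative expectation (\<lambda>\<omega>. h1 (?Q t \<omega>) * ?S t \<omega>)) (at t)" for t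
  proof (rule has_real_derivative_integral_dominated)
    let ?D = "\<lambda>\<omega>. A * (2 * \<Lambda> * \<beta>\<^sup>2 * real q * real (card I) * (\<Sum>k\<in>I. (Y k \<omega>)\<^sup>2))"
    show "((\<lambda>t. h (?Q t \<omega>)) has_real_derivative h1 (?Q t \<omega>) * ?S t \<omega>) (at t)" for t \<omega>
      by (intro DERIV_chain2[where f = h] DERIV_h offdiag_form_path_derivative finite_I deriv)
    show "\<bar>h1 (?Q t \<omega>) * ?S t \<omega>\<bar> \<le> ?D \<omega>" for t \<omega>
      unfolding abs_mult using h1_le A_nonneg path_speed_le[OF finite_I nonneg lam b b']
      by (intro mult_mono) auto
    show "integrable M ?D"
      using integrable_power(2)[where j = 2]
      by (intro integrable_mult_right Bochner_Integration.integrable_sum) auto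
    show "integrable M (\<lambda>\<omega>. h (?Q t \<omega>))" for t
      using meas(1)[of t] bounded by (intro integrable_const_bound[of _ H]) auto
    show "(\<lambda>\<omega>. h1 (?Q t \<omega>) * ?S t \<omega>) \<in> borel_measurable M"
      using meas by measurable
  qed
  show ?thesis
    using field_differentiable_bound[of UNIV "\<lambda>t. expectation (\<lambda>\<omega>. h (?Q t \<omega>))"
        "\<lambda>t. expectation (\<lambda>\<omega>. h1 (?Q t \<omega>) * ?S t \<omega>)" "A * path_bound K (card I) q \<Lambda> \<beta> B \<delta>" u v]
      D expectation_path_speed_le[OF test nonneg lam b b' B \<delta>0 \<delta>] by auto
qed

end

section \<open>Restoring the diagonal; expectations determined by marginal laws\<close>

text \<open>
  For variables of mean zero and variance one, the quadratic form minus its expectation.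
\<close>
definition centered_form ::
    "'i set \<Rightarrow> nat \<Rightarrow> (nat \<Rightarrow> real) \<Rightarrow> ('i \<Rightarrow> nat \<Rightarrow> real) \<Rightarrow> ('i \<Rightarrow> real) \<Rightarrow> real" where
  "centered_form I q lam b y = (\<Sum>m=1..q. lam m * ((lin_form I b m y)\<^sup>2 - (\<Sum>k\<in>I. (b k m)\<^sup>2)))"

lemma centered_form_eq_offdiag:
  "centered_form I q lam b y =
    offdiag_form I q lam b y + (\<Sum>k\<in>I. (\<Sum>m=1..q. lam m * (b k m)\<^sup>2) * ((y k)\<^sup>2 - 1))"
proof -
  have "(\<Sum>k\<in>I. (\<Sum>m=1..q. lam m * (b k m)\<^sup>2) * ((y k)\<^sup>2 - 1)) =
      (\<Sum>k\<in>I. \<Sum>m=1..q. lam m * ((b k m)\<^sup>2 * (y k)\<^sup>2 - (b k m)\<^sup>2))"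
    unfolding sum_distrib_right by (intro sum.cong refl) (simp add: algebra_simps)
  also have "\<dots> = (\<Sum>m=1..q. lam m * ((\<Sum>k\<in>I. (b k m)\<^sup>2 * (y k)\<^sup>2) - (\<Sum>k\<in>I. (b k m)\<^sup>2)))"
    by (subst sum.swap) (simp add: sum_subtractf flip: sum_distrib_left)
  finally show ?thesis
    unfolding centered_form_def offdiag_form_def by (simp add: algebra_simps flip: sum.distrib)
qed

context unit_indep_family
begin

lemma centered_form_measurable:
  "(\<lambda>\<omega>. centered_form I q lam b (\<lambda>i. Y i \<omega>)) \<in> borel_measurable M"
  unfolding centered_form_def
  by (intro arith_measurable lin_form_measurable order_refl)

lemma expectation_lin_form_square:
  shows "integrable M (\<lambda>\<omega>. (lin_form I b m (\<lambda>i. Y i \<omega>))\<^sup>2)"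
    and "expectation (\<lambda>\<omega>. (lin_form I b m (\<lambda>i. Y i \<omega>))\<^sup>2) = (\<Sum>k\<in>I. (b k m)\<^sup>2)"
  using linear_form_moments[OF subset_refl, of "\<lambda>k. b k m"] by (simp_all add: lin_form_def)

lemma expectation_abs_centered_form_le:
  assumes lam: "\<And>m. m \<in> {1..q} \<Longrightarrow> \<bar>lam m\<bar> \<le> \<Lambda>" and \<Lambda>: "0 \<le> \<Lambda>"
    and B: "\<And>m. m \<in> {1..q} \<Longrightarrow> (\<Sum>k\<in>I. (b k m)\<^sup>2) \<le> B"
  shows "integrable M (\<lambda>\<omega>. centered_form I q lam b (\<lambda>i. Y i \<omega>))"
    and "expectation (\<lambda>\<omega>. \<bar>centered_form I q lam b (\<lambda>i. Y i \<omega>)\<bar>) \<le> 2 * real q * \<Lambda> * B"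
proof -
  let ?L = "\<lambda>m \<omega>. (lin_form I b m (\<lambda>i. Y i \<omega>))\<^sup>2"
  let ?s = "\<lambda>m. \<Sum>k\<in>I. (b k m)\<^sup>2"
  let ?R = "\<lambda>\<omega>. \<Sum>m=1..q. \<Lambda> * (?L m \<omega> + ?s m)"
  show int: "integrable M (\<lambda>\<omega>. centered_form I q lam b (\<lambda>i. Y i \<omega>))"
    unfolding centered_form_def using expectation_lin_form_square(1)
    by (intro Bochner_Integration.integrable_sum) simp
  have R: "integrable M ?R"
    using expectation_lin_form_square(1) by (intro Bochner_Integration.integrable_sum) simp
  have "expectation (\<lambda>\<omega>. \<bar>centered_form I q lam b (\<lambda>i. Y i \<omega>)\<bar>) \<le> expectation ?R"
  proof (intro integral_mono integrable_abs int R)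
    fix \<omega>
    show "\<bar>centered_form I q lam b (\<lambda>i. Y i \<omega>)\<bar> \<le> ?R \<omega>"
      unfolding centered_form_def
    proof (intro order_trans[OF sum_abs sum_mono])
      fix m assume m: "m \<in> {1..q}"
      have "\<bar>?L m \<omega> - ?s m\<bar> \<le> ?L m \<omega> + ?s m"
        using sum_nonneg[of I "\<lambda>k. (b k m)\<^sup>2"] zero_le_power2[of "lin_form I b m (\<lambda>i. Y i \<omega>)"]
        by (simp add: abs_le_iff)
      then show "\<bar>lam m * (?L m \<omega> - ?s m)\<bar> \<le> \<Lambda> * (?L m \<omega> + ?s m)"
        unfolding abs_mult using lam[OF m] \<Lambda> by (intro mult_mono) auto
    qed
  qed
  also have "\<dots> = (\<Sum>m=1..q. \<Lambda> * (?s m + ?s m))"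
    using expectation_lin_form_square by (simp add: prob_space)
  also have "\<dots> \<le> (\<Sum>m=1..q. \<Lambda> * (B + B))"
    using B \<Lambda> by (intro sum_mono mult_left_mono add_mono) auto
  finally show "expectation (\<lambda>\<omega>. \<bar>centered_form I q lam b (\<lambda>i. Y i \<omega>)\<bar>) \<le> 2 * real q * \<Lambda> * B"
    by simp
qed

text \<open>
  The difference of the two forms is a weighted sum of \<open>(Y k)\<^sup>2 - 1\<close> with weights of order
  \<open>\<beta>\<^sup>2\<close>, and \<open>h\<close> is Lipschitz.
\<close>
lemma smooth_test_offdiag_centered_le:
  assumes test: "smooth_test A h h1 h2" and H: "\<And>x. \<bar>h x\<bar> \<le> H"
    and lam: "\<And>m. m \<in> {1..q} \<Longrightarrow> \<bar>lam m\<bar> \<le> \<Lambda>" and \<Lambda>: "0 \<le> \<Lambda>"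
    and b: "\<And>k m. k \<in> I \<Longrightarrow> m \<in> {1..q} \<Longrightarrow> \<bar>b k m\<bar> \<le> \<beta>"
  shows "\<bar>expectation (\<lambda>\<omega>. h (centered_form I q lam b (\<lambda>i. Y i \<omega>)))
      - expectation (\<lambda>\<omega>. h (offdiag_form I q lam b (\<lambda>i. Y i \<omega>)))\<bar>
    \<le> A * (real q * \<Lambda> * \<beta>\<^sup>2 * sqrt (K * real (card I)))"
proof -
  interpret smooth_test A h h1 h2 by (fact test)
  define w where "w k = (\<Sum>m=1..q. lam m * (b k m)\<^sup>2)" for k
  let ?C = "\<lambda>\<omega>. centered_form I q lam b (\<lambda>i. Y i \<omega>)"
  let ?Q = "\<lambda>\<omega>. offdiag_form I q lam b (\<lambda>i. Y i \<omega>)"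
  let ?D = "\<lambda>\<omega>. \<Sum>k\<in>I. w k * ((Y k \<omega>)\<^sup>2 - 1)"
  have CQ: "?C \<omega> = ?Q \<omega> + ?D \<omega>" for \<omega>
    unfolding w_def by (rule centered_form_eq_offdiag)
  have w: "\<bar>w k\<bar> \<le> real q * \<Lambda> * \<beta>\<^sup>2" if "k \<in> I" for k
  proof -
    have "\<bar>w k\<bar> \<le> (\<Sum>m=1..q. \<Lambda> * \<beta>\<^sup>2)"
      unfolding w_def
    proof (intro order_trans[OF sum_abs sum_mono])
      fix m assume m: "m \<in> {1..q}"
      have "(b k m)\<^sup>2 \<le> \<beta>\<^sup>2"
        using power_mono[OF b[OF that m], of 2] by simp
      then show "\<bar>lam m * (b k m)\<^sup>2\<bar> \<le> \<Lambda> * \<beta>\<^sup>2"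
        unfolding abs_mult using lam[OF m] \<Lambda> by (intro mult_mono) auto
    qed
    then show ?thesis
      by simp
  qed
  have "(\<Sum>k\<in>I. (w k)\<^sup>2) \<le> (\<Sum>k\<in>I. (real q * \<Lambda> * \<beta>\<^sup>2)\<^sup>2)"
    using w power_mono[OF w, of _ 2] by (intro sum_mono) auto
  then have "K * (\<Sum>k\<in>I. (w k)\<^sup>2) \<le> K * (real (card I) * (real q * \<Lambda> * \<beta>\<^sup>2)\<^sup>2)"
    using K_ge by (intro mult_left_mono) auto
  then have "sqrt (K * (\<Sum>k\<in>I. (w k)\<^sup>2)) \<le> sqrt (K * real (card I) * (real q * \<Lambda> * \<beta>\<^sup>2)\<^sup>2)"
    by (simp add: mult.assoc)
  also have "\<dots> = real q * \<Lambda> * \<beta>\<^sup>2 * sqrt (K * real (card I))"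
    using \<Lambda> by (simp add: real_sqrt_mult)
  finally have sq: "expectation (\<lambda>\<omega>. \<bar>?D \<omega>\<bar>) \<le> real q * \<Lambda> * \<beta>\<^sup>2 * sqrt (K * real (card I))"
    using expectation_abs_weighted_square_fluctuation(2)[of w] by linarith
  have "\<bar>expectation (\<lambda>\<omega>. h (?C \<omega>)) - expectation (\<lambda>\<omega>. h (?Q \<omega>))\<bar> \<le> expectation (\<lambda>\<omega>. A * \<bar>?D \<omega>\<bar>)"
  proof (rule abs_expectation_diff_le)
    show "integrable M (\<lambda>\<omega>. h (?C \<omega>))" "integrable M (\<lambda>\<omega>. h (?Q \<omega>))"
      using H centered_form_measurable offdiag_form_measurable[OF subset_refl]
      by (auto intro!: integrable_const_bound[of _ H])
    show "integrable M (\<lambda>\<omega>. A * \<bar>?D \<omega>\<bar>)"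
      using expectation_abs_weighted_square_fluctuation(1)[of w] by simp
    show "\<bar>h (?C \<omega>) - h (?Q \<omega>)\<bar> \<le> A * \<bar>?D \<omega>\<bar>" for \<omega>
      using h_lipschitz[of "?C \<omega>" "?Q \<omega>"] CQ[of \<omega>] by simp
  qed
  also have "\<dots> \<le> A * (real q * \<Lambda> * \<beta>\<^sup>2 * sqrt (K * real (card I)))"
    using sq A_nonneg by (simp add: mult_left_mono)
  finally show ?thesis .
qed

lemma smooth_test_rescale_le:
  assumes test: "smooth_test A h h1 h2" and H: "\<And>x. \<bar>h x\<bar> \<le> H"
    and lam: "\<And>m. m \<in> {1..q} \<Longrightarrow> \<bar>lam m\<bar> \<le> \<Lambda>" and \<Lambda>: "0 \<le> \<Lambda>"
    and B: "\<And>m. m \<in> {1..q} \<Longrightarrow> (\<Sum>k\<in>I. (b k m)\<^sup>2) \<le> B"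
  shows "\<bar>expectation (\<lambda>\<omega>. h (\<rho> * centered_form I q lam b (\<lambda>i. Y i \<omega>)))
      - expectation (\<lambda>\<omega>. h (centered_form I q lam b (\<lambda>i. Y i \<omega>)))\<bar>
    \<le> A * (\<bar>\<rho> - 1\<bar> * (2 * real q * \<Lambda> * B))"
proof -
  interpret smooth_test A h h1 h2 by (fact test)
  let ?C = "\<lambda>\<omega>. centered_form I q lam b (\<lambda>i. Y i \<omega>)"
  note C = expectation_abs_centered_form_le[where lam = lam and b = b and q = q, OF lam \<Lambda> B]
  have "\<bar>expectation (\<lambda>\<omega>. h (\<rho> * ?C \<omega>)) - expectation (\<lambda>\<omega>. h (?C \<omega>))\<bar>
      \<le> expectation (\<lambda>\<omega>. A * \<bar>\<rho> - 1\<bar> * \<bar>?C \<omega>\<bar>)"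
  proof (rule abs_expectation_diff_le)
    show "integrable M (\<lambda>\<omega>. h (\<rho> * ?C \<omega>))" "integrable M (\<lambda>\<omega>. h (?C \<omega>))"
      using H centered_form_measurable by (auto intro!: integrable_const_bound[of _ H])
    show "integrable M (\<lambda>\<omega>. A * \<bar>\<rho> - 1\<bar> * \<bar>?C \<omega>\<bar>)"
      using C(1) by simp
    show "\<bar>h (\<rho> * ?C \<omega>) - h (?C \<omega>)\<bar> \<le> A * \<bar>\<rho> - 1\<bar> * \<bar>?C \<omega>\<bar>" for \<omega>
    proof -
      have "\<rho> * ?C \<omega> - ?C \<omega> = (\<rho> - 1) * ?C \<omega>"
        by (simp add: algebra_simps)
      then show ?thesis
        using h_lipschitz[of "\<rho> * ?C \<omega>" "?C \<omega>"] by (simp add: abs_mult mult.assoc)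
    qed
  qed
  also have "\<dots> \<le> A * (\<bar>\<rho> - 1\<bar> * (2 * real q * \<Lambda> * B))"
    using C(2) A_nonneg by (simp add: mult.assoc mult_left_mono)
  finally show ?thesis .
qed

end

lemma expectation_eq_of_same_marginals:
  fixes X :: "'i \<Rightarrow> 'a \<Rightarrow> real" and Y :: "'i \<Rightarrow> 'b \<Rightarrow> real" and F :: "('i \<Rightarrow> real) \<Rightarrow> real"
  assumes M: "prob_space M" and N: "prob_space N" and I: "I \<noteq> {}"
    and X: "prob_space.indep_vars M (\<lambda>_. borel) X I" and Y: "prob_space.indep_vars N (\<lambda>_. borel) Y I"
    and same: "\<And>i. i \<in> I \<Longrightarrow> distr M borel (X i) = distr N borel (Y i)"
    and F: "F \<in> borel_measurable (PiM I (\<lambda>_. borel))" "\<And>y. F (restrict y I) = F y"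
  shows "(\<integral>\<omega>. F (\<lambda>i. X i \<omega>) \<partial>M) = (\<integral>\<omega>. F (\<lambda>i. Y i \<omega>) \<partial>N)"
proof -
  interpret M: prob_space M by fact
  interpret N: prob_space N by fact
  have rvX: "\<And>i. i \<in> I \<Longrightarrow> X i \<in> borel_measurable M" and rvY: "\<And>i. i \<in> I \<Longrightarrow> Y i \<in> borel_measurable N"
    using X Y by (auto simp: M.indep_vars_def N.indep_vars_def)
  let ?P = "PiM I (\<lambda>_. borel :: real measure)"
  have mX: "(\<lambda>\<omega>. \<lambda>i\<in>I. X i \<omega>) \<in> M \<rightarrow>\<^sub>M ?P" and mY: "(\<lambda>\<omega>. \<lambda>i\<in>I. Y i \<omega>) \<in> N \<rightarrow>\<^sub>M ?P"
    using rvX rvY by (auto intro: measurable_restrict)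
  have "distr M ?P (\<lambda>\<omega>. \<lambda>i\<in>I. X i \<omega>) = (\<Pi>\<^sub>M i\<in>I. distr M borel (X i))"
    using X M.indep_vars_iff_distr_eq_PiM'[OF I, where M' = "\<lambda>_. borel" and X = X] rvX by simp
  also have "\<dots> = (\<Pi>\<^sub>M i\<in>I. distr N borel (Y i))"
    using same by (intro PiM_cong) auto
  also have "\<dots> = distr N ?P (\<lambda>\<omega>. \<lambda>i\<in>I. Y i \<omega>)"
    using Y N.indep_vars_iff_distr_eq_PiM'[OF I, where M' = "\<lambda>_. borel" and X = Y] rvY by simp
  finally have law: "distr M ?P (\<lambda>\<omega>. \<lambda>i\<in>I. X i \<omega>) = distr N ?P (\<lambda>\<omega>. \<lambda>i\<in>I. Y i \<omega>)" .
  have "(\<integral>\<omega>. F (\<lambda>i. X i \<omega>) \<partial>M) = (\<integral>y. F y \<partial>distr M ?P (\<lambda>\<omega>. \<lambda>i\<in>I. X i \<omega>))"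
    using integral_distr[OF mX F(1)] F(2) by simp
  also have "\<dots> = (\<integral>\<omega>. F (\<lambda>i. Y i \<omega>) \<partial>N)"
    unfolding law using integral_distr[OF mY F(1)] F(2) by simp
  finally show ?thesis .
qed

lemma (in prob_space) indep_vars_reindex_inj:
  fixes Y :: "'i \<Rightarrow> 'a \<Rightarrow> real"
  assumes ind: "indep_vars (\<lambda>_. borel) Y I" and f: "inj_on f J" "f ` J \<subseteq> I"
  shows "indep_vars (\<lambda>_. borel) (\<lambda>j. Y (f j)) J"
proof -
  have "indep_vars (\<lambda>j. PiM {f j} (\<lambda>_. borel)) (\<lambda>j \<omega>. restrict (\<lambda>i. Y i \<omega>) {f j}) J"
    by (rule indep_vars_restrict[OF ind]) (use f in \<open>auto simp: disjoint_family_on_def inj_on_def\<close>)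
  then have "indep_vars (\<lambda>_. borel) (\<lambda>j \<omega>. (\<lambda>y. y (f j)) (restrict (\<lambda>i. Y i \<omega>) {f j})) J"
    by (rule indep_vars_compose2[where Y = "\<lambda>j y. y (f j)"]) (auto intro: measurable_component_singleton)
  then show ?thesis
    by simp
qed

lemma indep_coordinates_PiM:
  fixes \<mu> :: "'i \<Rightarrow> real measure"
  assumes fin: "finite I" and I: "I \<noteq> {}" and \<mu>: "\<And>i. prob_space (\<mu> i)" "\<And>i. sets (\<mu> i) = sets borel"
  shows "prob_space (PiM I \<mu>)"
    and "i \<in> I \<Longrightarrow> distr (PiM I \<mu>) borel (\<lambda>\<omega>. \<omega> i) = \<mu> i"
    and "prob_space.indep_vars (PiM I \<mu>) (\<lambda>_. borel) (\<lambda>i \<omega>. \<omega> i) I"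
proof -
  show P: "prob_space (PiM I \<mu>)"
    by (rule prob_space_PiM) (rule \<mu>)
  interpret P: prob_space "PiM I \<mu>" by fact
  have comp: "distr (PiM I \<mu>) borel (\<lambda>\<omega>. \<omega> i) = \<mu> i" if "i \<in> I" for i
  proof -
    have "distr (PiM I \<mu>) borel (\<lambda>\<omega>. \<omega> i) = distr (PiM I \<mu>) (\<mu> i) (\<lambda>\<omega>. \<omega> i)"
      by (rule distr_cong) (simp_all add: \<mu>)
    also have "\<dots> = \<mu> i"
      by (rule distr_PiM_component[OF \<mu>(1) that])
    finally show ?thesis .
  qed
  then show "i \<in> I \<Longrightarrow> distr (PiM I \<mu>) borel (\<lambda>\<omega>. \<omega> i) = \<mu> i" .
  have rv: "(\<lambda>\<omega>. \<omega> i) \<in> borel_measurable (PiM I \<mu>)" if "i \<in> I" for i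
    using measurable_component_singleton[OF that, of \<mu>] measurable_cong_sets[OF refl \<mu>(2)] by blast
  have "distr (PiM I \<mu>) (PiM I (\<lambda>_. borel)) (\<lambda>\<omega>. \<lambda>i\<in>I. \<omega> i) = distr (PiM I \<mu>) (PiM I \<mu>) (\<lambda>\<omega>. \<omega>)"
    by (rule distr_cong) (auto simp: \<mu> space_PiM intro!: sets_PiM_cong)
  also have "\<dots> = PiM I (\<lambda>i. distr (PiM I \<mu>) borel (\<lambda>\<omega>. \<omega> i))"
    using comp by (simp add: distr_id cong: PiM_cong)
  finally show "prob_space.indep_vars (PiM I \<mu>) (\<lambda>_. borel) (\<lambda>i \<omega>. \<omega> i) I"
    using P.indep_vars_iff_distr_eq_PiM'[OF I, where M' = "\<lambda>_. borel" and X = "\<lambda>i \<omega>. \<omega> i"] rv by simp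
qed

section \<open>Comparison of the quadratic form with its Gaussian limit\<close>

text \<open>
  The index \<open>(0, i)\<close> stands for the variable \<open>X i\<close> and \<open>(j, i)\<close> with \<open>1 \<le> j\<close> for the
  \<open>i\<close>-th standard normal summand of the limit variable \<open>Z j\<close>. The time runs from 0, the Gaussian
  end, to \<open>pi / 2\<close>. Sine and cosine keep the variances of the linear forms near one, and
  differentiation is a shift of \<open>t\<close> by \<open>pi / 2\<close>.
\<close>
definition path_coeff :: "nat \<Rightarrow> (nat \<Rightarrow> nat \<Rightarrow> real) \<Rightarrow> real \<Rightarrow> nat \<times> nat \<Rightarrow> nat \<Rightarrow> real" where
  "path_coeff n c t k m =
     (if fst k = 0 then sin t * c (snd k) m else if fst k = m then cos t / sqrt (real n) else 0)"

lemma DERIV_path_coeff: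
  "((\<lambda>t. path_coeff n c t k m) has_real_derivative path_coeff n c (t + pi / 2) k m) (at t)"
proof -
  have "((\<lambda>t. sin t * c (snd k) m) has_real_derivative cos t * c (snd k) m) (at t)"
    "((\<lambda>t. cos t / sqrt (real n)) has_real_derivative - sin t / sqrt (real n)) (at t)"
    using DERIV_cmult_right[OF DERIV_sin, of "c (snd k) m" t] DERIV_cdivide[OF DERIV_cos, of "sqrt (real n)" t]
    by (simp_all add: mult.commute)
  moreover have "sin (t + pi / 2) = cos t" "cos (t + pi / 2) = - sin t"
    by (simp_all add: sin_add cos_add)
  ultimately show ?thesis
    unfolding path_coeff_def by simp
qed

lemma abs_path_coeff_le:
  assumes "\<And>i. i \<in> {1..n} \<Longrightarrow> \<bar>c i m\<bar> \<le> \<beta>" "1 / sqrt (real n) \<le> \<beta>" and k: "k \<in> {0..q} \<times> {1..n}"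
  shows "\<bar>path_coeff n c t k m\<bar> \<le> \<beta>"
proof -
  have 0: "0 \<le> \<beta>"
    using assms(2) order_trans[of 0 "1 / sqrt (real n)" \<beta>] by simp
  have "\<bar>sin t * c (snd k) m\<bar> \<le> 1 * \<beta>"
    unfolding abs_mult using assms(1)[of "snd k"] k by (intro mult_mono) auto
  moreover have "\<bar>cos t * (1 / sqrt (real n))\<bar> \<le> 1 * \<beta>"
    unfolding abs_mult using assms(2) by (intro mult_mono) auto
  ultimately show ?thesis
    using 0 by (simp add: path_coeff_def)
qed

lemma sum_path_index:
  "(\<Sum>k\<in>{0..q} \<times> {1..n}. f k) = (\<Sum>i=1..n. f (0, i)) + (\<Sum>j=1..q. \<Sum>i=1..n. f (j, i))"
  for f :: "nat \<times> nat \<Rightarrow> real"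
proof -
  have "(\<Sum>k\<in>{0..q} \<times> {1..n}. f k) = (\<Sum>j=0..q. \<Sum>i=1..n. f (j, i))"
    by (simp add: sum.cartesian_product)
  then show ?thesis
    by (simp add: sum.atLeast_Suc_atMost)
qed

lemma gram_path_coeff:
  assumes n: "0 < n" and m: "m \<in> {1..q}" and l: "l \<in> {1..q}"
  shows "(\<Sum>k\<in>{0..q} \<times> {1..n}. path_coeff n c t k m * path_coeff n c s k l) =
     sin t * sin s * (\<Sum>i=1..n. c i m * c i l) + cos t * cos s * (if m = l then 1 else 0)"
proof -
  have "(\<Sum>i=1..n. path_coeff n c t (j, i) m * path_coeff n c s (j, i) l) =
      (if j = m then cos t * cos s * (if m = l then 1 else 0) else 0)" if "j \<in> {1..q}" for j
    using that n by (simp add: path_coeff_def)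
  then have "(\<Sum>j=1..q. \<Sum>i=1..n. path_coeff n c t (j, i) m * path_coeff n c s (j, i) l) =
      (\<Sum>j=1..q. if j = m then cos t * cos s * (if m = l then 1 else 0) else 0)"
    by (intro sum.cong refl) simp
  also have "\<dots> = cos t * cos s * (if m = l then 1 else 0)"
    using m by simp
  finally show ?thesis
    unfolding sum_path_index by (simp add: path_coeff_def sum_distrib_left ac_simps)
qed

lemma lin_form_path_coeff:
  assumes m: "m \<in> {1..q}"
  shows "lin_form ({0..q} \<times> {1..n}) (path_coeff n c t) m y =
    sin t * (\<Sum>i=1..n. c i m * y (0, i)) + cos t * (\<Sum>i=1..n. y (m, i) / sqrt (real n))"
proof -
  have "(\<Sum>i=1..n. path_coeff n c t (j, i) m * y (j, i)) =
      (if j = m then cos t * (\<Sum>i=1..n. y (m, i) / sqrt (real n)) else 0)" if "j \<in> {1..q}" for j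
    using that by (simp add: path_coeff_def sum_distrib_left)
  then have "(\<Sum>j=1..q. \<Sum>i=1..n. path_coeff n c t (j, i) m * y (j, i)) =
      (\<Sum>j=1..q. if j = m then cos t * (\<Sum>i=1..n. y (m, i) / sqrt (real n)) else 0)"
    by (intro sum.cong refl) simp
  also have "\<dots> = cos t * (\<Sum>i=1..n. y (m, i) / sqrt (real n))"
    using m by simp
  finally show ?thesis
    unfolding lin_form_def sum_path_index by (simp add: path_coeff_def sum_distrib_left ac_simps)
qed

lemma centered_form_path_end:
  assumes n: "0 < n"
  shows "centered_form ({0..q} \<times> {1..n}) q w (path_coeff n c (pi / 2)) y =
    (\<Sum>m=1..q. w m * ((\<Sum>i=1..n. c i m * y (0, i))\<^sup>2 - (\<Sum>i=1..n. (c i m)\<^sup>2)))"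
  unfolding centered_form_def
proof (intro sum.cong refl)
  fix m assume m: "m \<in> {1..q}"
  have "lin_form ({0..q} \<times> {1..n}) (path_coeff n c (pi / 2)) m y = (\<Sum>i=1..n. c i m * y (0, i))"
    using lin_form_path_coeff[OF m, where t = "pi / 2"] by simp
  moreover have "(\<Sum>k\<in>{0..q} \<times> {1..n}. (path_coeff n c (pi / 2) k m)\<^sup>2) = (\<Sum>i=1..n. (c i m)\<^sup>2)"
    using gram_path_coeff[OF n m m, where t = "pi / 2" and s = "pi / 2"] by (simp add: power2_eq_square)
  ultimately show "w m * ((lin_form ({0..q} \<times> {1..n}) (path_coeff n c (pi / 2)) m y)\<^sup>2
      - (\<Sum>k\<in>{0..q} \<times> {1..n}. (path_coeff n c (pi / 2) k m)\<^sup>2)) = w m * ((\<Sum>i=1..n. c i m * y (0, i))\<^sup>2 - (\<Sum>i=1..n. (c i m)\<^sup>2))"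
    by simp
qed

lemma centered_form_path_start:
  assumes n: "0 < n"
  shows "centered_form ({0..q} \<times> {1..n}) q w (path_coeff n c 0) y =
    (\<Sum>m=1..q. w m * ((\<Sum>i=1..n. y (m, i) / sqrt (real n))\<^sup>2 - 1))"
  unfolding centered_form_def
proof (intro sum.cong refl)
  fix m assume m: "m \<in> {1..q}"
  have "lin_form ({0..q} \<times> {1..n}) (path_coeff n c 0) m y = (\<Sum>i=1..n. y (m, i) / sqrt (real n))"
    using lin_form_path_coeff[OF m, where t = 0] by simp
  moreover have "(\<Sum>k\<in>{0..q} \<times> {1..n}. (path_coeff n c 0 k m)\<^sup>2) = 1"
    using gram_path_coeff[OF n m m, where t = 0 and s = 0] by (simp add: power2_eq_square)
  ultimately show "w m * ((lin_form ({0..q} \<times> {1..n}) (path_coeff n c 0) m y)\<^sup>2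
      - (\<Sum>k\<in>{0..q} \<times> {1..n}. (path_coeff n c 0 k m)\<^sup>2)) = w m * ((\<Sum>i=1..n. y (m, i) / sqrt (real n))\<^sup>2 - 1)"
    by simp
qed

lemma std_normal_moments:
  shows "integrable std_normal_distribution (\<lambda>x. x ^ 4)"
    and "(LINT x|std_normal_distribution. x) = 0"
    and "(LINT x|std_normal_distribution. x\<^sup>2) = 1"
    and "(LINT x|std_normal_distribution. x ^ 4) = 3"
  using integrable_std_normal_distribution_moment[of 4] integral_std_normal_distribution_moment_odd[of 1]
    std_normal_distribution_even_moments(1)[of 1] std_normal_distribution_even_moments(1)[of 2]
  by (simp_all add: fact_numeral)

text \<open>
  The two families of the theorem live on different spaces and only their laws matter; the product
  measure of the marginal laws carries copies of all variables.
\<close>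
lemma coupling_family_exists:
  fixes \<mu> :: "real measure"
  assumes \<mu>: "prob_space \<mu>" "sets \<mu> = sets borel"
    and m1: "(LINT x|\<mu>. x) = 0" and m2: "(LINT x|\<mu>. x\<^sup>2) = 1"
    and m4: "integrable \<mu> (\<lambda>x. x ^ 4)" "(LINT x|\<mu>. x ^ 4) \<le> K" and K: "3 \<le> K" and n: "0 < n"
  shows "\<exists>\<Omega> :: (nat \<times> nat \<Rightarrow> real) measure.
    unit_indep_family \<Omega> (\<lambda>k \<omega>. \<omega> k) ({0..q} \<times> {1..n}) K \<and>
    (\<forall>i\<in>{1..n}. distr \<Omega> borel (\<lambda>\<omega>. \<omega> (0, i)) = \<mu>) \<and>
    (\<forall>m\<in>{1..q}. \<forall>i\<in>{1..n}. distr \<Omega> borel (\<lambda>\<omega>. \<omega> (m, i)) = std_normal_distribution)"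
proof -
  let ?I = "{0..q} \<times> {1..n}"
  define \<nu> where "\<nu> k = (if fst k = 0 then \<mu> else std_normal_distribution)" for k :: "nat \<times> nat"
  have \<nu>: "prob_space (\<nu> k)" "sets (\<nu> k) = sets borel" for k
    using \<mu> prob_space_normal_density[of 1 0] by (auto simp: \<nu>_def)
  have ne: "?I \<noteq> {}" and fin: "finite ?I"
    using n by auto
  note P = indep_coordinates_PiM[where \<mu> = \<nu>, OF fin ne \<nu>]
  interpret prob_space "PiM ?I \<nu>" by (rule P(1))
  have moment: "integral\<^sup>L (PiM ?I \<nu>) (\<lambda>\<omega>. \<omega> k ^ p) = (LINT x|\<nu> k. x ^ p)"
    "integrable (PiM ?I \<nu>) (\<lambda>\<omega>. \<omega> k ^ p) \<longleftrightarrow> integrable (\<nu> k) (\<lambda>x. x ^ p)" if "k \<in> ?I" for k p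
  proof -
    have rv: "(\<lambda>\<omega>. \<omega> k) \<in> borel_measurable (PiM ?I \<nu>)"
      using P(3) that unfolding indep_vars_def by blast
    show "integral\<^sup>L (PiM ?I \<nu>) (\<lambda>\<omega>. \<omega> k ^ p) = (LINT x|\<nu> k. x ^ p)"
      using integral_distr[OF rv, of "\<lambda>x. x ^ p"] P(2)[OF that] by simp
    show "integrable (PiM ?I \<nu>) (\<lambda>\<omega>. \<omega> k ^ p) \<longleftrightarrow> integrable (\<nu> k) (\<lambda>x. x ^ p)"
      using integrable_distr_eq[OF rv, of "\<lambda>x. x ^ p"] P(2)[OF that] by simp
  qed
  have "unit_indep_family (PiM ?I \<nu>) (\<lambda>k \<omega>. \<omega> k) ?I K"
  proof
    fix k assume k: "k \<in> ?I"
    show "expectation (\<lambda>\<omega>. \<omega> k) = 0" "expectation (\<lambda>\<omega>. (\<omega> k)\<^sup>2) = 1"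
      "integrable (PiM ?I \<nu>) (\<lambda>\<omega>. \<omega> k ^ 4)" "expectation (\<lambda>\<omega>. \<omega> k ^ 4) \<le> K"
      using moment[OF k, of 1] moment[OF k, of 2] moment[OF k, of 4] m1 m2 m4 K std_normal_moments
      by (auto simp: \<nu>_def)
  qed (use fin P(3) K in auto)
  then show ?thesis
    using P(2) by (intro exI[of _ "PiM ?I \<nu>"]) (auto simp: \<nu>_def)
qed

text \<open>
  Splitting each limit variable into \<open>n\<close> independent normal summands makes its coefficients as small
  as those on the other side of the comparison.
\<close>
lemma normalized_gaussian_sums:
  fixes Y :: "nat \<times> nat \<Rightarrow> 'a \<Rightarrow> real" and q n :: nat
  assumes fam: "unit_indep_family \<Omega> Y ({0..q} \<times> {1..n}) K" and n: "0 < n"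
    and normal: "\<forall>m\<in>{1..q}. \<forall>i\<in>{1..n}. distr \<Omega> borel (Y (m, i)) = std_normal_distribution"
  defines "G \<equiv> \<lambda>m \<omega>. \<Sum>i=1..n. Y (m, i) \<omega> / sqrt (real n)"
  shows "prob_space.indep_vars \<Omega> (\<lambda>_. borel) G {1..q}"
    and "m \<in> {1..q} \<Longrightarrow> distr \<Omega> borel (G m) = std_normal_distribution"
proof -
  interpret unit_indep_family \<Omega> Y "{0..q} \<times> {1..n}" K by fact
  have "indep_vars (\<lambda>m. PiM ({m} \<times> {1..n}) (\<lambda>_. borel)) (\<lambda>m \<omega>. restrict (\<lambda>k. Y k \<omega>) ({m} \<times> {1..n})) {1..q}"
    by (rule indep_vars_restrict[OF indep]) (auto simp: disjoint_family_on_def)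
  then have "indep_vars (\<lambda>_. borel) (\<lambda>m \<omega>. (\<lambda>y. \<Sum>i=1..n. y (m, i) / sqrt (real n))
      (restrict (\<lambda>k. Y k \<omega>) ({m} \<times> {1..n}))) {1..q}"
    by (rule indep_vars_compose2[where Y = "\<lambda>m y. \<Sum>i=1..n. y (m, i) / sqrt (real n)"])
       (auto intro!: borel_measurable_sum borel_measurable_divide measurable_component_singleton)
  then show "indep_vars (\<lambda>_. borel) G {1..q}"
    by (simp add: G_def)
  assume m: "m \<in> {1..q}"
  have dist: "distributed \<Omega> lborel (\<lambda>\<omega>. Y (m, i) \<omega> / sqrt (real n)) (normal_density 0 (1 / sqrt (real n)))"
    if "i \<in> {1..n}" for i
  proof -
    have "distributed \<Omega> lborel (Y (m, i)) std_normal_density"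
    proof -
      have "distr \<Omega> lborel (Y (m, i)) = distr \<Omega> borel (Y (m, i))"
        by (rule distr_cong) auto
      then show ?thesis
        using normal m that Y_measurable[of "(m, i)"] by (auto simp: distributed_def)
    qed
    then show ?thesis
      using normal_density_affine[of "Y (m, i)" 0 1 "1 / sqrt (real n)" 0] n by simp
  qed
  have ind: "indep_vars (\<lambda>_. borel) (\<lambda>i \<omega>. Y (m, i) \<omega> / sqrt (real n)) {1..n}"
  proof (rule indep_vars_compose2[where Y = "\<lambda>i x. x / sqrt (real n)" and M' = "\<lambda>_. borel"])
    show "indep_vars (\<lambda>_. borel) (\<lambda>i. Y (m, i)) {1..n}"
      by (rule indep_vars_reindex_inj[OF indep]) (use m in \<open>auto simp: inj_on_def\<close>)
  qed auto
  have "distributed \<Omega> lborel (G m) (normal_density (\<Sum>i=1..n. 0) (sqrt (\<Sum>i=1..n. (1 / sqrt (real n))\<^sup>2)))"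
    unfolding G_def by (rule sum_indep_normal) (use n ind dist in auto)
  then have "distributed \<Omega> lborel (G m) std_normal_density"
    using n by (simp add: power_divide)
  then have "distr \<Omega> lborel (G m) = std_normal_distribution"
    by (simp add: distributed_def)
  moreover have "distr \<Omega> lborel (G m) = distr \<Omega> borel (G m)"
    by (rule distr_cong) auto
  ultimately show "distr \<Omega> borel (G m) = std_normal_distribution"
    by simp
qed

definition comparison_error ::
    "real \<Rightarrow> nat \<Rightarrow> nat \<Rightarrow> real \<Rightarrow> real \<Rightarrow> real \<Rightarrow> real \<Rightarrow> real" where
  "comparison_error K N q \<rho> \<beta> B d = \<bar>\<rho> - 1\<bar> * (2 * real q * B)
    + 2 * (real q * \<beta>\<^sup>2 * sqrt (K * real N)) + 2 * path_bound K N q 1 \<beta> B d"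

text \<open>
  Half the velocity of the covariance along the path is \<open>sin t * cos t\<close> times the difference between
  the Gram matrix and the identity, hence at most \<open>d\<close>. The factor \<open>\<rho>\<close> accounts for the
  normalization of the coefficients.
\<close>
lemma path_endpoints_comparison:
  fixes \<Omega> :: "'a measure" and Y :: "nat \<times> nat \<Rightarrow> 'a \<Rightarrow> real" and q n :: nat
  defines "I \<equiv> {0..q} \<times> {1..n}"
  assumes fam: "unit_indep_family \<Omega> Y I K" and n: "0 < n"
    and test: "smooth_test A h h1 h2" and H: "\<And>x. \<bar>h x\<bar> \<le> H"
    and w: "\<And>m. m \<in> {1..q} \<Longrightarrow> \<bar>w m\<bar> \<le> 1"
    and c: "\<And>i m. i \<in> {1..n} \<Longrightarrow> m \<in> {1..q} \<Longrightarrow> \<bar>c i m\<bar> \<le> \<beta>" and \<beta>: "1 / sqrt (real n) \<le> \<beta>"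
    and B: "real (card I) * \<beta>\<^sup>2 \<le> B" and d: "0 \<le> d"
    and gram: "\<And>m l. m \<in> {1..q} \<Longrightarrow> l \<in> {1..q} \<Longrightarrow>
       \<bar>(\<Sum>i=1..n. c i m * c i l) - (if m = l then 1 else 0)\<bar> \<le> d"
  shows "\<bar>(\<integral>\<omega>. h (\<rho> * centered_form I q w (path_coeff n c (pi / 2)) (\<lambda>k. Y k \<omega>)) \<partial>\<Omega>)
      - (\<integral>\<omega>. h (centered_form I q w (path_coeff n c 0) (\<lambda>k. Y k \<omega>)) \<partial>\<Omega>)\<bar>
    \<le> A * comparison_error K (card I) q \<rho> \<beta> B d"
proof -
  interpret unit_indep_family \<Omega> Y I K by fact
  interpret smooth_test A h h1 h2 by (fact test)
  let ?b = "path_coeff n c"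
  let ?C = "\<lambda>t \<omega>. centered_form I q w (?b t) (\<lambda>k. Y k \<omega>)"
  let ?Q = "\<lambda>t \<omega>. offdiag_form I q w (?b t) (\<lambda>k. Y k \<omega>)"
  have \<beta>0: "0 \<le> \<beta>"
    using \<beta> order_trans[of 0 "1 / sqrt (real n)" \<beta>] by simp
  have b: "\<bar>?b t k m\<bar> \<le> \<beta>" if "k \<in> I" "m \<in> {1..q}" for t k m
    using abs_path_coeff_le[where c = c and m = m, OF c \<beta>] that I_def by blast
  have bB: "(\<Sum>k\<in>I. (?b t k m)\<^sup>2) \<le> B" if "m \<in> {1..q}" for t m
  proof -
    have "(\<Sum>k\<in>I. (?b t k m)\<^sup>2) \<le> (\<Sum>k\<in>I. \<beta>\<^sup>2)"
      using power_mono[OF b[OF _ that], of _ t 2] by (intro sum_mono) auto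
    then show ?thesis
      using B by simp
  qed
  have cov: "\<bar>\<Sum>k\<in>I. ?b t k m * ?b (t + pi / 2) k l\<bar> \<le> d" if "m \<in> {1..q}" "l \<in> {1..q}" for t m l
  proof -
    have "(\<Sum>k\<in>I. ?b t k m * ?b (t + pi / 2) k l) =
        (sin t * cos t) * ((\<Sum>i=1..n. c i m * c i l) - (if m = l then 1 else 0))"
      unfolding I_def gram_path_coeff[OF n that] by (simp add: sin_add cos_add algebra_simps)
    also have "\<bar>\<dots>\<bar> \<le> (1 * 1) * d"
      unfolding abs_mult using gram[OF that] by (intro mult_mono) auto
    finally show ?thesis
      by simp
  qed
  have path: "\<bar>expectation (\<lambda>\<omega>. h (?Q (pi / 2) \<omega>)) - expectation (\<lambda>\<omega>. h (?Q 0 \<omega>))\<bar>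
      \<le> A * path_bound K (card I) q 1 \<beta> B d * \<bar>pi / 2 - 0\<bar>"
    by (rule smart_path_comparison[where b' = "\<lambda>t. ?b (t + pi / 2)", OF test _ \<beta>0 H w DERIV_path_coeff b b B d cov])
       auto
  have "0 \<le> path_bound K (card I) q 1 \<beta> B d"
    using K_ge \<beta>0 d form_bound_ge[of q B] unfolding path_bound_def taylor_bound_def
    by (intro mult_nonneg_nonneg add_nonneg_nonneg) auto
  \<comment> \<open>The length of the path is \<open>pi / 2\<close>, rounded up to 2.\<close>
  then have "A * path_bound K (card I) q 1 \<beta> B d * \<bar>pi / 2 - 0\<bar> \<le> A * path_bound K (card I) q 1 \<beta> B d * 2"
    using A_nonneg pi_less_4 by (intro mult_left_mono mult_nonneg_nonneg) auto
  then have path': "\<bar>expectation (\<lambda>\<omega>. h (?Q (pi / 2) \<omega>)) - expectation (\<lambda>\<omega>. h (?Q 0 \<omega>))\<bar>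
      \<le> A * (2 * path_bound K (card I) q 1 \<beta> B d)"
    using path by simp
  have diag: "\<bar>expectation (\<lambda>\<omega>. h (?C t \<omega>)) - expectation (\<lambda>\<omega>. h (?Q t \<omega>))\<bar>
      \<le> A * (real q * \<beta>\<^sup>2 * sqrt (K * real (card I)))" for t
    using smooth_test_offdiag_centered_le[where lam = w and b = "?b t" and q = q and \<Lambda> = 1, OF test H w _ b]
    by simp
  have scale: "\<bar>expectation (\<lambda>\<omega>. h (\<rho> * ?C (pi / 2) \<omega>)) - expectation (\<lambda>\<omega>. h (?C (pi / 2) \<omega>))\<bar>
      \<le> A * (\<bar>\<rho> - 1\<bar> * (2 * real q * B))"
    using smooth_test_rescale_le[where lam = w and b = "?b (pi / 2)" and q = q and \<Lambda> = 1, OF test H w _ bB]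
    by simp
  have "\<bar>expectation (\<lambda>\<omega>. h (\<rho> * ?C (pi / 2) \<omega>)) - expectation (\<lambda>\<omega>. h (?C 0 \<omega>))\<bar>
      \<le> A * (\<bar>\<rho> - 1\<bar> * (2 * real q * B)) + A * (real q * \<beta>\<^sup>2 * sqrt (K * real (card I)))
        + A * (2 * path_bound K (card I) q 1 \<beta> B d) + A * (real q * \<beta>\<^sup>2 * sqrt (K * real (card I)))"
    using scale diag[of "pi / 2"] path' diag[of 0] by linarith
  also have "\<dots> = A * comparison_error K (card I) q \<rho> \<beta> B d"
    by (simp add: comparison_error_def algebra_simps)
  finally show ?thesis .
qed

theorem quadratic_form_gaussian_comparison:
  fixes X :: "nat \<Rightarrow> 'a \<Rightarrow> real" and Z :: "nat \<Rightarrow> 'b \<Rightarrow> real"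
  assumes fam: "unit_indep_family M X {1..n} K" and n: "0 < n" and q: "0 < q"
    and same: "\<And>i. i \<in> {1..n} \<Longrightarrow> distr M borel (X i) = \<mu>"
    and N: "prob_space N" "prob_space.indep_vars N (\<lambda>_. borel) Z {1..q}"
    and normal: "\<And>m. m \<in> {1..q} \<Longrightarrow> distr N borel (Z m) = std_normal_distribution"
    and test: "smooth_test A h h1 h2" and H: "\<And>x. \<bar>h x\<bar> \<le> H"
    and w: "\<And>m. m \<in> {1..q} \<Longrightarrow> \<bar>w m\<bar> \<le> 1"
    and c: "\<And>i m. i \<in> {1..n} \<Longrightarrow> m \<in> {1..q} \<Longrightarrow> \<bar>c i m\<bar> \<le> \<beta>" and \<beta>: "1 / sqrt (real n) \<le> \<beta>"
    and B: "real ((q + 1) * n) * \<beta>\<^sup>2 \<le> B" and d: "0 \<le> d"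
    and gram: "\<And>m l. m \<in> {1..q} \<Longrightarrow> l \<in> {1..q} \<Longrightarrow>
       \<bar>(\<Sum>i=1..n. c i m * c i l) - (if m = l then 1 else 0)\<bar> \<le> d"
  shows "\<bar>(\<integral>\<omega>. h (\<rho> * (\<Sum>m=1..q. w m * ((\<Sum>i=1..n. c i m * X i \<omega>)\<^sup>2 - (\<Sum>i=1..n. (c i m)\<^sup>2)))) \<partial>M)
      - (\<integral>\<omega>. h (\<Sum>m=1..q. w m * ((Z m \<omega>)\<^sup>2 - 1)) \<partial>N)\<bar>
    \<le> A * comparison_error K ((q + 1) * n) q \<rho> \<beta> B d"
proof -
  interpret X: unit_indep_family M X "{1..n}" K by fact
  interpret smooth_test A h h1 h2 by (fact test)
  have one: "1 \<in> {1..n}"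
    using n by auto
  have rv: "X 1 \<in> borel_measurable M"
    by (rule X.Y_measurable[OF one])
  have \<mu>: "\<mu> = distr M borel (X 1)"
    using same[OF one] by simp
  have law: "prob_space \<mu>" "sets \<mu> = sets borel" "(LINT x|\<mu>. x) = 0" "(LINT x|\<mu>. x\<^sup>2) = 1"
    "integrable \<mu> (\<lambda>x. x ^ 4)" "(LINT x|\<mu>. x ^ 4) \<le> K"
    unfolding \<mu> using rv X.prob_space_distr[OF rv] X.mean_zero[OF one] X.unit_variance[OF one]
      X.fourth_le[OF one] X.integrable_fourth[OF one]
    by (simp_all add: integral_distr integrable_distr_eq)
  obtain \<Omega> :: "(nat \<times> nat \<Rightarrow> real) measure"
    where \<Omega>: "unit_indep_family \<Omega> (\<lambda>k \<omega>. \<omega> k) ({0..q} \<times> {1..n}) K"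
      and \<Omega>0: "\<forall>i\<in>{1..n}. distr \<Omega> borel (\<lambda>\<omega>. \<omega> (0, i)) = \<mu>"
      and \<Omega>1: "\<forall>m\<in>{1..q}. \<forall>i\<in>{1..n}. distr \<Omega> borel (\<lambda>\<omega>. \<omega> (m, i)) = std_normal_distribution"
    using coupling_family_exists[OF law X.K_ge n, of q] by blast
  interpret \<Omega>: unit_indep_family \<Omega> "\<lambda>k \<omega>. \<omega> k" "{0..q} \<times> {1..n}" K by fact
  let ?F = "\<lambda>x :: nat \<Rightarrow> real. h (\<rho> * (\<Sum>m=1..q. w m * ((\<Sum>i=1..n. c i m * x i)\<^sup>2 - (\<Sum>i=1..n. (c i m)\<^sup>2))))"
  let ?G = "\<lambda>z :: nat \<Rightarrow> real. h (\<Sum>m=1..q. w m * ((z m)\<^sup>2 - 1))"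
  have left: "(\<integral>\<omega>. ?F (\<lambda>i. X i \<omega>) \<partial>M) = (\<integral>\<omega>. ?F (\<lambda>i. \<omega> (0, i)) \<partial>\<Omega>)"
  proof (rule expectation_eq_of_same_marginals[where I = "{1..n}" and X = X and Y = "\<lambda>i \<omega>. \<omega> (0, i)" and F = ?F])
    show "\<Omega>.indep_vars (\<lambda>_. borel) (\<lambda>i \<omega>. \<omega> (0, i)) {1..n}"
      by (rule \<Omega>.indep_vars_reindex_inj[OF \<Omega>.indep]) (auto simp: inj_on_def)
    show "distr M borel (X i) = distr \<Omega> borel (\<lambda>\<omega>. \<omega> (0, i))" if "i \<in> {1..n}" for i
      using same[OF that] \<Omega>0 that by simp
    show "?F \<in> borel_measurable (PiM {1..n} (\<lambda>_. borel))"
      by (intro measurable_compose[OF _ measurable_h(1)] borel_measurable_times borel_measurable_sum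
          borel_measurable_diff borel_measurable_power measurable_component_singleton borel_measurable_const) auto
    have "(\<Sum>i=1..n. c i m * restrict y {1..n} i) = (\<Sum>i=1..n. c i m * y i)" for m y
      by (intro sum.cong) auto
    then show "?F (restrict y {1..n}) = ?F y" for y
      by (simp only:)
  qed (use n X.prob_space_axioms \<Omega>.prob_space_axioms X.indep in auto)
  note G = normalized_gaussian_sums[OF \<Omega> n \<Omega>1]
  have right: "(\<integral>\<omega>. ?G (\<lambda>m. Z m \<omega>) \<partial>N) = (\<integral>\<omega>. ?G (\<lambda>m. \<Sum>i=1..n. \<omega> (m, i) / sqrt (real n)) \<partial>\<Omega>)"
  proof (rule expectation_eq_of_same_marginals[where I = "{1..q}" and X = Z and F = ?G
        and Y = "\<lambda>m \<omega>. \<Sum>i=1..n. \<omega> (m, i) / sqrt (real n)"])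
    show "\<Omega>.indep_vars (\<lambda>_. borel) (\<lambda>m \<omega>. \<Sum>i=1..n. \<omega> (m, i) / sqrt (real n)) {1..q}"
      by (rule G(1))
    show "distr N borel (Z m) = distr \<Omega> borel (\<lambda>\<omega>. \<Sum>i=1..n. \<omega> (m, i) / sqrt (real n))" if "m \<in> {1..q}" for m
      using normal[OF that] G(2)[OF that] by simp
    show "?G \<in> borel_measurable (PiM {1..q} (\<lambda>_. borel))"
      by (intro measurable_compose[OF _ measurable_h(1)] borel_measurable_times borel_measurable_sum
          borel_measurable_diff borel_measurable_power measurable_component_singleton borel_measurable_const) auto
    show "?G (restrict y {1..q}) = ?G y" for y
      by (intro arg_cong[where f = h] sum.cong) auto
  qed (use q N \<Omega>.prob_space_axioms in auto)
  have card: "card ({0..q} \<times> {1..n}) = (q + 1) * n"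
    by simp
  show ?thesis
    using path_endpoints_comparison[where \<rho> = \<rho> and c = c and w = w and d = d and h = h,
        OF \<Omega> n test H w c \<beta> B[folded card] d gram]
    unfolding left right card centered_form_path_end[OF n] centered_form_path_start[OF n] .
qed

section \<open>Riemann sums of Hoelder continuous functions\<close>

lemma holder_imp_continuous_on:
  fixes f :: "real \<Rightarrow> real"
  assumes "0 < \<alpha>" and holder: "holder_continuous_on \<alpha> S f"
  shows "continuous_on S f"
  unfolding continuous_on_def
proof
  fix x assume x: "x \<in> S"
  obtain C where C: "\<And>x y. x \<in> S \<Longrightarrow> y \<in> S \<Longrightarrow> \<bar>f x - f y\<bar> \<le> C * \<bar>x - y\<bar> powr \<alpha>"
    using holder unfolding holder_continuous_on_def by blast
  have "((\<lambda>y. C * \<bar>y - x\<bar> powr \<alpha>) \<longlongrightarrow> C * \<bar>x - x\<bar> powr \<alpha>) (at x within S)"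
    using \<open>0 < \<alpha>\<close> by (intro tendsto_intros tendsto_powr') auto
  then have "((\<lambda>y. C * \<bar>y - x\<bar> powr \<alpha>) \<longlongrightarrow> 0) (at x within S)"
    by simp
  then have "((\<lambda>y. f y - f x) \<longlongrightarrow> 0) (at x within S)"
    by (rule Lim_null_comparison[rotated])
       (use C x in \<open>auto simp: eventually_at_filter intro!: always_eventually\<close>)
  then show "(f \<longlongrightarrow> f x) (at x within S)"
    using LIM_zero_iff by blast
qed

lemma holder_mono:
  assumes "holder_continuous_on \<alpha> {0..1} f" and "0 < \<alpha>'" "\<alpha>' \<le> \<alpha>"
  shows "holder_continuous_on \<alpha>' {0..1} f"
proof -
  obtain C where C: "\<And>x y. x \<in> {0..1} \<Longrightarrow> y \<in> {0..1} \<Longrightarrow> \<bar>f x - f y\<bar> \<le> C * \<bar>x - y\<bar> powr \<alpha>"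
    using assms(1) unfolding holder_continuous_on_def by blast
  have "\<bar>f x - f y\<bar> \<le> \<bar>C\<bar> * \<bar>x - y\<bar> powr \<alpha>'" if "x \<in> {0..1}" "y \<in> {0..1}" for x y
  proof -
    have "\<bar>x - y\<bar> powr \<alpha> \<le> \<bar>x - y\<bar> powr \<alpha>'"
      using that assms(3) by (intro powr_mono') auto
    then have "C * \<bar>x - y\<bar> powr \<alpha> \<le> \<bar>C\<bar> * \<bar>x - y\<bar> powr \<alpha>'"
      by (intro mult_mono) auto
    then show ?thesis
      using C[OF that] by linarith
  qed
  then show ?thesis
    unfolding holder_continuous_on_def by blast
qed

lemma holder_mult:
  assumes \<alpha>: "0 < \<alpha>" and f: "holder_continuous_on \<alpha> {0..1} f" and g: "holder_continuous_on \<alpha> {0..1} g"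
  shows "holder_continuous_on \<alpha> {0..1} (\<lambda>x. f x * g x)"
proof -
  obtain C where C: "\<And>x y. x \<in> {0..1} \<Longrightarrow> y \<in> {0..1} \<Longrightarrow> \<bar>f x - f y\<bar> \<le> C * \<bar>x - y\<bar> powr \<alpha>"
    using f unfolding holder_continuous_on_def by blast
  obtain D where D: "\<And>x y. x \<in> {0..1} \<Longrightarrow> y \<in> {0..1} \<Longrightarrow> \<bar>g x - g y\<bar> \<le> D * \<bar>x - y\<bar> powr \<alpha>"
    using g unfolding holder_continuous_on_def by blast
  have "bounded (f ` {0..1})" "bounded (g ` {0..1})"
    using holder_imp_continuous_on[OF \<alpha>] f g
    by (auto intro!: compact_imp_bounded compact_continuous_image)
  then obtain a b where "\<forall>x\<in>{0..1}. \<bar>f x\<bar> \<le> a" "\<forall>x\<in>{0..1}. \<bar>g x\<bar> \<le> b"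
    unfolding bounded_iff by auto
  then have a: "\<And>x. x \<in> {0..1} \<Longrightarrow> \<bar>f x\<bar> \<le> a" and b: "\<And>x. x \<in> {0..1} \<Longrightarrow> \<bar>g x\<bar> \<le> b"
    by blast+
  have "\<bar>f x * g x - f y * g y\<bar> \<le> (a * D + b * C) * \<bar>x - y\<bar> powr \<alpha>" if xy: "x \<in> {0..1}" "y \<in> {0..1}" for x y
  proof -
    have "f x * g x - f y * g y = f x * (g x - g y) + g y * (f x - f y)"
      by (simp add: algebra_simps)
    also have "\<bar>\<dots>\<bar> \<le> \<bar>f x\<bar> * \<bar>g x - g y\<bar> + \<bar>g y\<bar> * \<bar>f x - f y\<bar>"
      using abs_triangle_ineq by (simp flip: abs_mult)
    also have "\<dots> \<le> a * (D * \<bar>x - y\<bar> powr \<alpha>) + b * (C * \<bar>x - y\<bar> powr \<alpha>)"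
      using a[OF xy(1)] b[OF xy(2)] C[OF xy] D[OF xy] by (intro add_mono mult_mono) auto
    finally show ?thesis
      by (simp add: algebra_simps)
  qed
  then show ?thesis
    unfolding holder_continuous_on_def by blast
qed

text \<open>
  On a cell of length \<open>1 / n\<close> the function differs from its value at the right end point by at most
  \<open>C * n powr - \<alpha>\<close>.
\<close>
lemma riemann_sum_holder_error:
  fixes f :: "real \<Rightarrow> real"
  assumes \<alpha>: "0 < \<alpha>" and n: "0 < n" and C: "0 \<le> C"
    and holder: "\<And>x y. x \<in> {0..1} \<Longrightarrow> y \<in> {0..1} \<Longrightarrow> \<bar>f x - f y\<bar> \<le> C * \<bar>x - y\<bar> powr \<alpha>"
  shows "\<bar>(\<Sum>i=1..n. f (real i / real n)) / real n - integral {0..1} f\<bar> \<le> C * real n powr - \<alpha>"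
proof -
  let ?R = "\<lambda>k. (\<Sum>i=1..k. f (real i / real n)) / real n"
  have cont: "continuous_on {0..1} f"
    by (rule holder_imp_continuous_on[OF \<alpha>]) (unfold holder_continuous_on_def, use holder in blast)
  have "\<bar>?R k - integral {0..real k / real n} f\<bar>
      \<le> real k / real n * (C * real n powr - \<alpha>)" if "k \<le> n" for k
    using that
  proof (induction k)
    case 0
    then show ?case by simp
  next
    case (Suc k)
    let ?a = "real k / real n" and ?b = "real (Suc k) / real n"
    have ab: "0 \<le> ?a" "?a \<le> ?b" "?b \<le> 1" "?b - ?a = 1 / real n"
      using n Suc.prems by (auto simp: field_simps)
    have "{0..?b} \<subseteq> {0..1}" "{?a..?b} \<subseteq> {0..1}"
      using ab(1,3) by (auto simp del: of_nat_Suc)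
    then have int: "f integrable_on {0..?b}" "f integrable_on {?a..?b}" and contab: "continuous_on {?a..?b} f"
      by (blast intro: integrable_continuous_real continuous_on_subset[OF cont])+
    have "integral {0..?a} f + integral {?a..?b} f = integral {0..?b} f"
      using ab int by (intro Henstock_Kurzweil_Integration.integral_combine) auto
    moreover have "\<bar>f ?b / real n - integral {?a..?b} f\<bar> \<le> C * real n powr - \<alpha> * (1 / real n)"
    proof -
      have "integral {?a..?b} (\<lambda>x. f x - f ?b) = integral {?a..?b} f - integral {?a..?b} (\<lambda>x. f ?b)"
        using int by (intro Henstock_Kurzweil_Integration.integral_diff) auto
      also have "integral {?a..?b} (\<lambda>x. f ?b) = f ?b / real n"
        using ab by simp
      finally have "\<bar>f ?b / real n - integral {?a..?b} f\<bar> = norm (integral {?a..?b} (\<lambda>x. f x - f ?b))"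
        by simp
      also have "\<dots> \<le> C * real n powr - \<alpha> * (?b - ?a)"
      proof (rule integral_bound[OF ab(2)])
        show "continuous_on {?a..?b} (\<lambda>x. f x - f ?b)"
          using contab by (intro continuous_intros)
        fix x assume x: "x \<in> {?a..?b}"
        have "\<bar>x - ?b\<bar> \<le> 1 / real n"
          using x ab by auto
        then have "\<bar>x - ?b\<bar> powr \<alpha> \<le> (1 / real n) powr \<alpha>"
          using \<alpha> by (intro powr_mono2) auto
        also have "\<dots> = real n powr - \<alpha>"
          using n by (simp add: powr_divide powr_minus_divide)
        finally have "C * \<bar>x - ?b\<bar> powr \<alpha> \<le> C * real n powr - \<alpha>"
          using C by (intro mult_left_mono) auto
        moreover have "x \<in> {0..1}"
          using x \<open>{?a..?b} \<subseteq> {0..1}\<close> by blast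
        moreover have "?b \<in> {0..1}"
          using ab(1-3) by auto
        ultimately show "norm (f x - f ?b) \<le> C * real n powr - \<alpha>"
          using holder[of x ?b] by simp
      qed
      finally show ?thesis
        unfolding ab(4) .
    qed
    moreover have "\<bar>?R k - integral {0..?a} f\<bar>
        \<le> ?a * (C * real n powr - \<alpha>)"
      using Suc by simp
    moreover have "?R (Suc k)
        = ?R k + f ?b / real n"
      by (simp add: add_divide_distrib)
    moreover have "?b * (C * real n powr - \<alpha>) = ?a * (C * real n powr - \<alpha>) + C * real n powr - \<alpha> * (1 / real n)"
      using n by (simp add: field_simps)
    ultimately show ?case
      by linarith
  qed
  from this[of n] show ?thesis
    using n by simp
qed

lemma integral_Icc_eq_lebesgue_Ioo:
  fixes f :: "real \<Rightarrow> real"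
  assumes "continuous_on {0..1} f"
  shows "(LINT x|lebesgue_on {0<..<1}. f x) = integral {0..1} f"
proof -
  have "integrable (lebesgue_on {0..1}) f"
    using assms by (rule continuous_imp_integrable_real)
  then have "set_integrable lebesgue {0..1} f"
    by (simp add: integrable_restrict_space set_integrable_def)
  then have "set_integrable lebesgue {0<..<1} f"
    by (rule set_integrable_subset) auto
  then have "integrable (lebesgue_on {0<..<1}) f"
    by (simp add: integrable_restrict_space set_integrable_def)
  then show ?thesis
    using lebesgue_integral_eq_integral[of "{0<..<1}" f] integral_open_interval_real[of 0 1 f] by simp
qed

text \<open>
  The products \<open>e m * e l\<close> are again Hoelder continuous of order \<open>\<alpha>\<close>, and their integrals are
  given by orthonormality; the index set is finite, so one constant serves all pairs.
\<close>
lemma gram_matrix_riemann_error: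
  fixes e :: "nat \<Rightarrow> real \<Rightarrow> real"
  assumes \<alpha>: "0 < \<alpha>" and on: "orthonormal_L2 {0<..<1} {1..q} e"
    and holder: "\<forall>m\<in>{1..q}. holder_continuous_on \<alpha> {0..1} (e m)"
  shows "\<exists>D>0. \<forall>n>0. \<forall>m\<in>{1..q}. \<forall>l\<in>{1..q}.
     \<bar>(\<Sum>i=1..n. e m (real i / real n) * e l (real i / real n)) / real n - (if m = l then 1 else 0)\<bar>
       \<le> D * real n powr - \<alpha>"
proof -
  have "\<exists>C. \<forall>x\<in>{0..1}. \<forall>y\<in>{0..1}. \<bar>e m x * e l x - e m y * e l y\<bar> \<le> C * \<bar>x - y\<bar> powr \<alpha>"
    if "m \<in> {1..q}" "l \<in> {1..q}" for m l
    using holder_mult[OF \<alpha>, of "e m" "e l"] holder that unfolding holder_continuous_on_def by auto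
  then obtain C where C: "\<And>m l x y. m \<in> {1..q} \<Longrightarrow> l \<in> {1..q} \<Longrightarrow> x \<in> {0..1} \<Longrightarrow> y \<in> {0..1} \<Longrightarrow>
      \<bar>e m x * e l x - e m y * e l y\<bar> \<le> C m l * \<bar>x - y\<bar> powr \<alpha>"
    by metis
  define D where "D = 1 + (\<Sum>m=1..q. \<Sum>l=1..q. \<bar>C m l\<bar>)"
  have CD: "C m l \<le> D" if "m \<in> {1..q}" "l \<in> {1..q}" for m l
  proof -
    have "\<bar>C m l\<bar> \<le> (\<Sum>l=1..q. \<bar>C m l\<bar>)"
      by (rule member_le_sum[OF that(2)]) auto
    also have "\<dots> \<le> (\<Sum>m=1..q. \<Sum>l=1..q. \<bar>C m l\<bar>)"
      by (rule member_le_sum[OF that(1)]) (auto intro!: sum_nonneg)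
    finally show ?thesis
      unfolding D_def by linarith
  qed
  have D: "0 < D"
    unfolding D_def by (intro add_pos_nonneg sum_nonneg) auto
  show ?thesis
  proof (intro exI conjI allI impI ballI)
    fix n m l :: nat assume n: "0 < n" and ml: "m \<in> {1..q}" "l \<in> {1..q}"
    let ?R = "(\<Sum>i=1..n. e m (real i / real n) * e l (real i / real n)) / real n"
    have cont: "continuous_on {0..1} (\<lambda>x. e m x * e l x)"
      using holder_imp_continuous_on[OF \<alpha>] holder ml by (intro continuous_intros) auto
    have "(LINT x|lebesgue_on {0<..<1}. e m x * e l x) = (if m = l then 1 else 0)"
      using on ml by (auto simp: orthonormal_L2_def)
    then have "integral {0..1} (\<lambda>x. e m x * e l x) = (if m = l then 1 else 0)"
      using integral_Icc_eq_lebesgue_Ioo[OF cont] by simp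
    moreover have "\<bar>?R
        - integral {0..1} (\<lambda>x. e m x * e l x)\<bar> \<le> D * real n powr - \<alpha>"
    proof (rule riemann_sum_holder_error[OF \<alpha> n])
      fix x y :: real assume "x \<in> {0..1}" "y \<in> {0..1}"
      then have "\<bar>e m x * e l x - e m y * e l y\<bar> \<le> C m l * \<bar>x - y\<bar> powr \<alpha>"
        by (intro C ml)
      also have "\<dots> \<le> D * \<bar>x - y\<bar> powr \<alpha>"
        using CD[OF ml] by (intro mult_right_mono) auto
      finally show "\<bar>e m x * e l x - e m y * e l y\<bar> \<le> D * \<bar>x - y\<bar> powr \<alpha>" .
    qed (use D in auto)
    ultimately show "\<bar>?R
        - (if m = l then 1 else 0)\<bar> \<le> D * real n powr - \<alpha>"
      by simp
  qed (rule D)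
qed

lemma holder_family_bounded:
  assumes \<alpha>: "0 < \<alpha>" and holder: "\<forall>m\<in>{1..q :: nat}. holder_continuous_on \<alpha> {0..1} (e m)"
  shows "\<exists>E>0. \<forall>m\<in>{1..q}. \<forall>x\<in>{0..1}. \<bar>e m x\<bar> \<le> E"
proof -
  have "bounded (\<Union>m\<in>{1..q}. e m ` {0..1})"
    using holder_imp_continuous_on[OF \<alpha>] holder
    by (intro bounded_UN ballI compact_imp_bounded compact_continuous_image) auto
  then obtain b where "0 < b" "\<forall>y\<in>(\<Union>m\<in>{1..q}. e m ` {0..1}). norm y \<le> b"
    unfolding bounded_pos by blast
  then show ?thesis
    by (intro exI[of _ b]) auto
qed

section \<open>Anticoncentration of weighted chi-square sums\<close>

lemma emeasure_annulus_le:
  fixes a \<epsilon> :: real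
  assumes \<epsilon>: "0 \<le> \<epsilon>"
  shows "emeasure lborel {p :: real \<times> real. (fst p)\<^sup>2 + (snd p)\<^sup>2 \<in> {a..a + \<epsilon>}}
    \<le> ennreal (pi * \<epsilon>)" (is "emeasure lborel ?S \<le> _")
proof -
  have norm_sq: "(fst p)\<^sup>2 + (snd p)\<^sup>2 = (norm p)\<^sup>2" for p :: "real \<times> real"
    by (simp add: norm_prod_def)
  have vol: "unit_ball_vol 2 = pi"
    by (simp add: unit_ball_vol_numeral)
  show ?thesis
  proof (cases "a \<le> 0")
    case True
    show ?thesis
    proof (cases "a + \<epsilon> < 0")
      case True
      have "\<not> (fst p)\<^sup>2 + (snd p)\<^sup>2 \<le> a + \<epsilon>" for p :: "real \<times> real"
        using True sum_power2_ge_zero[of "fst p" "snd p"] by linarith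
      then have "?S = {}"
        by auto
      then show ?thesis
        by (simp only: emeasure_empty zero_le)
    next
      case False
      have "?S \<subseteq> cball 0 (sqrt (a + \<epsilon>))"
        unfolding norm_sq by (auto simp: real_le_rsqrt)
      then have "emeasure lborel ?S \<le> emeasure lborel (cball (0 :: real \<times> real) (sqrt (a + \<epsilon>)))"
        by (intro emeasure_mono) auto
      also have "\<dots> = ennreal (pi * (a + \<epsilon>))"
        using False by (simp add: emeasure_cball vol)
      also have "\<dots> \<le> ennreal (pi * \<epsilon>)"
        using True by (intro ennreal_leI mult_left_mono) auto
      finally show ?thesis .
    qed
  next
    case False
    have "sqrt a \<le> norm p" if "a \<le> (norm p)\<^sup>2" for p :: "real \<times> real"
      using that by (intro real_le_lsqrt) auto
    then have "?S \<subseteq> cball 0 (sqrt (a + \<epsilon>)) - ball 0 (sqrt a)"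
      unfolding norm_sq by (fastforce simp: real_le_rsqrt)
    then have "emeasure lborel ?S \<le> emeasure lborel (cball (0 :: real \<times> real) (sqrt (a + \<epsilon>)) - ball 0 (sqrt a))"
      by (intro emeasure_mono) auto
    also have "\<dots> = emeasure lborel (cball (0 :: real \<times> real) (sqrt (a + \<epsilon>))) - emeasure lborel (ball (0 :: real \<times> real) (sqrt a))"
    proof (rule emeasure_Diff)
      have "sqrt a \<le> sqrt (a + \<epsilon>)"
        using \<epsilon> by simp
      then show "ball (0 :: real \<times> real) (sqrt a) \<subseteq> cball 0 (sqrt (a + \<epsilon>))"
        using subset_ball[of "sqrt a" "sqrt (a + \<epsilon>)" "0 :: real \<times> real"] ball_subset_cball by blast
    qed (use False in \<open>auto simp: emeasure_ball\<close>)
    also have "\<dots> = ennreal (pi * (a + \<epsilon>)) - ennreal (pi * a)"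
      using False \<epsilon> by (simp add: emeasure_cball emeasure_ball vol)
    also have "\<dots> = ennreal (pi * \<epsilon>)"
      using False \<epsilon> by (simp add: ennreal_minus algebra_simps)
    finally show ?thesis .
  qed
qed

lemma normal_density_le: "0 < \<sigma> \<Longrightarrow> normal_density \<mu> \<sigma> x \<le> 1 / (sqrt (2 * pi) * \<sigma>)"
  unfolding normal_density_def by (simp add: real_sqrt_mult field_simps)

context prob_space
begin

text \<open>
  The joint density is bounded and the annulus has area at most \<open>pi * \<epsilon>\<close>, wherever it lies.
\<close>
lemma prob_sum_squares_normal_interval_le:
  assumes \<sigma>: "0 < \<sigma>1" "0 < \<sigma>2" and \<epsilon>: "0 \<le> \<epsilon>"
    and X: "distributed M lborel X (normal_density 0 \<sigma>1)"
    and Y: "distributed M lborel Y (normal_density 0 \<sigma>2)"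
    and ind: "indep_var lborel X lborel Y"
  shows "prob {\<omega> \<in> space M. (X \<omega>)\<^sup>2 + (Y \<omega>)\<^sup>2 \<in> {a..a + \<epsilon>}} \<le> \<epsilon> / (2 * \<sigma>1 * \<sigma>2)"
proof -
  let ?S = "{p :: real \<times> real. (fst p)\<^sup>2 + (snd p)\<^sup>2 \<in> {a..a + \<epsilon>}}"
  let ?c = "1 / (2 * pi * \<sigma>1 * \<sigma>2)"
  let ?f = "\<lambda>(x, y). ennreal (normal_density 0 \<sigma>1 x) * ennreal (normal_density 0 \<sigma>2 y)"
  have joint: "distributed M (lborel \<Otimes>\<^sub>M lborel) (\<lambda>\<omega>. (X \<omega>, Y \<omega>)) ?f"
    by (rule distributed_joint_indep[OF _ _ X Y ind]) (auto intro: lborel.sigma_finite_measure_axioms)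
  have "Measurable.pred (borel \<Otimes>\<^sub>M borel)
      (\<lambda>p :: real \<times> real. (fst p)\<^sup>2 + (snd p)\<^sup>2 \<in> {a..a + \<epsilon>})"
    by measurable
  then have S': "?S \<in> sets (borel \<Otimes>\<^sub>M borel)"
    by (simp add: pred_def space_pair_measure)
  then have S: "?S \<in> sets borel"
    unfolding borel_prod .
  have dens: "?f p \<le> ennreal ?c" for p
  proof -
    have "normal_density 0 \<sigma>1 (fst p) * normal_density 0 \<sigma>2 (snd p)
        \<le> 1 / (sqrt (2 * pi) * \<sigma>1) * (1 / (sqrt (2 * pi) * \<sigma>2))"
      using \<sigma> by (intro mult_mono normal_density_le) (auto simp: normal_density_nonneg)
    also have "\<dots> = ?c"
      using \<sigma> by (simp add: field_simps)
    finally show ?thesis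
      by (cases p) (auto simp: normal_density_nonneg simp flip: ennreal_mult intro!: ennreal_leI)
  qed
  have "emeasure M ((\<lambda>\<omega>. (X \<omega>, Y \<omega>)) -` ?S \<inter> space M) = (\<integral>\<^sup>+p. ?f p * indicator ?S p \<partial>(lborel \<Otimes>\<^sub>M lborel))"
    by (rule distributed_emeasure[OF joint]) (use S' in simp)
  also have "\<dots> \<le> (\<integral>\<^sup>+p. ennreal ?c * indicator ?S p \<partial>lborel)"
    unfolding lborel_prod using dens by (intro nn_integral_mono mult_right_mono) auto
  also have "\<dots> = ennreal ?c * emeasure lborel ?S"
    by (intro nn_integral_cmult_indicator) (use S in simp)
  also have "\<dots> \<le> ennreal ?c * ennreal (pi * \<epsilon>)"
    by (intro mult_left_mono emeasure_annulus_le \<epsilon>) auto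
  also have "\<dots> = ennreal (\<epsilon> / (2 * \<sigma>1 * \<sigma>2))"
    using \<sigma> \<epsilon> by (simp flip: ennreal_mult)
  also have "(\<lambda>\<omega>. (X \<omega>, Y \<omega>)) -` ?S \<inter> space M =
      {\<omega> \<in> space M. (X \<omega>)\<^sup>2 + (Y \<omega>)\<^sup>2 \<in> {a..a + \<epsilon>}}"
    by auto
  finally show ?thesis
    using \<sigma> \<epsilon> by (simp add: emeasure_eq_measure)
qed

text \<open>
  Conditioning on \<open>R\<close> merely translates the interval.
\<close>
lemma prob_add_indep_interval_le:
  fixes V R :: "'a \<Rightarrow> real"
  assumes ind: "indep_var borel V borel R"
    and V: "\<And>x. prob {\<omega> \<in> space M. V \<omega> \<in> {x..x + \<epsilon>}} \<le> c"
  shows "prob {\<omega> \<in> space M. V \<omega> + R \<omega> \<in> {x..x + \<epsilon>}} \<le> c"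
proof -
  have meas [measurable]: "V \<in> borel_measurable M" "R \<in> borel_measurable M"
    using indep_var_rv1[OF ind] indep_var_rv2[OF ind] by auto
  have c: "0 \<le> c"
    using V[of 0] measure_nonneg order_trans by blast
  interpret DV: prob_space "distr M borel V" by (rule prob_space_distr) simp
  interpret DR: prob_space "distr M borel R" by (rule prob_space_distr) simp
  interpret pair_sigma_finite "distr M borel V" "distr M borel R" ..
  let ?A = "{p :: real \<times> real. fst p + snd p \<in> {x..x + \<epsilon>}}"
  have "Measurable.pred (borel \<Otimes>\<^sub>M borel) (\<lambda>p :: real \<times> real. fst p + snd p \<in> {x..x + \<epsilon>})"
    by measurable
  then have A: "?A \<in> sets (borel \<Otimes>\<^sub>M borel)"
    by (simp add: pred_def space_pair_measure)
  have "emeasure M {\<omega> \<in> space M. V \<omega> + R \<omega> \<in> {x..x + \<epsilon>}}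
      = emeasure (distr M (borel \<Otimes>\<^sub>M borel) (\<lambda>\<omega>. (V \<omega>, R \<omega>))) ?A"
    by (subst emeasure_distr) (use A in \<open>auto intro!: arg_cong[where f = "emeasure M"]\<close>)
  also have "\<dots> = emeasure (distr M borel V \<Otimes>\<^sub>M distr M borel R) ?A"
    using ind indep_var_distribution_eq[of borel V borel R] by simp
  also have "\<dots> = (\<integral>\<^sup>+y. emeasure (distr M borel V) ((\<lambda>v. (v, y)) -` ?A) \<partial>distr M borel R)"
    by (rule emeasure_pair_measure_alt2) (use A in simp)
  also have "\<dots> \<le> (\<integral>\<^sup>+y. ennreal c \<partial>distr M borel R)"
  proof (rule nn_integral_mono)
    fix y
    have "emeasure (distr M borel V) ((\<lambda>v. (v, y)) -` ?A) = emeasure M (V -` ((\<lambda>v. (v, y)) -` ?A) \<inter> space M)"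
      by (rule emeasure_distr) (use sets_Pair2[OF A, of y] in auto)
    also have "V -` ((\<lambda>v. (v, y)) -` ?A) \<inter> space M = {\<omega> \<in> space M. V \<omega> \<in> {x - y..x - y + \<epsilon>}}"
      by auto
    also have "emeasure M \<dots> \<le> ennreal c"
      unfolding emeasure_eq_measure by (intro ennreal_leI V)
    finally show "emeasure (distr M borel V) ((\<lambda>v. (v, y)) -` ?A) \<le> ennreal c" .
  qed
  also have "\<dots> = ennreal c"
    using DR.emeasure_space_1 by simp
  finally show ?thesis
    using c by (simp add: emeasure_eq_measure)
qed

lemma prob_two_weighted_squares_interval_le:
  fixes Z1 Z2 :: "'a \<Rightarrow> real"
  assumes w: "0 < w1 * w2" and \<epsilon>: "0 \<le> \<epsilon>"
    and Z1: "distributed M lborel Z1 std_normal_density"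
    and Z2: "distributed M lborel Z2 std_normal_density"
    and ind: "indep_var borel Z1 borel Z2"
  shows "prob {\<omega> \<in> space M. w1 * (Z1 \<omega>)\<^sup>2 + w2 * (Z2 \<omega>)\<^sup>2 \<in> {x..x + \<epsilon>}}
    \<le> \<epsilon> / (2 * sqrt (w1 * w2))"
proof -
  let ?s1 = "sqrt \<bar>w1\<bar>" and ?s2 = "sqrt \<bar>w2\<bar>"
  let ?U1 = "\<lambda>\<omega>. ?s1 * Z1 \<omega>" and ?U2 = "\<lambda>\<omega>. ?s2 * Z2 \<omega>"
  have nz: "0 < ?s1" "0 < ?s2"
    using w by auto
  have U1: "distributed M lborel ?U1 (normal_density 0 ?s1)"
    using normal_density_affine[OF Z1, of ?s1 0] nz by simp
  have U2: "distributed M lborel ?U2 (normal_density 0 ?s2)"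
    using normal_density_affine[OF Z2, of ?s2 0] nz by simp
  have indU: "indep_var lborel ?U1 lborel ?U2"
    using indep_var_compose[OF ind, of "\<lambda>x. ?s1 * x" lborel "\<lambda>x. ?s2 * x" lborel] by (simp add: comp_def)
  have sq: "(?U1 \<omega>)\<^sup>2 = \<bar>w1\<bar> * (Z1 \<omega>)\<^sup>2" "(?U2 \<omega>)\<^sup>2 = \<bar>w2\<bar> * (Z2 \<omega>)\<^sup>2" for \<omega>
    by (simp_all add: power_mult_distrib)
  have bound: "prob {\<omega> \<in> space M. \<bar>w1\<bar> * (Z1 \<omega>)\<^sup>2 + \<bar>w2\<bar> * (Z2 \<omega>)\<^sup>2 \<in> {a..a + \<epsilon>}} \<le> \<epsilon> / (2 * sqrt (w1 * w2))" for a
  proof -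
    have "2 * ?s1 * ?s2 = 2 * sqrt (w1 * w2)"
      using w by (simp flip: real_sqrt_mult abs_mult)
    then show ?thesis
      using prob_sum_squares_normal_interval_le[OF nz \<epsilon> U1 U2 indU, of a] unfolding sq by (simp only:)
  qed
  show ?thesis
  proof (cases "0 < w1")
    case True
    then have "\<bar>w1\<bar> = w1" "\<bar>w2\<bar> = w2"
      using w by (auto simp: zero_less_mult_iff)
    then show ?thesis
      using bound[of x] by simp
  next
    case False
    then have "\<bar>w1\<bar> = - w1" "\<bar>w2\<bar> = - w2"
      using w by (auto simp: zero_less_mult_iff)
    then have "{\<omega> \<in> space M. w1 * (Z1 \<omega>)\<^sup>2 + w2 * (Z2 \<omega>)\<^sup>2 \<in> {x..x + \<epsilon>}}
      = {\<omega> \<in> space M. \<bar>w1\<bar> * (Z1 \<omega>)\<^sup>2 + \<bar>w2\<bar> * (Z2 \<omega>)\<^sup>2 \<in> {- x - \<epsilon>..- x - \<epsilon> + \<epsilon>}}"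
      by auto
    then show ?thesis
      using bound[of "- x - \<epsilon>"] by simp
  qed
qed

text \<open>
  A single square has an unbounded density near 0 and would give only the order \<open>sqrt \<epsilon>\<close>. Two
  squares with weights of the same sign have a bounded density, and three nonzero weights always contain such
  a pair.
\<close>
theorem weighted_chi_square_anticoncentration:
  fixes Z :: "nat \<Rightarrow> 'a \<Rightarrow> real"
  assumes q: "3 \<le> q" and w: "\<And>m. m \<in> {1..q} \<Longrightarrow> w m \<noteq> 0"
    and ind: "indep_vars (\<lambda>_. borel) Z {1..q}"
    and Z: "\<And>m. m \<in> {1..q} \<Longrightarrow> distributed M lborel (Z m) std_normal_density"
  shows "\<exists>C>0. \<forall>x. \<forall>\<epsilon>\<ge>0. prob {\<omega> \<in> space M. (\<Sum>m=1..q. w m * ((Z m \<omega>)\<^sup>2 - 1)) \<in> {x..x + \<epsilon>}} \<le> C * \<epsilon>"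
proof -
  have "\<exists>m1\<in>{1..q}. \<exists>m2\<in>{1..q}. m1 \<noteq> m2 \<and> 0 < w m1 * w m2"
  proof -
    have "w 1 \<noteq> 0" "w 2 \<noteq> 0" "w 3 \<noteq> 0"
      using w q by auto
    then have "0 < w 1 * w 2 \<or> 0 < w 1 * w 3 \<or> 0 < w 2 * w 3"
      by (auto simp: zero_less_mult_iff)
    moreover have "1 \<in> {1..q}" "2 \<in> {1..q}" "3 \<in> {1..q}" "1 \<noteq> (2 :: nat)" "1 \<noteq> (3 :: nat)" "2 \<noteq> (3 :: nat)"
      using q by auto
    ultimately show ?thesis
      by blast
  qed
  then obtain m1 m2 where m: "m1 \<in> {1..q}" "m2 \<in> {1..q}" "m1 \<noteq> m2" "0 < w m1 * w m2"
    by blast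
  let ?J1 = "{m1, m2}" and ?J2 = "{1..q} - {m1, m2}"
  let ?v = "\<lambda>z :: nat \<Rightarrow> real. w m1 * (z m1)\<^sup>2 + w m2 * (z m2)\<^sup>2"
  let ?r = "\<lambda>z :: nat \<Rightarrow> real. (\<Sum>m\<in>?J2. w m * ((z m)\<^sup>2 - 1)) - w m1 - w m2"
  have indZ: "indep_var borel (Z m1) borel (Z m2)"
    using indep_var_of_disjoint_functions[OF ind, of "{m1}" "{m2}" "\<lambda>z. z m1" "\<lambda>z. z m2"] m by simp
  have indVR: "indep_var borel (\<lambda>\<omega>. ?v (\<lambda>m. Z m \<omega>)) borel (\<lambda>\<omega>. ?r (\<lambda>m. Z m \<omega>))"
  proof (rule indep_var_of_disjoint_functions[OF ind, where ?J1.0 = ?J1 and ?J2.0 = ?J2])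
    show "?v \<in> borel_measurable (PiM ?J1 (\<lambda>_. borel))"
      by (intro borel_measurable_add borel_measurable_times borel_measurable_power
          measurable_component_singleton borel_measurable_const) auto
    show "?r \<in> borel_measurable (PiM ?J2 (\<lambda>_. borel))"
      by (intro borel_measurable_sum borel_measurable_diff borel_measurable_times borel_measurable_power
          measurable_component_singleton borel_measurable_const) auto
    show "?r (restrict z ?J2) = ?r z" for z
      by (intro arg_cong2[where f = "(-)"] sum.cong) auto
  qed (use m in auto)
  have eq: "(\<Sum>m=1..q. w m * ((Z m \<omega>)\<^sup>2 - 1)) = ?v (\<lambda>m. Z m \<omega>) + ?r (\<lambda>m. Z m \<omega>)" for \<omega>
  proof -
    have "(\<Sum>m=1..q. w m * ((Z m \<omega>)\<^sup>2 - 1))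
        = (\<Sum>m\<in>?J1. w m * ((Z m \<omega>)\<^sup>2 - 1)) + (\<Sum>m\<in>?J2. w m * ((Z m \<omega>)\<^sup>2 - 1))"
      using m by (subst sum.subset_diff[of ?J1]) auto
    then show ?thesis
      using m by (simp add: algebra_simps)
  qed
  show ?thesis
  proof (intro exI[of _ "1 / (2 * sqrt (w m1 * w m2))"] conjI allI impI)
    fix x \<epsilon> :: real assume \<epsilon>: "0 \<le> \<epsilon>"
    show "prob {\<omega> \<in> space M. (\<Sum>m=1..q. w m * ((Z m \<omega>)\<^sup>2 - 1)) \<in> {x..x + \<epsilon>}} \<le> 1 / (2 * sqrt (w m1 * w m2)) * \<epsilon>"
      unfolding eq
      by (rule prob_add_indep_interval_le[OF indVR])
         (use prob_two_weighted_squares_interval_le[OF m(4) \<epsilon> Z[OF m(1)] Z[OF m(2)] indZ] in simp)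
  qed (use m in simp)
qed

end

section \<open>A cubic spline approximating the indicator of a half-line\<close>

lemma DERIV_pos_part_power:
  assumes "2 \<le> n"
  shows "((\<lambda>x. max 0 (x - a) ^ n) has_real_derivative real n * max 0 (x - a) ^ (n - 1)) (at x)"
proof (cases x a rule: linorder_cases)
  case less
  have "((\<lambda>x. 0 :: real) has_real_derivative real n * max 0 (x - a) ^ (n - 1)) (at x)"
    using less assms by (auto simp: max_def intro!: derivative_eq_intros)
  then show ?thesis
    by (rule has_field_derivative_transform_within_open[of _ _ _ "{..<a}"])
       (use less assms in \<open>auto simp: max_def\<close>)
next
  case equal
  have "((\<lambda>y. max 0 (y - a) ^ (n - 1)) \<longlongrightarrow> max 0 (a - a) ^ (n - 1)) (at a)"
    by (intro tendsto_intros)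
  moreover have "max 0 (a - a) ^ (n - 1) = 0"
    using assms by simp
  ultimately have "((\<lambda>y. max 0 (y - a) ^ (n - 1)) \<longlongrightarrow> 0) (at a)"
    by metis
  then have "((\<lambda>y. max 0 (y - a) ^ n / (y - a)) \<longlongrightarrow> 0) (at a)"
  proof (rule Lim_null_comparison[rotated], intro always_eventually allI)
    fix y :: real
    have "max 0 (y - a) ^ n = max 0 (y - a) ^ (n - 1) * max 0 (y - a)"
      using assms by (simp add: power_eq_if[of _ n])
    then show "norm (max 0 (y - a) ^ n / (y - a)) \<le> max 0 (y - a) ^ (n - 1)"
      by (auto simp: max_def)
  qed
  then show ?thesis
    using equal assms by (simp add: has_field_derivative_iff power_0_left)
next
  case greater
  have "((\<lambda>x. (x - a) ^ n) has_real_derivative real n * max 0 (x - a) ^ (n - 1)) (at x)"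
    using greater by (auto simp: max_def intro!: derivative_eq_intros)
  then show ?thesis
    by (rule has_field_derivative_transform_within_open[of _ _ _ "{a<..}"])
       (use greater in \<open>auto simp: max_def\<close>)
qed

text \<open>
  The third divided difference of truncated cubes: it rises from 0 to 1 on \<open>{0..3}\<close> and is twice
  continuously differentiable with piecewise linear second derivative. The trivial shift by 0 keeps the four
  terms uniform.
\<close>
definition spline_step :: "real \<Rightarrow> real" where
  "spline_step u = (max 0 (u - 0) ^ 3 - 3 * max 0 (u - 1) ^ 3 + 3 * max 0 (u - 2) ^ 3 - max 0 (u - 3) ^ 3) / 6"

definition spline_step1 :: "real \<Rightarrow> real" where
  "spline_step1 u = (max 0 (u - 0) ^ 2 - 3 * max 0 (u - 1) ^ 2 + 3 * max 0 (u - 2) ^ 2 - max 0 (u - 3) ^ 2) / 2"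

definition spline_step2 :: "real \<Rightarrow> real" where
  "spline_step2 u = max 0 (u - 0) - 3 * max 0 (u - 1) + 3 * max 0 (u - 2) - max 0 (u - 3)"

lemma spline_step_eq_0: "u \<le> 0 \<Longrightarrow> spline_step u = 0"
  by (simp add: spline_step_def max_def)

lemma spline_step_eq_1: "3 \<le> u \<Longrightarrow> spline_step u = 1"
  by (simp add: spline_step_def max_def power3_eq_cube algebra_simps)

lemma smooth_test_spline_step: "smooth_test 8 spline_step spline_step1 spline_step2"
proof
  fix x :: real
  have p3: "((\<lambda>x. max 0 (x - a) ^ 3) has_real_derivative 3 * (max 0 (x - a))\<^sup>2) (at x)"
    and p2: "((\<lambda>x. max 0 (x - a) ^ 2) has_real_derivative 2 * max 0 (x - a)) (at x)" for a
    using DERIV_pos_part_power[of 3 a x] DERIV_pos_part_power[of 2 a x] by simp_all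
  have "(spline_step has_real_derivative (3 * (max 0 (x - 0))\<^sup>2 - 3 * (3 * (max 0 (x - 1))\<^sup>2)
      + 3 * (3 * (max 0 (x - 2))\<^sup>2) - 3 * (max 0 (x - 3))\<^sup>2) / 6) (at x)"
    unfolding spline_step_def[abs_def] by (intro DERIV_cdivide DERIV_diff DERIV_add DERIV_cmult p3)
  then show "(spline_step has_real_derivative spline_step1 x) (at x)"
    by (rule DERIV_cong) (simp add: spline_step1_def)
  have "(spline_step1 has_real_derivative (2 * max 0 (x - 0) - 3 * (2 * max 0 (x - 1))
      + 3 * (2 * max 0 (x - 2)) - 2 * max 0 (x - 3)) / 2) (at x)"
    unfolding spline_step1_def[abs_def] by (intro DERIV_cdivide DERIV_diff DERIV_add DERIV_cmult p2)
  then show "(spline_step1 has_real_derivative spline_step2 x) (at x)"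
    by (rule DERIV_cong) (simp add: spline_step2_def)
next
  show "\<bar>spline_step2 x\<bar> \<le> 8" for x
    unfolding spline_step2_def by (auto simp: max_def)
  show "\<bar>spline_step2 x - spline_step2 y\<bar> \<le> 8 * \<bar>x - y\<bar>" for x y
  proof -
    define d where "d a = max 0 (x - a) - max 0 (y - a)" for a :: real
    define r where "r = \<bar>x - y\<bar>"
    have d: "d a \<le> r" "- r \<le> d a" for a
      by (simp_all add: d_def r_def max_def abs_if)
    have "spline_step2 x - spline_step2 y = d 0 - 3 * d 1 + 3 * d 2 - d 3"
      by (simp only: spline_step2_def d_def) algebra
    then show ?thesis
      using d[of 0] d[of 1] d[of 2] d[of 3] unfolding r_def[symmetric] by linarith
  qed
  show "\<bar>spline_step1 x\<bar> \<le> 8" for x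
  proof (cases "3 \<le> x")
    case True
    then show ?thesis
      by (simp add: spline_step1_def max_def power2_eq_square algebra_simps)
  next
    case False
    then have "max 0 (x - 0) ^ 2 \<le> 3\<^sup>2" "max 0 (x - 1) ^ 2 \<le> 2\<^sup>2" "max 0 (x - 2) ^ 2 \<le> 1\<^sup>2"
      "max 0 (x - 3) = 0"
      using power_mono[of "max 0 (x - 0)" 3 2] power_mono[of "max 0 (x - 1)" 2 2]
        power_mono[of "max 0 (x - 2)" 1 2] by simp_all
    moreover have "\<bar>(p - 3 * q + 3 * r - 0\<^sup>2) / 2\<bar> \<le> 8"
      if "0 \<le> p" "p \<le> 3\<^sup>2" "0 \<le> q" "q \<le> 2\<^sup>2" "0 \<le> r" "r \<le> 1\<^sup>2" for p q r :: real
      using that by (simp add: abs_le_iff)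
    ultimately show ?thesis
      unfolding spline_step1_def by simp
  qed
qed

lemma spline_step_bounds: "0 \<le> spline_step u \<and> spline_step u \<le> 1"
proof -
  consider "u \<le> 0" | "0 \<le> u" "u \<le> 1" | "1 \<le> u" "u \<le> 2" | "2 \<le> u" "u \<le> 3" | "3 \<le> u"
    by linarith
  then show ?thesis
  proof cases
    case 2
    then have "spline_step u = u ^ 3 / 6"
      by (simp add: spline_step_def max_def)
    then show ?thesis
      using 2 power_le_one[of u 3] zero_le_power[of u 3] by (intro conjI; linarith)
  next
    case 3
    define v where "v = u - 1"
    have v: "0 \<le> v" "v \<le> 1" "v ^ 3 \<le> v\<^sup>2" "v ^ 3 \<le> 1"
      using 3 power_decreasing[of 2 3 v] power_le_one[of v 3] by (auto simp: v_def)
    have "u = 1 + v" "max 0 (u - 0) = 1 + v" "max 0 (u - 1) = v" "max 0 (u - 2) = 0" "max 0 (u - 3) = 0"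
      using 3 by (auto simp: v_def)
    then have "spline_step u = (1 + 3 * v + 3 * v\<^sup>2 - 2 * v ^ 3) / 6"
      unfolding spline_step_def by (simp add: power3_eq_cube power2_eq_square algebra_simps)
    moreover have "0 \<le> (1 - v)\<^sup>2 * (1 + 2 * v)"
      using v by simp
    then have "3 * v\<^sup>2 - 2 * v ^ 3 \<le> 1"
      by (simp add: power3_eq_cube power2_eq_square algebra_simps)
    moreover have "0 \<le> 1 + 3 * v + 3 * v\<^sup>2 - 2 * v ^ 3"
      using v zero_le_power2[of v] by linarith
    ultimately show ?thesis
      using v by simp
  next
    case 4
    have "max 0 (u - 0) = u" "max 0 (u - 1) = u - 1" "max 0 (u - 2) = u - 2" "max 0 (u - 3) = 0"
      using 4 by auto
    then have "spline_step u = 1 - (3 - u) ^ 3 / 6"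
      unfolding spline_step_def by (simp add: power3_eq_cube field_simps)
    then show ?thesis
      using 4 power_le_one[of "3 - u" 3] by simp
  qed (simp_all add: spline_step_eq_0 spline_step_eq_1)
qed

lemma smooth_test_affine_reflection:
  assumes "smooth_test A s s1 s2" and c: "1 \<le> c"
  shows "smooth_test (A * c ^ 3) (\<lambda>y. 1 - s (c * (y - x))) (\<lambda>y. - c * s1 (c * (y - x))) (\<lambda>y. - c\<^sup>2 * s2 (c * (y - x)))"
proof -
  interpret smooth_test A s s1 s2 by fact
  have A: "0 \<le> A" by (rule A_nonneg)
  have c3: "c \<le> c ^ 3" "c\<^sup>2 \<le> c ^ 3"
    using c power_increasing[of 1 3 c] power_increasing[of 2 3 c] by auto
  show ?thesis
  proof
    fix y
    have lin: "((\<lambda>y. c * (y - x)) has_real_derivative c) (at y)"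
      using DERIV_cmult[OF DERIV_diff[OF DERIV_ident DERIV_const], of c x y] by simp
    have "((\<lambda>y. 1 - s (c * (y - x))) has_real_derivative 0 - s1 (c * (y - x)) * c) (at y)"
      by (intro DERIV_diff DERIV_const DERIV_chain2[OF DERIV_h] lin)
    then show "((\<lambda>y. 1 - s (c * (y - x))) has_real_derivative - c * s1 (c * (y - x))) (at y)"
      by (rule DERIV_cong) simp
    have "((\<lambda>y. - c * s1 (c * (y - x))) has_real_derivative - c * (s2 (c * (y - x)) * c)) (at y)"
      by (intro DERIV_cmult DERIV_chain2[OF DERIV_h1] lin)
    then show "((\<lambda>y. - c * s1 (c * (y - x))) has_real_derivative - c\<^sup>2 * s2 (c * (y - x))) (at y)"
      by (rule DERIV_cong) (simp add: power2_eq_square)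
  next
    show "\<bar>- c * s1 (c * (y - x))\<bar> \<le> A * c ^ 3" for y
      unfolding abs_mult using h1_le c c3 A by (subst mult.commute, intro mult_mono) auto
    show "\<bar>- c\<^sup>2 * s2 (c * (y - x))\<bar> \<le> A * c ^ 3" for y
      unfolding abs_mult using h2_le c c3 A by (subst mult.commute, intro mult_mono) auto
    show "\<bar>- c\<^sup>2 * s2 (c * (y - x)) - - c\<^sup>2 * s2 (c * (z - x))\<bar> \<le> A * c ^ 3 * \<bar>y - z\<bar>" for y z
    proof -
      have "\<bar>- c\<^sup>2 * s2 (c * (y - x)) - - c\<^sup>2 * s2 (c * (z - x))\<bar> = c\<^sup>2 * \<bar>s2 (c * (z - x)) - s2 (c * (y - x))\<bar>"
        by (simp add: abs_mult flip: right_diff_distrib)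
      also have "\<dots> \<le> c\<^sup>2 * (A * \<bar>c * (z - x) - c * (y - x)\<bar>)"
        by (intro mult_left_mono h2_lipschitz) auto
      also have "c * (z - x) - c * (y - x) = c * (z - y)"
        by (simp add: algebra_simps)
      also have "c\<^sup>2 * (A * \<bar>c * (z - y)\<bar>) = A * c ^ 3 * \<bar>y - z\<bar>"
        using c by (simp add: abs_mult power2_eq_square power3_eq_cube abs_minus_commute)
      finally show ?thesis .
    qed
  qed
qed

section \<open>From smooth test functions to the Kolmogorov distance\<close>

text \<open>
  The test function at \<open>x\<close> equals 1 left of \<open>x\<close> and 0 right of \<open>x + \<epsilon>\<close>. Its expectations
  bracket the distribution functions at \<open>x\<close> and \<open>x + \<epsilon>\<close>, and by hypothesis the limit law puts
  at most mass \<open>\<eta>\<close> in between.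
\<close>
lemma kolmogorov_smoothing:
  assumes M: "prob_space M" and N: "prob_space N" and \<epsilon>: "0 < \<epsilon>"
    and F: "F \<in> borel_measurable M" and G: "G \<in> borel_measurable N"
    and smooth: "\<And>x. \<bar>(\<integral>\<omega>. 1 - spline_step (3 / \<epsilon> * (F \<omega> - x)) \<partial>M)
        - (\<integral>\<omega>. 1 - spline_step (3 / \<epsilon> * (G \<omega> - x)) \<partial>N)\<bar> \<le> \<gamma>"
    and conc: "\<And>x. measure N {\<omega> \<in> space N. G \<omega> \<in> {x..x + \<epsilon>}} \<le> \<eta>"
  shows "d_Kol M F N G \<le> \<gamma> + \<eta>"
proof -
  interpret M: prob_space M by fact
  interpret N: prob_space N by fact
  interpret S: smooth_test 8 spline_step spline_step1 spline_step2 by (rule smooth_test_spline_step)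
  define h where "h x y = 1 - spline_step (3 / \<epsilon> * (y - x))" for x y
  have [measurable]: "h x \<in> borel_measurable borel" for x
    unfolding h_def by measurable
  have h_bounds: "0 \<le> h x y" "h x y \<le> 1" for x y
    using spline_step_bounds by (auto simp: h_def)
  have h_left: "h x y = 1" if "y \<le> x" for x y
  proof -
    have "3 / \<epsilon> * (y - x) \<le> 0"
      using \<epsilon> that by (intro mult_nonneg_nonpos) auto
    then show ?thesis
      unfolding h_def by (simp only: spline_step_eq_0 diff_zero)
  qed
  have h_right: "h x y = 0" if "x + \<epsilon> \<le> y" for x y
  proof -
    have "3 / \<epsilon> * \<epsilon> \<le> 3 / \<epsilon> * (y - x)"
      using \<epsilon> that by (intro mult_left_mono) auto
    then show ?thesis
      using \<epsilon> by (simp add: h_def spline_step_eq_1)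
  qed
  have lower: "measure P {\<omega> \<in> space P. U \<omega> \<le> x} \<le> (\<integral>\<omega>. h x (U \<omega>) \<partial>P)"
    and upper: "(\<integral>\<omega>. h x (U \<omega>) \<partial>P) \<le> measure P {\<omega> \<in> space P. U \<omega> \<le> x + \<epsilon>}"
    if P: "prob_space P" and U [measurable]: "U \<in> borel_measurable P" for P :: "'c measure" and U x
  proof -
    interpret P: prob_space P by fact
    have int: "integrable P (\<lambda>\<omega>. h x (U \<omega>))"
      by (rule P.integrable_const_bound[of _ 1]) (use h_bounds in auto)
    have intI: "integrable P (indicat_real {\<omega> \<in> space P. U \<omega> \<le> z})" for z
      by (intro integrable_real_indicator) (auto simp: less_top[symmetric] P.emeasure_eq_measure)
    have "measure P {\<omega> \<in> space P. U \<omega> \<le> x} = (\<integral>\<omega>. indicat_real {\<omega> \<in> space P. U \<omega> \<le> x} \<omega> \<partial>P)"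
      by simp
    also have "\<dots> \<le> (\<integral>\<omega>. h x (U \<omega>) \<partial>P)"
      by (rule integral_mono[OF intI int]) (use h_bounds h_left in \<open>auto simp: indicator_def\<close>)
    finally show "measure P {\<omega> \<in> space P. U \<omega> \<le> x} \<le> (\<integral>\<omega>. h x (U \<omega>) \<partial>P)" .
    have "(\<integral>\<omega>. h x (U \<omega>) \<partial>P) \<le> (\<integral>\<omega>. indicat_real {\<omega> \<in> space P. U \<omega> \<le> x + \<epsilon>} \<omega> \<partial>P)"
      by (rule integral_mono[OF int intI]) (use h_bounds h_right in \<open>auto simp: indicator_def\<close>)
    then show "(\<integral>\<omega>. h x (U \<omega>) \<partial>P) \<le> measure P {\<omega> \<in> space P. U \<omega> \<le> x + \<epsilon>}"
      by simp
  qed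
  have smooth': "\<bar>(\<integral>\<omega>. h x (F \<omega>) \<partial>M) - (\<integral>\<omega>. h x (G \<omega>) \<partial>N)\<bar> \<le> \<gamma>" for x
    using smooth[of x] by (simp add: h_def)
  let ?FM = "\<lambda>x. measure M {\<omega> \<in> space M. F \<omega> \<le> x}"
  let ?FN = "\<lambda>x. measure N {\<omega> \<in> space N. G \<omega> \<le> x}"
  have window: "?FN (x + \<epsilon>) \<le> ?FN x + \<eta>" for x
  proof -
    have "?FN (x + \<epsilon>)
        \<le> measure N ({\<omega> \<in> space N. G \<omega> \<le> x} \<union> {\<omega> \<in> space N. G \<omega> \<in> {x..x + \<epsilon>}})"
      using G by (intro N.finite_measure_mono) auto
    also have "\<dots> \<le> ?FN x + measure N {\<omega> \<in> space N. G \<omega> \<in> {x..x + \<epsilon>}}"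
      using G by (intro measure_Un_le) auto
    finally show ?thesis
      using conc[of x] by linarith
  qed
  show ?thesis
    unfolding d_Kol_def
  proof (rule cSUP_least)
    fix x :: real
    have "?FM x \<le> ?FN x + (\<gamma> + \<eta>)"
      using lower[OF M F, of x] smooth'[of x] upper[OF N G, of x] window[of x] by linarith
    moreover have "?FN x \<le> ?FM x + (\<gamma> + \<eta>)"
      using upper[OF M F, of "x - \<epsilon>"] smooth'[of "x - \<epsilon>"] lower[OF N G, of "x - \<epsilon>"] window[of "x - \<epsilon>"]
      by (simp only: diff_add_cancel)
    ultimately show "\<bar>\<P>(\<omega> in M. F \<omega> \<le> x) - \<P>(\<omega> in N. G \<omega> \<le> x)\<bar> \<le> \<gamma> + \<eta>"
      by linarith
  qed simp
qed

lemma d_Kol_le_1: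
  assumes "prob_space M" "prob_space N"
  shows "d_Kol M F N G \<le> 1"
  unfolding d_Kol_def
proof (rule cSUP_least)
  fix x :: real
  have "measure M {\<omega> \<in> space M. F \<omega> \<le> x} \<in> {0..1}" "measure N {\<omega> \<in> space N. G \<omega> \<le> x} \<in> {0..1}"
    using assms by (auto intro: prob_space.prob_le_1)
  then show "\<bar>\<P>(\<omega> in M. F \<omega> \<le> x) - \<P>(\<omega> in N. G \<omega> \<le> x)\<bar> \<le> 1"
    by (simp only: atLeastAtMost_iff) linarith
qed simp

text \<open>
  In terms of these coefficients the kernel matrix is a sum of \<open>q\<close> rank one matrices, and the
  quadratic form is a weighted sum of squares of \<open>q\<close> linear forms.
\<close>
definition sample_coeff :: "(nat \<Rightarrow> real \<Rightarrow> real) \<Rightarrow> nat \<Rightarrow> nat \<Rightarrow> nat \<Rightarrow> real" where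
  "sample_coeff e n i m = e m (real i / real n) / sqrt (real n)"

lemma coeff_mat_kern:
  "coeff_mat (kern q lam e) n i j = (\<Sum>m=1..q. lam m * (sample_coeff e n i m * sample_coeff e n j m))"
  unfolding coeff_mat_def kern_def sample_coeff_def
  by (simp add: sum_distrib_left sum_divide_distrib mult.assoc)

lemma sum_squares_coeff_mat:
  "sum_squares n (coeff_mat (kern q lam e) n) =
    (\<Sum>m=1..q. \<Sum>l=1..q. lam m * lam l * (\<Sum>i=1..n. sample_coeff e n i m * sample_coeff e n i l)\<^sup>2)"
proof -
  let ?c = "sample_coeff e n"
  have "sum_squares n (coeff_mat (kern q lam e) n) =
      (\<Sum>i=1..n. \<Sum>j=1..n. \<Sum>m=1..q. \<Sum>l=1..q. lam m * lam l * ((?c i m * ?c i l) * (?c j m * ?c j l)))"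
    unfolding sum_squares_def coeff_mat_kern power2_eq_square sum_product
    by (intro sum.cong refl) (simp add: ac_simps)
  also have "\<dots> = (\<Sum>i=1..n. \<Sum>m=1..q. \<Sum>l=1..q. \<Sum>j=1..n. lam m * lam l * ((?c i m * ?c i l) * (?c j m * ?c j l)))"
    by (rule sum.cong[OF refl], subst sum.swap, rule sum.cong[OF refl], subst sum.swap, rule refl)
  also have "\<dots> = (\<Sum>m=1..q. \<Sum>l=1..q. \<Sum>i=1..n. \<Sum>j=1..n. lam m * lam l * ((?c i m * ?c i l) * (?c j m * ?c j l)))"
    by (subst sum.swap, rule sum.cong[OF refl], subst sum.swap, rule refl)
  also have "\<dots> = (\<Sum>m=1..q. \<Sum>l=1..q. lam m * lam l * (\<Sum>i=1..n. ?c i m * ?c i l)\<^sup>2)"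
    unfolding power2_eq_square sum_product by (simp only: sum_distrib_left)
  finally show ?thesis .
qed

lemma quad_form_normalized:
  fixes q n :: nat and lam :: "nat \<Rightarrow> real" and e :: "nat \<Rightarrow> real \<Rightarrow> real" and X :: "nat \<Rightarrow> 'a \<Rightarrow> real"
  assumes \<Lambda>: "0 < (\<Sum>l=1..q. (lam l)\<^sup>2)"
  defines "\<rho> \<equiv> sqrt (\<Sum>l=1..q. (lam l)\<^sup>2) / sqrt (sum_squares n (coeff_mat (kern q lam e) n))"
  shows "quad_form n (normalized_coeff n (coeff_mat (kern q lam e) n)) X \<omega> =
    \<rho> * (\<Sum>m=1..q. normalized_eigenvalue q lam m * (\<Sum>i=1..n. sample_coeff e n i m * X i \<omega>)\<^sup>2)"
proof -
  let ?c = "sample_coeff e n"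
  define s where "s = sqrt (sum_squares n (coeff_mat (kern q lam e) n))"
  have coeff: "normalized_coeff n (coeff_mat (kern q lam e) n) i j = coeff_mat (kern q lam e) n i j / s" for i j
    by (simp add: normalized_coeff_def s_def)
  have "quad_form n (normalized_coeff n (coeff_mat (kern q lam e) n)) X \<omega> =
      (\<Sum>i=1..n. \<Sum>j=1..n. \<Sum>m=1..q. lam m / s * ((?c i m * X i \<omega>) * (?c j m * X j \<omega>)))"
    unfolding quad_form_def coeff coeff_mat_kern
    by (intro sum.cong refl) (simp add: sum_divide_distrib sum_distrib_left sum_distrib_right ac_simps)
  also have "\<dots> = (\<Sum>m=1..q. \<Sum>i=1..n. \<Sum>j=1..n. lam m / s * ((?c i m * X i \<omega>) * (?c j m * X j \<omega>)))"
    by (subst (2) sum.swap, subst sum.swap, rule refl)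
  also have "\<dots> = (\<Sum>m=1..q. lam m / s * (\<Sum>i=1..n. ?c i m * X i \<omega>)\<^sup>2)"
    unfolding power2_eq_square sum_product by (simp only: sum_distrib_left)
  also have "\<dots> = (\<Sum>m=1..q. \<rho> * (normalized_eigenvalue q lam m * (\<Sum>i=1..n. ?c i m * X i \<omega>)\<^sup>2))"
    using \<Lambda> by (intro sum.cong refl) (simp add: \<rho>_def s_def normalized_eigenvalue_def)
  finally show ?thesis
    by (simp add: sum_distrib_left)
qed

lemma normalized_eigenvalue_facts:
  assumes \<Lambda>: "0 < (\<Sum>l=1..q. (lam l)\<^sup>2)"
  shows "(\<Sum>m=1..q. (normalized_eigenvalue q lam m)\<^sup>2) = 1"
    and "m \<in> {1..q} \<Longrightarrow> \<bar>normalized_eigenvalue q lam m\<bar> \<le> 1"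
proof -
  show sum: "(\<Sum>m=1..q. (normalized_eigenvalue q lam m)\<^sup>2) = 1"
    using \<Lambda> by (simp add: normalized_eigenvalue_def power_divide flip: sum_divide_distrib)
  assume "m \<in> {1..q}"
  then have "(normalized_eigenvalue q lam m)\<^sup>2 \<le> 1"
    unfolding sum[symmetric] by (intro member_le_sum) auto
  then show "\<bar>normalized_eigenvalue q lam m\<bar> \<le> 1"
    by (simp add: abs_square_le_1)
qed

text \<open>
  The sum of squares of the matrix is \<open>\<Sum>m l. lam m * lam l * (\<sigma> m l)\<^sup>2\<close> with the Gram matrix
  \<open>\<sigma>\<close>; replacing \<open>\<sigma>\<close> by the identity gives the sum of the squared eigenvalues. The smallness
  condition on \<open>d\<close> keeps the quotient of the two at least 1/2, where the inverse square root is Lipschitz.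
\<close>
lemma normalization_ratio_near_one:
  assumes \<Lambda>: "0 < (\<Sum>l=1..q. (lam l)\<^sup>2)"
    and gram: "\<And>m l. m \<in> {1..q} \<Longrightarrow> l \<in> {1..q} \<Longrightarrow>
       \<bar>(\<Sum>i=1..n. sample_coeff e n i m * sample_coeff e n i l) - (if m = l then 1 else 0)\<bar> \<le> d"
    and d: "0 \<le> d" "d \<le> 1" "6 * (real q)\<^sup>2 * d \<le> 1"
  shows "\<bar>sqrt (\<Sum>l=1..q. (lam l)\<^sup>2) / sqrt (sum_squares n (coeff_mat (kern q lam e) n)) - 1\<bar>
    \<le> 6 * (real q)\<^sup>2 * d"
proof -
  let ?\<Lambda> = "\<Sum>l=1..q. (lam l)\<^sup>2" and ?s = "sum_squares n (coeff_mat (kern q lam e) n)"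
  let ?\<sigma> = "\<lambda>m l. \<Sum>i=1..n. sample_coeff e n i m * sample_coeff e n i l"
  let ?w = "normalized_eigenvalue q lam"
  let ?id = "\<lambda>m l. if m = l then 1 else 0 :: real"
  define \<tau> where "\<tau> = ?s / ?\<Lambda>"
  have "\<tau> = (\<Sum>m=1..q. \<Sum>l=1..q. ?w m * ?w l * (?\<sigma> m l)\<^sup>2)"
    unfolding \<tau>_def sum_squares_coeff_mat using \<Lambda>
    by (simp add: normalized_eigenvalue_def sum_divide_distrib)
  moreover have "1 = (\<Sum>m=1..q. \<Sum>l=1..q. ?w m * ?w l * (?id m l)\<^sup>2)"
  proof -
    have "(\<Sum>l=1..q. ?w m * ?w l * (?id m l)\<^sup>2) = (?w m)\<^sup>2" if "m \<in> {1..q}" for m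
    proof -
      have "(\<Sum>l=1..q. ?w m * ?w l * (?id m l)\<^sup>2) = (\<Sum>l=1..q. if m = l then (?w m)\<^sup>2 else 0)"
        by (intro sum.cong) (auto simp: power2_eq_square)
      then show ?thesis
        using that by simp
    qed
    then show ?thesis
      using normalized_eigenvalue_facts(1)[OF \<Lambda>] by simp
  qed
  ultimately have "\<tau> - 1 = (\<Sum>m=1..q. \<Sum>l=1..q. ?w m * ?w l * ((?\<sigma> m l)\<^sup>2 - (?id m l)\<^sup>2))"
    by (simp add: sum_subtractf right_diff_distrib)
  then have "\<bar>\<tau> - 1\<bar> \<le> (\<Sum>m=1..q. \<Sum>l=1..q. \<bar>?w m * ?w l * ((?\<sigma> m l)\<^sup>2 - (?id m l)\<^sup>2)\<bar>)"
    by (auto intro!: order_trans[OF sum_abs] sum_mono)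
  also have "\<dots> \<le> (\<Sum>m=1..q. \<Sum>l=1..q. 3 * d)"
  proof (intro sum_mono)
    fix m l assume ml: "m \<in> {1..q}" "l \<in> {1..q}"
    have "\<bar>?\<sigma> m l + ?id m l\<bar> \<le> 3"
      using gram[OF ml] d by (auto split: if_splits)
    then have "\<bar>?\<sigma> m l - ?id m l\<bar> * \<bar>?\<sigma> m l + ?id m l\<bar> \<le> d * 3"
      using gram[OF ml] d by (intro mult_mono) auto
    moreover have "(?\<sigma> m l)\<^sup>2 - (?id m l)\<^sup>2 = (?\<sigma> m l - ?id m l) * (?\<sigma> m l + ?id m l)"
      by (simp only: power2_eq_square square_diff_square_factored mult.commute)
    ultimately have "\<bar>(?\<sigma> m l)\<^sup>2 - (?id m l)\<^sup>2\<bar> \<le> 3 * d"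
      by (simp add: abs_mult mult.commute)
    then have "\<bar>?w m * ?w l\<bar> * \<bar>(?\<sigma> m l)\<^sup>2 - (?id m l)\<^sup>2\<bar> \<le> (1 * 1) * (3 * d)"
      unfolding abs_mult[of "?w m"] using normalized_eigenvalue_facts(2)[OF \<Lambda>] ml by (intro mult_mono) auto
    then show "\<bar>?w m * ?w l * ((?\<sigma> m l)\<^sup>2 - (?id m l)\<^sup>2)\<bar> \<le> 3 * d"
      by (simp add: abs_mult)
  qed
  finally have \<tau>: "\<bar>\<tau> - 1\<bar> \<le> 3 * (real q)\<^sup>2 * d"
    by (simp add: power2_eq_square)
  then have half: "1 / 2 \<le> \<tau>"
    using d(3) by linarith
  have root: "1 / 2 \<le> sqrt \<tau>"
    by (rule real_le_rsqrt) (use half in \<open>simp add: power2_eq_square\<close>)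
  then have root_pos: "0 < sqrt \<tau>"
    by linarith
  have "sqrt ?\<Lambda> / sqrt ?s = 1 / sqrt \<tau>"
    using \<Lambda> by (simp add: \<tau>_def real_sqrt_divide)
  moreover have "\<bar>1 / sqrt \<tau> - 1\<bar> \<le> 2 * \<bar>\<tau> - 1\<bar>"
  proof -
    have "\<tau> - 1 = (sqrt \<tau> - 1) * (sqrt \<tau> + 1)"
      using half by (simp add: algebra_simps flip: power2_eq_square)
    then have "\<bar>sqrt \<tau> - 1\<bar> * 1 \<le> \<bar>\<tau> - 1\<bar>"
      using root half by (simp only: abs_mult) (intro mult_left_mono, auto)
    moreover have "1 / sqrt \<tau> - 1 = - (sqrt \<tau> - 1) / sqrt \<tau>"
      using root_pos by (simp add: diff_divide_distrib)
    then have "\<bar>1 / sqrt \<tau> - 1\<bar> = \<bar>sqrt \<tau> - 1\<bar> / sqrt \<tau>"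
      by (simp only: abs_divide abs_minus_cancel abs_of_pos[OF root_pos])
    moreover have "\<bar>sqrt \<tau> - 1\<bar> / sqrt \<tau> \<le> \<bar>sqrt \<tau> - 1\<bar> / (1 / 2)"
      using root root_pos by (intro divide_left_mono) auto
    ultimately show ?thesis
      by simp
  qed
  ultimately show ?thesis
    using \<tau> by simp
qed

text \<open>
  The number of variables is of order \<open>n\<close> and the coefficients are of order \<open>1 / sqrt n\<close>, so
  the third powers sum to order \<open>1 / sqrt n\<close> and the fourth powers to order \<open>1 / n\<close>.
\<close>
lemma path_bound_le_rate:
  assumes n: "0 < n" and root: "1 / sqrt (real n) \<le> \<delta>" and K: "0 \<le> K" and E: "1 \<le> E" and D: "0 \<le> D"
  shows "path_bound K ((q + 1) * n) q 1 (E / sqrt (real n)) B (D * \<delta>) \<le>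
    form_bound K q B * (real (q + 1) * (1 + K) * taylor_bound q 1 E + 4 * D) * \<delta>"
proof -
  \<comment> \<open>The powers of \<open>\<beta> = E * r\<close> are counted through \<open>n * r\<^sup>2 = 1\<close>.\<close>
  define r where "r = 1 / sqrt (real n)"
  have r2: "real n * r\<^sup>2 = 1" and r01: "0 \<le> r" "r \<le> 1" "r \<le> \<delta>"
    using n root by (auto simp: r_def power_divide)
  have r\<delta>: "r\<^sup>2 \<le> \<delta>"
    using mult_left_le_one_le[of r r] r01 by (simp add: power2_eq_square)
  have "real n * taylor_bound q 1 (E / sqrt (real n)) = real n * taylor_bound q 1 (E * r)"
    by (simp add: r_def)
  also have "\<dots> = (real n * r\<^sup>2) * ((16 * E ^ 3 + 8 * real q * E ^ 3) * r + 4 * (real q)\<^sup>2 * E ^ 4 * r\<^sup>2)"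
    unfolding taylor_bound_def
    by (simp add: power4_eq_xxxx power3_eq_cube power2_eq_square algebra_simps)
  also have "\<dots> \<le> (16 * E ^ 3 + 8 * real q * E ^ 3) * \<delta> + 4 * (real q)\<^sup>2 * E ^ 4 * \<delta>"
    unfolding r2 mult_1_left using r01 r\<delta> E by (intro add_mono mult_left_mono) auto
  also have "\<dots> = taylor_bound q 1 E * \<delta>"
    by (simp add: taylor_bound_def algebra_simps)
  finally have "real (q + 1) * (1 + K) * (real n * taylor_bound q 1 (E / sqrt (real n)))
      \<le> real (q + 1) * (1 + K) * (taylor_bound q 1 E * \<delta>)"
    using K by (intro mult_left_mono) auto
  then have "real ((q + 1) * n) * (1 + K) * taylor_bound q 1 (E / sqrt (real n)) + 4 * 1\<^sup>2 * (D * \<delta>)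
      \<le> (real (q + 1) * (1 + K) * taylor_bound q 1 E + 4 * D) * \<delta>"
    by (simp add: algebra_simps)
  moreover have "0 \<le> form_bound K q B"
    using K by (simp add: form_bound_def)
  ultimately show ?thesis
    unfolding path_bound_def mult.assoc[of "form_bound K q B"] by (rule mult_left_mono)
qed

text \<open>
  With \<open>\<epsilon> = n powr - (\<alpha> / 4)\<close> and \<open>\<delta> = \<epsilon> ^ 4\<close> the comparison error is of order
  \<open>\<epsilon> powr -3 * \<delta> = \<epsilon>\<close>, as is the mass of an interval of length \<open>\<epsilon>\<close>. If \<open>\<delta>\<close> is
  not small, a large constant makes the bound exceed 1.
\<close>
theorem kolmogorov_rate_holder:
  fixes X :: "nat \<Rightarrow> 'a \<Rightarrow> real" and Z :: "nat \<Rightarrow> 'b \<Rightarrow> real" and e :: "nat \<Rightarrow> real \<Rightarrow> real"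
  assumes q: "3 \<le> q" and lam: "\<forall>m\<in>{1..q}. lam m \<noteq> 0"
    and on: "orthonormal_L2 {0<..<1} {1..q} e" and \<alpha>: "0 < \<alpha>" "\<alpha> \<le> 1 / 4"
    and holder: "\<forall>m\<in>{1..q}. holder_continuous_on \<alpha> {0..1} (e m)"
    and M: "prob_space M" and X: "iid_seq M X"
    and X1: "\<forall>i\<ge>1. integrable M (X i) \<and> prob_space.expectation M (X i) = 0"
    and X2: "\<forall>i\<ge>1. prob_space.expectation M (\<lambda>\<omega>. (X i \<omega>)\<^sup>2) = 1"
    and X4: "\<forall>i\<ge>1. integrable M (\<lambda>\<omega>. (X i \<omega>) ^ 4)"
    and N: "prob_space N" and Z: "iid_seq N Z"
    and Z1: "\<forall>i\<ge>1. distributed N lborel (Z i) std_normal_density"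
  shows "\<exists>C>0. \<forall>n>0.
    d_Kol M (\<lambda>\<omega>. quad_form n (normalized_coeff n (coeff_mat (kern q lam e) n)) X \<omega>
        - prob_space.expectation M (quad_form n (normalized_coeff n (coeff_mat (kern q lam e) n)) X))
      N (Q_limit q lam Z) \<le> C * real n powr - (\<alpha> / 4)"
proof -
  interpret M: prob_space M by fact
  interpret N: prob_space N by fact
  have \<Lambda>: "0 < (\<Sum>l=1..q. (lam l)\<^sup>2)"
    using lam q by (intro sum_pos) auto
  obtain D where D: "0 < D" and gram0: "\<forall>n>0. \<forall>m\<in>{1..q}. \<forall>l\<in>{1..q}.
     \<bar>(\<Sum>i=1..n. e m (real i / real n) * e l (real i / real n)) / real n - (if m = l then 1 else 0)\<bar>
       \<le> D * real n powr - \<alpha>"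
    using gram_matrix_riemann_error[OF \<alpha>(1) on holder] by blast
  obtain E0 where E0: "\<forall>m\<in>{1..q}. \<forall>x\<in>{0..1}. \<bar>e m x\<bar> \<le> E0"
    using holder_family_bounded[OF \<alpha>(1) holder] by blast
  define E where "E = max 1 E0"
  define K where "K = max 3 (M.expectation (\<lambda>\<omega>. (X 1 \<omega>) ^ 4))"
  define B where "B = real (q + 1) * E\<^sup>2"
  let ?w = "normalized_eigenvalue q lam"
  have indX: "M.indep_vars (\<lambda>_. borel) X {1..}" and indZ': "N.indep_vars (\<lambda>_. borel) Z {1..}"
    using X Z unfolding iid_seq_def by blast+
  have sameX: "distr M borel (X i) = distr M borel (X 1)" if "1 \<le> i" for i
    using X that unfolding iid_seq_def by blast
  have rvX: "X i \<in> borel_measurable M" if "1 \<le> i" for i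
    using indX that by (auto simp: M.indep_vars_def)
  have indZ: "N.indep_vars (\<lambda>_. borel) Z {1..q}"
    by (rule N.indep_vars_subset[OF indZ']) auto
  have normalZ: "distr N borel (Z m) = std_normal_distribution" if "m \<in> {1..q}" for m
  proof -
    have "distr N lborel (Z m) = distr N borel (Z m)"
      by (rule distr_cong) auto
    then show ?thesis
      using Z1 that by (auto simp: distributed_def)
  qed
  obtain Ca where Ca: "0 < Ca" and conc: "\<And>x \<epsilon>. 0 \<le> \<epsilon> \<Longrightarrow>
      N.prob {\<omega> \<in> space N. Q_limit q lam Z \<omega> \<in> {x..x + \<epsilon>}} \<le> Ca * \<epsilon>"
  proof -
    have "?w m \<noteq> 0" if "m \<in> {1..q}" for m
      using lam that \<Lambda> by (simp add: normalized_eigenvalue_def)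
    then show ?thesis
      using N.weighted_chi_square_anticoncentration[OF q _ indZ, of ?w] Z1 that
      unfolding Q_limit_def by auto
  qed
  have fam: "unit_indep_family M X {1..n} K" for n
  proof
    show "M.indep_vars (\<lambda>_. borel) X {1..n}"
      by (rule M.indep_vars_subset[OF indX]) auto
    fix i assume i: "i \<in> {1..n}"
    have "M.expectation (\<lambda>\<omega>. (X i \<omega>) ^ 4) = M.expectation (\<lambda>\<omega>. (X 1 \<omega>) ^ 4)"
      using integral_distr[OF rvX[of i], of "\<lambda>x. x ^ 4"] integral_distr[OF rvX[of 1], of "\<lambda>x. x ^ 4"]
        sameX[of i] i by simp
    then show "M.expectation (\<lambda>\<omega>. (X i \<omega>) ^ 4) \<le> K"
      by (simp add: K_def)
  qed (use X1 X2 X4 in \<open>auto simp: K_def\<close>)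
  have K0: "3 \<le> K" and E1: "1 \<le> E"
    by (simp_all add: K_def E_def)
  define C0 where "C0 = 6 * (real q)\<^sup>2 * D * (2 * real q * B) + 2 * (real q * E\<^sup>2 * sqrt (K * real (q + 1)))
    + 2 * (form_bound K q B * (real (q + 1) * (1 + K) * taylor_bound q 1 E + 4 * D))"
  have C0: "0 \<le> C0"
    unfolding C0_def B_def form_bound_def taylor_bound_def using K0 E1 D by (intro add_nonneg_nonneg mult_nonneg_nonneg) auto
  \<comment> \<open>The factor 216 is the bound 8 for the derivatives of the spline times the cube of the rescaling 3; the
    last summand serves those \<open>n\<close> for which the Gram matrix is not yet close to the identity.\<close>
  define C where "C = 216 * C0 + Ca + (6 * (real q)\<^sup>2 + 1) * D"
  have Cpos: "0 < C"
    unfolding C_def using C0 Ca D by (intro add_nonneg_pos add_pos_pos mult_pos_pos) auto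
  show ?thesis
  proof (intro exI[of _ C] conjI allI impI Cpos)
    fix n :: nat assume n: "0 < n"
    let ?a = "coeff_mat (kern q lam e) n"
    let ?Q = "quad_form n (normalized_coeff n ?a) X"
    let ?c = "sample_coeff e n"
    define \<rho> where "\<rho> = sqrt (\<Sum>l=1..q. (lam l)\<^sup>2) / sqrt (sum_squares n ?a)"
    define F where "F \<omega> = \<rho> * (\<Sum>m=1..q. ?w m * ((\<Sum>i=1..n. ?c i m * X i \<omega>)\<^sup>2 - (\<Sum>i=1..n. (?c i m)\<^sup>2)))" for \<omega>
    interpret fam: unit_indep_family M X "{1..n}" K by (rule fam)
    have Qn: "?Q = (\<lambda>\<omega>. \<rho> * (\<Sum>m=1..q. ?w m * (\<Sum>i=1..n. ?c i m * X i \<omega>)\<^sup>2))"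
      unfolding \<rho>_def using quad_form_normalized[OF \<Lambda>] by (intro ext)
    have EQn: "M.expectation (?Q) = \<rho> * (\<Sum>m=1..q. ?w m * (\<Sum>i=1..n. (?c i m)\<^sup>2))"
      unfolding Qn using fam.expectation_lin_form_square[where b = ?c] by (simp add: lin_form_def)
    have F_eq: "(\<lambda>\<omega>. ?Q \<omega>
        - M.expectation (?Q)) = F"
      unfolding EQn unfolding Qn F_def by (simp add: fun_eq_iff right_diff_distrib sum_subtractf)
    have Fmeas: "F \<in> borel_measurable M"
      unfolding F_def[abs_def] using rvX by (intro arith_measurable) auto
    have Gmeas: "Q_limit q lam Z \<in> borel_measurable N"
      unfolding Q_limit_def[abs_def] using indZ by (intro arith_measurable) (auto simp: N.indep_vars_def)
    define \<epsilon> where "\<epsilon> = real n powr - (\<alpha> / 4)"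
    define \<delta> where "\<delta> = real n powr - \<alpha>"
    have \<epsilon>: "0 < \<epsilon>" "\<epsilon> \<le> 1"
      using n \<alpha> powr_mono[of "- (\<alpha> / 4)" 0 "real n"] by (auto simp: \<epsilon>_def)
    have \<delta>\<epsilon>: "\<delta> = \<epsilon> ^ 4"
      using n by (simp add: \<delta>_def \<epsilon>_def powr_power)
    have \<delta>: "0 < \<delta>" "\<delta> \<le> \<epsilon>"
      using \<epsilon> power_decreasing[of 1 4 \<epsilon>] by (auto simp: \<delta>\<epsilon>)
    have root: "1 / sqrt (real n) \<le> \<delta>"
    proof -
      have "1 / sqrt (real n) = real n powr - (1 / 2)"
        using n by (simp add: powr_minus_divide powr_half_sqrt)
      also have "\<dots> \<le> \<delta>"
        unfolding \<delta>_def using n \<alpha> by (intro powr_mono) auto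
      finally show ?thesis .
    qed
    show "d_Kol M (\<lambda>\<omega>. ?Q \<omega>
        - M.expectation (?Q)) N (Q_limit q lam Z) \<le> C * real n powr - (\<alpha> / 4)"
      unfolding F_eq \<epsilon>_def[symmetric]
    proof (cases "(6 * (real q)\<^sup>2 + 1) * D * \<delta> \<le> 1")
      case False
      have "1 \<le> (6 * (real q)\<^sup>2 + 1) * D * \<delta>"
        using False by simp
      also have "\<dots> \<le> (6 * (real q)\<^sup>2 + 1) * D * \<epsilon>"
        using \<delta> D by (intro mult_left_mono mult_nonneg_nonneg) auto
      also have "\<dots> \<le> C * \<epsilon>"
        using \<epsilon> C0 Ca by (intro mult_right_mono) (auto simp: C_def)
      finally show "d_Kol M F N (Q_limit q lam Z) \<le> C * \<epsilon>"
        using d_Kol_le_1[OF M N, of F "Q_limit q lam Z"] by linarith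
    next
      case True
      define d where "d = D * \<delta>"
      have "6 * (real q)\<^sup>2 * d + d \<le> 1" "0 \<le> 6 * (real q)\<^sup>2 * d"
        using True D \<delta> by (auto simp: d_def algebra_simps)
      moreover have d0: "0 \<le> d"
        using D \<delta> by (simp add: d_def)
      ultimately have d: "d \<le> 1" "6 * (real q)\<^sup>2 * d \<le> 1"
        by linarith+
      have gram: "\<bar>(\<Sum>i=1..n. ?c i m * ?c i l) - (if m = l then 1 else 0)\<bar> \<le> d"
        if "m \<in> {1..q}" "l \<in> {1..q}" for m l
      proof -
        have "(\<Sum>i=1..n. ?c i m * ?c i l) = (\<Sum>i=1..n. e m (real i / real n) * e l (real i / real n)) / real n"
          by (simp add: sample_coeff_def sum_divide_distrib)
        then show ?thesis
          using gram0 n that by (simp add: d_def \<delta>_def)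
      qed
      have \<rho>: "\<bar>\<rho> - 1\<bar> \<le> 6 * (real q)\<^sup>2 * d"
        unfolding \<rho>_def by (rule normalization_ratio_near_one[OF \<Lambda> gram d0 d])
      define \<beta> where "\<beta> = E / sqrt (real n)"
      have c: "\<bar>?c i m\<bar> \<le> \<beta>" if "i \<in> {1..n}" "m \<in> {1..q}" for i m
      proof -
        have "\<bar>e m (real i / real n)\<bar> \<le> E"
          using E0 that n by (auto simp: E_def intro: max.coboundedI2)
        then show ?thesis
          by (simp add: sample_coeff_def \<beta>_def abs_divide divide_right_mono)
      qed
      have \<beta>: "1 / sqrt (real n) \<le> \<beta>"
        unfolding \<beta>_def using E1 by (intro divide_right_mono) auto
      have \<beta>2: "\<beta>\<^sup>2 = E\<^sup>2 / real n"
        by (simp add: \<beta>_def power_divide)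
      have B: "real ((q + 1) * n) * \<beta>\<^sup>2 \<le> B"
        using n by (simp add: \<beta>2 B_def field_simps)
      have "\<beta>\<^sup>2 * sqrt (K * real ((q + 1) * n)) = E\<^sup>2 * sqrt (K * real (q + 1)) * (sqrt (real n) / real n)"
        unfolding \<beta>2 of_nat_mult real_sqrt_mult by simp
      also have "sqrt (real n) / real n = 1 / sqrt (real n)"
        using n by (simp add: real_div_sqrt field_simps)
      also have "E\<^sup>2 * sqrt (K * real (q + 1)) * (1 / sqrt (real n)) \<le> E\<^sup>2 * sqrt (K * real (q + 1)) * \<delta>"
        using root K0 by (intro mult_left_mono) auto
      finally have t2: "2 * (real q * \<beta>\<^sup>2 * sqrt (K * real ((q + 1) * n))) \<le> 2 * (real q * E\<^sup>2 * sqrt (K * real (q + 1))) * \<delta>"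
        using mult_left_mono[of _ _ "2 * real q"] by (simp add: mult.assoc)
      have t1: "\<bar>\<rho> - 1\<bar> * (2 * real q * B) \<le> 6 * (real q)\<^sup>2 * D * (2 * real q * B) * \<delta>"
      proof -
        have "\<bar>\<rho> - 1\<bar> * (2 * real q * B) \<le> 6 * (real q)\<^sup>2 * d * (2 * real q * B)"
          using \<rho> by (intro mult_right_mono) (auto simp: B_def)
        then show ?thesis
          by (simp add: d_def ac_simps)
      qed
      have t3: "2 * path_bound K ((q + 1) * n) q 1 \<beta> B d \<le>
          2 * (form_bound K q B * (real (q + 1) * (1 + K) * taylor_bound q 1 E + 4 * D)) * \<delta>"
        using path_bound_le_rate[OF n root _ E1, of K D q B] K0 D unfolding \<beta>_def d_def by simp
      have total: "comparison_error K ((q + 1) * n) q \<rho> \<beta> B d \<le> C0 * \<delta>"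
        using t1 t2 t3 unfolding C0_def comparison_error_def distrib_right by linarith
      have "d_Kol M F N (Q_limit q lam Z) \<le> 216 * C0 * \<epsilon> + Ca * \<epsilon>"
      proof (rule kolmogorov_smoothing[OF M N \<epsilon>(1) Fmeas Gmeas])
        show "N.prob {\<omega> \<in> space N. Q_limit q lam Z \<omega> \<in> {x..x + \<epsilon>}} \<le> Ca * \<epsilon>" for x
          using \<epsilon> by (intro conc) auto
        fix x
        let ?h = "\<lambda>y. 1 - spline_step (3 / \<epsilon> * (y - x))"
        have "1 \<le> 3 / \<epsilon>"
          using \<epsilon> by simp
        note test = smooth_test_affine_reflection[OF smooth_test_spline_step this, of x]
        have h1: "\<bar>?h y\<bar> \<le> 1" for y
          using spline_step_bounds[of "3 / \<epsilon> * (y - x)"] by auto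
        have "\<bar>(\<integral>\<omega>. ?h (F \<omega>) \<partial>M) - (\<integral>\<omega>. ?h (Q_limit q lam Z \<omega>) \<partial>N)\<bar> \<le> 8 * (3 / \<epsilon>) ^ 3 *
           comparison_error K ((q + 1) * n) q \<rho> \<beta> B d"
          unfolding F_def Q_limit_def
          using q by (intro quadratic_form_gaussian_comparison[where \<mu> = "distr M borel (X 1)", OF fam n _ _ N indZ normalZ test h1
                normalized_eigenvalue_facts(2)[OF \<Lambda>] c \<beta> B d0 gram] sameX) auto
        also have "\<dots> \<le> 8 * (3 / \<epsilon>) ^ 3 * (C0 * \<delta>)"
          using total \<epsilon> by (intro mult_left_mono) auto
        also have "\<dots> = 216 * C0 * \<epsilon>"
          using \<epsilon> by (simp add: \<delta>\<epsilon> power_divide power3_eq_cube power4_eq_xxxx)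
        finally show "\<bar>(\<integral>\<omega>. ?h (F \<omega>) \<partial>M) - (\<integral>\<omega>. ?h (Q_limit q lam Z \<omega>) \<partial>N)\<bar> \<le> 216 * C0 * \<epsilon>" .
      qed
      also have "\<dots> \<le> C * \<epsilon>"
        using \<epsilon> D unfolding C_def by (simp add: distrib_right)
      finally show "d_Kol M F N (Q_limit q lam Z) \<le> C * \<epsilon>" .
    qed
  qed
qed

text \<open>
  Hoelder continuity of order \<open>\<alpha>\<close> on the unit interval implies that of order
  \<open>min \<alpha> (1 / 4)\<close>, whose rate is one of the two terms of the bound.
\<close>
theorem theorem3p1:
  fixes q :: nat and lam :: "nat \<Rightarrow> real" and e :: "nat \<Rightarrow> real \<Rightarrow> real" and \<alpha> :: real
    and M :: "'a measure" and X :: "nat \<Rightarrow> 'a \<Rightarrow> real"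
    and N :: "'b measure" and Z :: "nat \<Rightarrow> 'b \<Rightarrow> real"
  defines "a \<equiv> coeff_mat (kern q lam e)"
  defines "Qn \<equiv> (\<lambda>n. quad_form n (normalized_coeff n (a n)) X)"
  assumes "q \<ge> 3"
    and "inj_on lam {1..q}" and "\<forall>m\<in>{1..q}. lam m \<noteq> 0"
    and "inj_on e {1..q}" and "orthonormal_L2 {0<..<1} {1..q} e"
    and "0 < \<alpha>" and "\<alpha> \<le> 1"
    and "\<forall>m\<in>{1..q}. holder_continuous_on \<alpha> {0..1} (e m)"
    and "prob_space M" and "iid_seq M X"
    and "\<forall>i\<ge>1. integrable M (X i) \<and> prob_space.expectation M (X i) = 0"
    and "\<forall>i\<ge>1. prob_space.expectation M (\<lambda>\<omega>. (X i \<omega>)\<^sup>2) = 1"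
    and "\<forall>i\<ge>1. integrable M (\<lambda>\<omega>. (X i \<omega>) ^ 4)"
    and "prob_space N" and "iid_seq N Z"
    and "\<forall>i\<ge>1. distributed N lborel (Z i) std_normal_density"
  shows "\<exists>C1>0. \<exists>C2>0. \<forall>n. sum_squares n (a n) \<noteq> 0 \<longrightarrow>
           d_Kol M (\<lambda>\<omega>. Qn n \<omega> - prob_space.expectation M (Qn n)) N (Q_limit q lam Z)
             \<le> C1 / real n powr (1 / 16) + C2 / real n powr (\<alpha> / 4)"
proof -
  define \<alpha>' where "\<alpha>' = min \<alpha> (1 / 4)"
  have \<alpha>': "0 < \<alpha>'" "\<alpha>' \<le> 1 / 4" "\<alpha>' \<le> \<alpha>"
    using \<open>0 < \<alpha>\<close> by (auto simp: \<alpha>'_def)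
  have holder': "\<forall>m\<in>{1..q}. holder_continuous_on \<alpha>' {0..1} (e m)"
    using \<open>\<forall>m\<in>{1..q}. holder_continuous_on \<alpha> {0..1} (e m)\<close> \<alpha>' by (blast intro: holder_mono)
  have "\<exists>C>0. \<forall>n>0. d_Kol M (\<lambda>\<omega>. Qn n \<omega> - prob_space.expectation M (Qn n)) N (Q_limit q lam Z)
      \<le> C * real n powr - (\<alpha>' / 4)"
    unfolding Qn_def a_def by (rule kolmogorov_rate_holder) (fact assms \<alpha>' holder')+
  then obtain C where C: "0 < C" and rate: "\<And>n. 0 < n \<Longrightarrow>
      d_Kol M (\<lambda>\<omega>. Qn n \<omega> - prob_space.expectation M (Qn n)) N (Q_limit q lam Z)
      \<le> C * real n powr - (\<alpha>' / 4)"
    by blast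
  show ?thesis
  proof (intro exI[of _ C] conjI C allI impI)
    fix n assume "sum_squares n (a n) \<noteq> 0"
    then have "0 < n"
      by (cases n) (auto simp: sum_squares_def)
    have "C * real n powr - (\<alpha>' / 4) = C / real n powr (\<alpha>' / 4)"
      by (simp add: powr_minus_divide)
    also have "\<dots> \<le> C / real n powr (1 / 16) + C / real n powr (\<alpha> / 4)"
      using C by (cases "\<alpha> \<le> 1 / 4") (simp_all add: \<alpha>'_def)
    finally show "d_Kol M (\<lambda>\<omega>. Qn n \<omega> - prob_space.expectation M (Qn n)) N (Q_limit q lam Z)
        \<le> C / real n powr (1 / 16) + C / real n powr (\<alpha> / 4)"
      using rate[OF \<open>0 < n\<close>] by linarith
  qed
qed

end
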